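(* Let $\kappa\in(0,2]$, $c_{\widehat Y}>0$, let $\widehat{Y}\in\mathbf{S}(\kappa,\kappa,c_{\widehat{Y}})$ and let $x\ge 0$. Then $$\mathcal{B}_{\widehat{Y}}(x)=c_{\widehat{Y}}^{1/\kappa}\,\mathcal{B}_{B_{\kappa}}\bigl(c_{\widehat{Y}}^{1/\kappa}x\bigr)\in(0,\infty).$$
   Context: For a centered Gaussian process $Y(t)$, $t\ge0$, write $V_Y(t,s)=\mathrm{Var}(Y(t)-Y(s))$ and $V_Y(t)=V_Y(t,1)=\mathrm{Var}(Y(1)-Y(t))$. For $\alpha>0$, $\kappa\in(0,2]$, $c_Y>0$, the notation $Y\in\mathbf{S}(\alpha,\kappa,c_Y)$ means that $Y(t)$, $t\ge 0$, is a centered Gaussian process with a.s. continuous sample paths such that: (S1) $Y$ is self-similar with index $\alpha/2$ (i.e. for every $\lambda>0$ the processes $(Y(\lambda t))_{t\ge0}$ and $(\lambda^{\alpha/2}Y(t))_{t\ge0}$ have the same law) and $\mathrm{Var}(Y(1))=1$; (S2) $V_Y(1-h)\sim c_Y|h|^{\kappa}$ as $h\to0$ (the ratio of the two sides tends to $1$). $B_\kappa$ denotes a standard fractional Brownian motion with $\mathrm{Var}(B_\kappa(t)-B_\kappa(s))=|t-s|^\kappa$, $s,t\ge0$ (centered Gaussian, continuous paths, $B_\kappa(0)=0$). For a centered Gaussian process $\zeta(t)$, $t\ge 0$, with a.s. continuous sample paths and $x\ge0$, the Berman constant is $$\mathcal{B}_{\zeta}(x)=\lim_{T\to\infty}\frac1T\int_{\mathbb{R}}\mathbb{P}\left\{\int_0^T\mathbb{I}\left(\sqrt2\,\zeta(t)-\mathrm{Var}(\zeta(t))+y>0\right)dt>x\right\}e^{-y}\,dy,$$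 where $\mathbb{I}(\cdot)$ is the indicator function; the assertion includes that the limits exist. *)

theory Defs
  imports "HOL-Probability.Probability" "HOL-Library.Landau_Symbols"
begin

text \<open>
  A process indexed by \<open>t \<ge> 0\<close> is a function \<open>Y :: real \<Rightarrow> 'a \<Rightarrow> real\<close>; its values at
  negative times are never used.
\<close>

text \<open>The normal law with standard deviation 0 is the point mass at 0.\<close>

definition centered_normal :: "'a measure \<Rightarrow> ('a \<Rightarrow> real) \<Rightarrow> bool" where
  "centered_normal M Z \<longleftrightarrow>
     (AE \<omega> in M. Z \<omega> = 0) \<or> (\<exists>\<sigma>>0. distributed M lborel Z (normal_density 0 \<sigma>))"

definition centered_gaussian_process :: "'a measure \<Rightarrow> (real \<Rightarrow> 'a \<Rightarrow> real) \<Rightarrow> bool" where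
  "centered_gaussian_process M Y \<longleftrightarrow>
     prob_space M \<and>
     (\<forall>t\<ge>0. Y t \<in> borel_measurable M) \<and>
     (\<forall>J a. finite J \<and> J \<subseteq> {0..} \<longrightarrow> centered_normal M (\<lambda>\<omega>. \<Sum>t\<in>J. a t * Y t \<omega>))"

definition ae_continuous_paths :: "'a measure \<Rightarrow> (real \<Rightarrow> 'a \<Rightarrow> real) \<Rightarrow> bool" where
  "ae_continuous_paths M Y \<longleftrightarrow> (AE \<omega> in M. continuous_on {0..} (\<lambda>t. Y t \<omega>))"

definition process_law :: "'a measure \<Rightarrow> (real \<Rightarrow> 'a \<Rightarrow> real) \<Rightarrow> (real \<Rightarrow> real) measure" where
  "process_law M Y =
     distr M (\<Pi>\<^sub>M t\<in>{0..}. borel) (\<lambda>\<omega>. \<lambda>t\<in>{0..}. Y t \<omega>)"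

definition self_similar :: "'a measure \<Rightarrow> (real \<Rightarrow> 'a \<Rightarrow> real) \<Rightarrow> real \<Rightarrow> bool" where
  "self_similar M Y H \<longleftrightarrow>
     (\<forall>l>0. process_law M (\<lambda>t. Y (l * t)) = process_law M (\<lambda>t \<omega>. l powr H * Y t \<omega>))"

definition incr_variance :: "'a measure \<Rightarrow> (real \<Rightarrow> 'a \<Rightarrow> real) \<Rightarrow> real \<Rightarrow> real \<Rightarrow> real" where
  "incr_variance M Y t s = prob_space.variance M (\<lambda>\<omega>. Y t \<omega> - Y s \<omega>)"

definition S_class ::
  "'a measure \<Rightarrow> (real \<Rightarrow> 'a \<Rightarrow> real) \<Rightarrow> real \<Rightarrow> real \<Rightarrow> real \<Rightarrow> bool" where
  "S_class M Y \<alpha> \<kappa> c \<longleftrightarrow>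
     centered_gaussian_process M Y \<and> ae_continuous_paths M Y \<and>
     self_similar M Y (\<alpha> / 2) \<and> prob_space.variance M (Y 1) = 1 \<and>
     (\<lambda>h. incr_variance M Y (1 - h) 1) \<sim>[at 0] (\<lambda>h. c * \<bar>h\<bar> powr \<kappa>)"

definition standard_fBm :: "'a measure \<Rightarrow> (real \<Rightarrow> 'a \<Rightarrow> real) \<Rightarrow> real \<Rightarrow> bool" where
  "standard_fBm M B \<kappa> \<longleftrightarrow>
     centered_gaussian_process M B \<and> ae_continuous_paths M B \<and>
     (AE \<omega> in M. B 0 \<omega> = 0) \<and>
     (\<forall>t\<ge>0. \<forall>s\<ge>0. incr_variance M B t s = \<bar>t - s\<bar> powr \<kappa>)"

definition sojourn ::
  "'a measure \<Rightarrow> (real \<Rightarrow> 'a \<Rightarrow> real) \<Rightarrow> real \<Rightarrow> real \<Rightarrow> 'a \<Rightarrow> real" where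
  "sojourn M \<zeta> T y \<omega> =
     (LBINT t:{0..T}.
        indicat_real {t. sqrt 2 * \<zeta> t \<omega> - prob_space.variance M (\<zeta> t) + y > 0} t)"

text \<open>
  Paths are continuous only outside a null set, so the event below need not belong to
  \<open>sets M\<close>; it does belong to the completion of \<open>M\<close>. The integral over \<open>y\<close> is taken in
  \<open>[0, \<infinity>]\<close>, so that no finiteness is presupposed.
\<close>

definition berman_mean ::
  "'a measure \<Rightarrow> (real \<Rightarrow> 'a \<Rightarrow> real) \<Rightarrow> real \<Rightarrow> real \<Rightarrow> ennreal" where
  "berman_mean M \<zeta> x T =
     ennreal (1 / T) *
     (\<integral>\<^sup>+ y. ennreal (measure (completion M) {\<omega> \<in> space M. sojourn M \<zeta> T y \<omega> > x} * exp (- y))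
        \<partial>lborel)"

definition berman_exists :: "'a measure \<Rightarrow> (real \<Rightarrow> 'a \<Rightarrow> real) \<Rightarrow> real \<Rightarrow> bool" where
  "berman_exists M \<zeta> x \<longleftrightarrow> (\<exists>L. (berman_mean M \<zeta> x \<longlongrightarrow> L) at_top)"

definition berman :: "'a measure \<Rightarrow> (real \<Rightarrow> 'a \<Rightarrow> real) \<Rightarrow> real \<Rightarrow> ennreal" where
  "berman M \<zeta> x = Lim at_top (berman_mean M \<zeta> x)"

end

theory Submission
  imports Defs "HOL-Complex_Analysis.Conformal_Mappings" "HOL-Real_Asymp.Real_Asymp"
begin

text \<open>
  For a centred Gaussian process \<open>Z\<close> put \<open>W t = sqrt 2 * Z t - Var (Z t)\<close>, so that \<open>exp (W t)\<close> has
  mean 1. The integral in the Berman mean is the measure of a set of paths under the infinite measure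
  \<open>mu = exp (- y) dy \<otimes> P\<close> on pairs \<open>(y, \<omega>)\<close>, whose path is \<open>w = W + y\<close>: the paths that spend more than
  time \<open>x\<close> above zero during \<open>[0, T]\<close>. The substitution \<open>y = z - W t\<close> shows what \<open>mu\<close> looks like from a
  time \<open>t\<close>: the value \<open>z\<close> of the path at \<open>t\<close> has density \<open>exp (- z)\<close>, and independently of it the
  increments after \<open>t\<close> have their law under the tilted measure \<open>Q t = exp (W t) P\<close>
  (\<open>nn_integral_mu\<close>). Under \<open>Q t\<close> these increments are Gaussian with a law that depends only on the
  variogram \<open>V s t = Var (Z s - Z t)\<close> (\<open>tilted_increments_char\<close>).

  For the self-similar process, (S2) implies that \<open>V (r + s) (r + t)\<close> tends to
  \<open>c * \<bar>s - t\<bar> powr \<kappa>\<close> as \<open>r\<close> tends to infinity, and \<open>c * \<bar>s - t\<bar> powr \<kappa>\<close> is the variogram of the dilated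
  fractional Brownian motion \<open>B (c powr (1 / \<kappa>) * t)\<close>. Seen from late times the two processes are
  therefore indistinguishable, and the theorem follows once the rate of exceedances is known to be
  an average of such local quantities. The dilation itself is an exact change of variables and
  produces the factors \<open>c powr (1 / \<kappa>)\<close>.

  Localisation rests on an identity of calculus. If \<open>K t T\<close> is the integral of \<open>g (w s)\<close> over
  \<open>[t, T]\<close> and \<open>\<psi>\<close> is a differentiable function with \<open>\<psi> 0 = 0\<close> and derivative \<open>\<rho>\<close>, then
  \<open>\<psi> (K 0 T)\<close> is the integral over \<open>t\<close> of \<open>g (w t) * \<rho> (K t T)\<close> (\<open>threshold_occupation\<close>). Taking for \<open>g\<close> a
  continuous ramp and for \<open>\<psi>\<close> a smooth threshold near \<open>x\<close>, the measure of \<open>\<psi> (K 0 T)\<close> becomes a time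
  integral of functionals of the path after \<open>t\<close>. As \<open>V\<close> grows like a power, the path rarely returns
  above zero, so only a bounded window after \<open>t\<close> matters (\<open>truncate_future\<close>); the functional of the
  window converges to that of the reference process by the method of moments, because an
  occupation time of a bounded window is bounded (\<open>occupation_tendsto\<close>). Averaging over \<open>t\<close> gives
  \<open>threshold_mean_asymptotics\<close>.

  The smoothing has to be removed for every \<open>x \<ge> 0\<close>. Raising all paths by \<open>a\<close> multiplies \<open>mu\<close> by
  \<open>exp a\<close>, so a small change of level is cheap. A path with sojourn time above \<open>x\<close> that fails to exceed
  the smoothed threshold even after being raised must cross the strip \<open>(- \<epsilon>, 0)\<close> in very short time,
  and such paths have small measure per unit of time: a chaining argument reduces positivity
  somewhere to values on a grid (\<open>chaining_cell\<close>), and from a grid point on the path needs a definite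
  time to cross the strip (\<open>narrow_excursions_rare\<close>). Finiteness of the limit comes from the same chaining
  bound, and positivity from a second moment estimate (\<open>sojourn_exceedance_lower_bound\<close>).
\<close>

section \<open>Exponential moments of Gaussian variables\<close>

lemma borel_measurable_cis [measurable]: "cis \<in> borel_measurable borel"
  unfolding cis_conv_exp[abs_def] by (intro borel_measurable_continuous_onI continuous_intros)

context prob_space begin

lemma centered_normal_exp:
  assumes "centered_normal M N" and [measurable]: "N \<in> borel_measurable M"
  shows "integrable M (\<lambda>x. (N x)\<^sup>2)" "integrable M N" "expectation N = 0"
    "integrable M (\<lambda>x. exp (N x))" 
    "expectation (\<lambda>x. exp (N x)) = exp (expectation (\<lambda>x. (N x)\<^sup>2) / 2)"
    "expectation (\<lambda>x. cis (N x)) = exp (- complex_of_real (expectation (\<lambda>x. (N x)\<^sup>2) / 2))"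
proof -
  have "integrable M (\<lambda>x. (N x)\<^sup>2) \<and> integrable M N \<and> expectation N = 0 \<and>
    integrable M (\<lambda>x. exp (N x)) \<and>
    expectation (\<lambda>x. exp (N x)) = exp (expectation (\<lambda>x. (N x)\<^sup>2) / 2) \<and>
    expectation (\<lambda>x. cis (N x)) = exp (- complex_of_real (expectation (\<lambda>x. (N x)\<^sup>2) / 2))"
    using assms(1) unfolding centered_normal_def
  proof (elim disjE exE conjE)
    assume ae: "AE x in M. N x = 0"
    have "integrable M (\<lambda>x. (N x)\<^sup>2) \<longleftrightarrow> integrable M (\<lambda>x. 0::real)"
      by (rule integrable_cong_AE) (use ae in auto)
    moreover have "integrable M N \<longleftrightarrow> integrable M (\<lambda>x. 0::real)"
      by (rule integrable_cong_AE) (use ae in auto)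
    moreover have "integrable M (\<lambda>x. exp (N x)) \<longleftrightarrow> integrable M (\<lambda>x. 1::real)"
      by (rule integrable_cong_AE) (use ae in auto)
    moreover have "expectation (\<lambda>x. (N x)\<^sup>2) = expectation (\<lambda>x. 0)" "expectation N = expectation (\<lambda>x. 0)"
      "expectation (\<lambda>x. exp (N x)) = expectation (\<lambda>x. 1)" "expectation (\<lambda>x. cis (N x)) = expectation (\<lambda>x. 1)"
      by (rule integral_cong_AE; use ae in auto)+
    ultimately show ?thesis by (simp add: prob_space)
  next
    fix \<sigma> :: real assume \<sigma>: "0 < \<sigma>" and D: "distributed M lborel N (normal_density 0 \<sigma>)"
    have i2: "integrable M (\<lambda>x. (N x)\<^sup>2)"
      using distributed_integrable[OF D, of "\<lambda>x. x^2"] integrable_normal_moment[OF \<sigma>, of 0 2] by simp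
    have i1: "integrable M N"
      using distributed_integrable[OF D, of "\<lambda>x. x"] integrable_normal_moment[OF \<sigma>, of 0 1] by simp
    have e1: "expectation N = 0"
      using distributed_integral[OF D, of "\<lambda>x. x"] integral_normal_moment_nz_1[OF \<sigma>, of 0] by simp
    have e2: "expectation (\<lambda>x. (N x)\<^sup>2) = \<sigma>\<^sup>2"
      using distributed_integral[OF D, of "\<lambda>x. x^2"] integral_normal_moment_even[OF \<sigma>, of 0 1] by simp
    have eq: "normal_density 0 \<sigma> x * exp x = exp (\<sigma>\<^sup>2/2) * normal_density (\<sigma>\<^sup>2) \<sigma> x" for x
    proof -
      have "- (x\<^sup>2 / (2 * \<sigma>\<^sup>2)) + x = \<sigma>\<^sup>2/2 + - ((x - \<sigma>\<^sup>2)\<^sup>2 / (2 * \<sigma>\<^sup>2))"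
        using \<sigma> by (simp add: field_simps power2_eq_square)
      then show ?thesis
        by (simp add: normal_density_def flip: exp_add)
    qed
    have i3: "integrable M (\<lambda>x. exp (N x))"
      using distributed_integrable[OF D, of exp] integrable_normal_density[OF \<sigma>, of "\<sigma>\<^sup>2"] by (simp add: eq)
    have e3: "expectation (\<lambda>x. exp (N x)) = exp (\<sigma>\<^sup>2/2)"
      using distributed_integral[OF D, of exp] integral_normal_density[OF \<sigma>, of "\<sigma>\<^sup>2"] by (simp add: eq)
    have D': "distributed M lborel (\<lambda>x. N x / \<sigma>) std_normal_density"
      using D normal_standard_normal_convert[OF \<sigma>, of N 0] by simp
    have "distr M lborel (\<lambda>x. N x / \<sigma>) = std_normal_distribution"
      using distributed_distr_eq_density[OF D'] by simp
    then have "char (distr M borel (\<lambda>x. N x / \<sigma>)) \<sigma> = exp (- (\<sigma>^2) / 2)"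
      using char_std_normal_distribution by (metis distr_cong sets_lborel)
    then have "expectation (\<lambda>x. cis (N x)) = complex_of_real (exp (- (\<sigma>\<^sup>2/2)))"
      unfolding char_def using \<sigma> by (subst (asm) integral_distr) (auto simp: cis_conv_exp)
    then have e4: "expectation (\<lambda>x. cis (N x)) = exp (- complex_of_real (\<sigma>\<^sup>2/2))"
      unfolding exp_of_real[symmetric] by simp
    show ?thesis using i1 i2 e1 e2 i3 e3 e4 by simp
  qed
  then show "integrable M (\<lambda>x. (N x)\<^sup>2)" "integrable M N" "expectation N = 0"
    "integrable M (\<lambda>x. exp (N x))" 
    "expectation (\<lambda>x. exp (N x)) = exp (expectation (\<lambda>x. (N x)\<^sup>2) / 2)"
    "expectation (\<lambda>x. cis (N x)) = exp (- complex_of_real (expectation (\<lambda>x. (N x)\<^sup>2) / 2))"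
    by auto
qed

text \<open>
  Only the characteristic functions of \<open>\<tau> * G + S\<close> for real \<open>\<tau>\<close> are given. As \<open>G\<close> has all exponential
  moments, the expectation of \<open>exp (w * G) * cis (S)\<close> is a power series in \<open>w\<close> that converges
  everywhere. It agrees on the imaginary axis with the exponential of a quadratic polynomial, hence
  also at \<open>w = 1\<close>.
\<close>

lemma tilted_characteristic_function:
  fixes G S :: "'a \<Rightarrow> real" and A B C :: real
  assumes [measurable]: "G \<in> borel_measurable M" "S \<in> borel_measurable M"
    and mgf: "\<And>r. integrable M (\<lambda>x. exp (r * G x))"
    and char: "\<And>\<tau>. expectation (\<lambda>x. cis (\<tau> * G x + S x)) =
      exp (- complex_of_real ((A * \<tau>\<^sup>2 + 2 * C * \<tau> + B) / 2))"
  shows "expectation (\<lambda>x. exp (G x) * cis (S x)) = exp (complex_of_real ((A - B) / 2) + \<i> * C)"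
proof -
  have mgf': "integrable M (\<lambda>x. exp (r * \<bar>G x\<bar>))" for r :: real
  proof (rule Bochner_Integration.integrable_bound)
    show "integrable M (\<lambda>x. exp (r * G x) + exp (- r * G x))"
      using mgf[of r] mgf[of "-r"] by simp
    show "AE x in M. norm (exp (r * \<bar>G x\<bar>)) \<le> norm (exp (r * G x) + exp (- r * G x))"
      by (intro AE_I2, subst (2) real_norm_def, subst abs_of_nonneg) (auto simp: abs_if intro: add_nonneg_nonneg)
  qed simp
  have pow_le: "(r * \<bar>g\<bar>) ^ n / fact n \<le> exp (r * \<bar>g\<bar>)" if "r \<ge> 0" for r g :: real and n
  proof -
    have "summable (\<lambda>n. (r * \<bar>g\<bar>) ^ n /\<^sub>R fact n)" by (rule summable_exp_generic)
    then have "sum (\<lambda>n. (r * \<bar>g\<bar>) ^ n /\<^sub>R fact n) {n} \<le> exp (r * \<bar>g\<bar>)"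
      unfolding exp_def using that by (intro sum_le_suminf) auto
    then show ?thesis by (simp add: divide_inverse mult.commute)
  qed
  define h where "h n x = (complex_of_real (G x) ^ n /\<^sub>R fact n) * cis (S x)" for n x
  have [measurable]: "h n \<in> borel_measurable M" for n unfolding h_def by measurable
  define f where "f w = expectation (\<lambda>x. exp (w * G x) * cis (S x))" for w :: complex
  have sums_f: "(\<lambda>n. expectation (h n) * w ^ n) sums f w" for w
  proof -
    have nrm: "norm (w ^ n * h n x) = (norm w * \<bar>G x\<bar>) ^ n / fact n" for n x
      by (simp add: h_def norm_mult norm_power power_mult_distrib divide_inverse)
    have int: "integrable M (\<lambda>x. w ^ n * h n x)" for n
      by (rule Bochner_Integration.integrable_bound[OF mgf'[of "norm w"]])
         (auto simp: nrm pow_le)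
    have sm: "(\<lambda>n. w ^ n * h n x) sums (exp (w * G x) * cis (S x))" for x
    proof -
      have "(\<lambda>n. (w * G x) ^ n /\<^sub>R fact n) sums exp (w * G x)"
        unfolding exp_def by (rule summable_sums[OF summable_exp_generic])
      from sums_mult2[OF this, of "cis (S x)"] show ?thesis
        by (simp add: h_def power_mult_distrib mult_ac scaleR_conv_of_real)
    qed
    have nsm: "(\<lambda>n. norm (w ^ n * h n x)) sums exp (norm w * \<bar>G x\<bar>)" for x
      unfolding nrm exp_def using summable_sums[OF summable_exp_generic[of "norm w * \<bar>G x\<bar>"]]
      by (simp add: divide_inverse mult.commute)
    have "(\<lambda>n. expectation (\<lambda>x. w ^ n * h n x)) sums (\<integral>x. (\<Sum>n. w ^ n * h n x) \<partial>M)"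
    proof (rule sums_integral[OF int])
      show "AE x in M. summable (\<lambda>n. norm (w ^ n * h n x))"
        using nsm by (auto simp: sums_iff)
      show "summable (\<lambda>n. \<integral>x. norm (w ^ n * h n x) \<partial>M)"
      proof (rule bounded_imp_summable)
        show "0 \<le> (\<integral>x. norm (w ^ n * h n x) \<partial>M)" for n by simp
        show "(\<Sum>k\<le>n. \<integral>x. norm (w ^ k * h k x) \<partial>M) \<le> expectation (\<lambda>x. exp (norm w * \<bar>G x\<bar>))" for n
        proof -
          have "(\<Sum>k\<le>n. \<integral>x. norm (w ^ k * h k x) \<partial>M) = (\<integral>x. (\<Sum>k\<le>n. norm (w ^ k * h k x)) \<partial>M)"
            using int by (subst Bochner_Integration.integral_sum) auto
          also have "\<dots> \<le> expectation (\<lambda>x. exp (norm w * \<bar>G x\<bar>))"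
          proof (rule integral_mono)
            show "(\<Sum>k\<le>n. norm (w ^ k * h k x)) \<le> exp (norm w * \<bar>G x\<bar>)" for x
              using nsm[of x] by (subst sums_unique[OF nsm]) (intro sum_le_suminf, auto simp: sums_iff)
          qed (use int mgf' in auto)
          finally show ?thesis .
        qed
      qed
    qed
    then show ?thesis
      unfolding f_def sums_unique[OF sm, symmetric] by (simp add: mult.commute)
  qed
  define g where "g w = exp ((A * w\<^sup>2 - B) / 2 - \<i> * (- C * w))" for w :: complex
  have "f 1 - g 1 = 0"
  proof (rule analytic_continuation[where f = "\<lambda>w. f w - g w" and S = "ball 0 2" and U = "(\<lambda>\<tau>. \<i> * complex_of_real \<tau>) ` {0<..<1}" and \<xi> = 0])
    have "f holomorphic_on ball 0 2"
      by (rule power_series_holomorphic[where a = "\<lambda>n. expectation (h n)"]) (use sums_f in simp)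
    then show "(\<lambda>w. f w - g w) holomorphic_on ball 0 2"
      unfolding g_def by (intro holomorphic_intros) auto
    show "(\<lambda>\<tau>. \<i> * complex_of_real \<tau>) ` {0<..<1} \<subseteq> ball 0 2" by (auto simp: norm_mult)
    show "0 islimpt (\<lambda>\<tau>. \<i> * complex_of_real \<tau>) ` {0<..<1}"
      unfolding islimpt_approachable
    proof (intro allI impI)
      fix e :: real assume "0 < e"
      then show "\<exists>x'\<in>(\<lambda>\<tau>. \<i> * complex_of_real \<tau>) ` {0<..<1}. x' \<noteq> 0 \<and> dist x' 0 < e"
        by (intro bexI[of _ "\<i> * complex_of_real (min (e/2) (1/2))"]) (auto simp: norm_mult)
    qed
    fix z assume "z \<in> (\<lambda>\<tau>. \<i> * complex_of_real \<tau>) ` {0<..<1}"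
    then obtain \<tau> where z: "z = \<i> * complex_of_real \<tau>" by auto
    have "f z = expectation (\<lambda>x. cis (\<tau> * G x + S x))"
      unfolding f_def z by (simp add: cis_conv_exp exp_add[symmetric] distrib_left mult_ac add.commute)
    also have "\<dots> = g z"
    proof -
      have "- complex_of_real ((A * \<tau>\<^sup>2 + 2 * C * \<tau> + B) / 2) = (A * z\<^sup>2 - B) / 2 - \<i> * (- C * z)"
        unfolding z by (simp add: power_mult_distrib field_simps)
      then show ?thesis unfolding char g_def by simp
    qed
    finally show "f z - g z = 0" by simp
  qed (auto)
  then show ?thesis
    unfolding f_def g_def by (simp add: exp_of_real)
qed

end

section \<open>Occupation times\<close>

lemma integrable_indicator_Icc: "integrable lborel (indicator {a..b} :: real \<Rightarrow> real)"
  by (intro integrable_real_indicator) (auto simp: emeasure_lborel_Icc_eq)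

text \<open>
  The value is 0 for paths along which \<open>g\<close> is not integrable, so the bounds of this integral hold for
  every path.
\<close>

definition occupation :: "(real \<Rightarrow> real) \<Rightarrow> real \<Rightarrow> real \<Rightarrow> (real \<Rightarrow> real) \<Rightarrow> real" where
  "occupation g a b p = (LBINT s:{a..b}. g (p s))"

lemma occupation_bounds:
  assumes "a \<le> b" and g: "\<And>u. 0 \<le> g u" "\<And>u. g u \<le> 1"
  shows "0 \<le> occupation g a b p" "occupation g a b p \<le> b - a"
proof -
  show "0 \<le> occupation g a b p"
    unfolding occupation_def set_lebesgue_integral_def using g by (intro Bochner_Integration.integral_nonneg) auto
  show "occupation g a b p \<le> b - a"
  proof (cases "set_integrable lborel {a..b} (\<lambda>s. g (p s))")
    case True
    then have "occupation g a b p \<le> (LBINT s:{a..b}. 1)"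
      unfolding occupation_def using g by (intro set_integral_mono) (auto simp: set_integrable_def integrable_indicator_Icc)
    then show ?thesis using assms(1) by (simp add: set_lebesgue_integral_def)
  next
    case False
    then show ?thesis
      using assms(1) by (simp add: occupation_def set_lebesgue_integral_def set_integrable_def not_integrable_integral_eq)
  qed
qed

lemma occupation_measurable:
  assumes [measurable]: "case_prod X \<in> borel_measurable (borel \<Otimes>\<^sub>M M)" "g \<in> borel_measurable borel"
  shows "(\<lambda>\<omega>. occupation g a b (\<lambda>s. X s \<omega>)) \<in> borel_measurable M"
  unfolding occupation_def set_lebesgue_integral_def
  by (rule lborel.borel_measurable_lebesgue_integral) measurable

lemma occupation_shift: "occupation g (t + a) (t + b) p = occupation g a b (\<lambda>s. p (t + s))"
proof -
  have "(\<integral>s. indicator {t + a..t + b} s *\<^sub>R g (p s) \<partial>lborel) =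
    \<bar>1\<bar> *\<^sub>R (\<integral>s. indicator {t + a..t + b} (t + 1 * s) *\<^sub>R g (p (t + 1 * s)) \<partial>lborel)"
    by (rule lborel_integral_real_affine) simp
  also have "\<dots> = (\<integral>s. indicator {a..b} s *\<^sub>R g (p (t + s)) \<partial>lborel)"
    by (simp, intro Bochner_Integration.integral_cong) (auto split: split_indicator)
  finally show ?thesis unfolding occupation_def set_lebesgue_integral_def .
qed

lemma occupation_translate: "occupation (\<lambda>u. g (u + z)) a b p = occupation g a b (\<lambda>s. p s + z)"
  by (simp add: occupation_def)

lemma occupation_set_integrable:
  fixes p g :: "real \<Rightarrow> real" and a b :: real
  assumes [measurable]: "p \<in> borel_measurable borel" "g \<in> borel_measurable borel"
    and g: "\<And>u. 0 \<le> g u" "\<And>u. g u \<le> (1::real)"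
  shows "set_integrable lborel {a..b} (\<lambda>s. g (p s))"
  unfolding set_integrable_def
  by (rule Bochner_Integration.integrable_bound[OF integrable_indicator_Icc[of a b]])
     (use g in \<open>auto split: split_indicator\<close>)

lemma occupation_mono:
  assumes p: "p \<in> borel_measurable borel" and g: "g \<in> borel_measurable borel" "\<And>u. 0 \<le> g u" "\<And>u. g u \<le> 1"
    and g': "g' \<in> borel_measurable borel" "\<And>u. 0 \<le> g' u" "\<And>u. g' u \<le> 1"
    and le: "\<And>u. g u \<le> g' u" and ab: "a' \<le> a" "b \<le> b'"
  shows "occupation g a b p \<le> occupation g' a' b' p"
  unfolding occupation_def set_lebesgue_integral_def
proof (rule integral_mono)
  show "indicat_real {a..b} s *\<^sub>R g (p s) \<le> indicat_real {a'..b'} s *\<^sub>R g' (p s)" for s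
    using ab le[of "p s"] g'(2)[of "p s"] by (auto split: split_indicator)
qed (use occupation_set_integrable[OF p g] occupation_set_integrable[OF p g'] in \<open>auto simp: set_integrable_def\<close>)

lemma occupation_split:
  assumes p: "p \<in> borel_measurable borel" and g: "g \<in> borel_measurable borel" "\<And>u. 0 \<le> g u" "\<And>u. g u \<le> 1"
    and ab: "a \<le> b" "b \<le> d"
  shows "occupation g a d p = occupation g a b p + occupation g b d p"
proof -
  have [measurable]: "p \<in> borel_measurable borel" "g \<in> borel_measurable borel" using p g by auto
  have "occupation g a d p = (\<integral>s. indicator {a..b} s *\<^sub>R g (p s) + indicator {b..d} s *\<^sub>R g (p s) \<partial>lborel)"
    unfolding occupation_def set_lebesgue_integral_def
  proof (rule integral_cong_AE)
    show "AE s in lborel. indicat_real {a..d} s *\<^sub>R g (p s) = indicator {a..b} s *\<^sub>R g (p s) + indicator {b..d} s *\<^sub>R g (p s)"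
      using AE_lborel_singleton[of b] by eventually_elim (use ab in \<open>auto split: split_indicator\<close>)
  qed measurable
  then show ?thesis
    using occupation_set_integrable[OF p g, of a b] occupation_set_integrable[OF p g, of b d]
    by (simp add: occupation_def set_lebesgue_integral_def set_integrable_def)
qed

lemma occupation_pos:
  assumes p: "continuous_on UNIV p" and g: "continuous_on UNIV g" "\<And>u. 0 \<le> g u" "\<And>u. g u \<le> 1"
    and s: "a \<le> s" "s < b" "0 < g (p s)"
  shows "0 < occupation g a b p"
proof -
  have gp: "continuous_on UNIV (\<lambda>s. g (p s))" by (intro continuous_on_compose2[OF g(1) p]) auto
  have [measurable]: "p \<in> borel_measurable borel" "g \<in> borel_measurable borel"
    using p g by (auto intro: borel_measurable_continuous_onI)
  have "isCont (\<lambda>s. g (p s)) s" using gp by (simp add: continuous_on_eq_continuous_at)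
  then obtain \<delta> where \<delta>: "0 < \<delta>" "\<And>r. \<bar>r - s\<bar> < \<delta> \<Longrightarrow> \<bar>g (p r) - g (p s)\<bar> < g (p s) / 2"
    using s(3) unfolding continuous_at_eps_delta by (metis dist_real_def half_gt_zero)
  define d where "d = min (s + \<delta> / 2) b"
  have d: "s < d" "d \<le> b" using \<delta> s by (auto simp: d_def)
  have "0 < (d - s) * (g (p s) / 2)" using d s by simp
  also have "\<dots> = (\<integral>r. indicator {s..d} r *\<^sub>R (g (p s) / 2) \<partial>lborel)"
    using d by simp
  also have "\<dots> \<le> occupation g a b p"
    unfolding occupation_def set_lebesgue_integral_def
  proof (rule integral_mono)
    show "integrable lborel (\<lambda>r. indicat_real {s..d} r *\<^sub>R (g (p s) / 2))"
      using integrable_indicator_Icc[of s d] by simp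
    show "integrable lborel (\<lambda>r. indicat_real {a..b} r *\<^sub>R g (p r))"
      using occupation_set_integrable[of p g a b] g by (simp add: set_integrable_def)
    show "indicat_real {s..d} r *\<^sub>R (g (p s) / 2) \<le> indicat_real {a..b} r *\<^sub>R g (p r)" for r
    proof (cases "r \<in> {s..d}")
      case True
      then have "\<bar>r - s\<bar> < \<delta>" using \<delta>(1) by (auto simp: d_def)
      then have "\<bar>g (p r) - g (p s)\<bar> < g (p s) / 2" by (rule \<delta>(2))
      then have "g (p s) / 2 \<le> g (p r)" by linarith
      then show ?thesis using True s d by auto
    qed (use g in \<open>auto split: split_indicator\<close>)
  qed
  finally show ?thesis .
qed

lemma integral_against_occupation:
  fixes F :: "(real \<Rightarrow> real) \<Rightarrow> complex" and g :: "real \<Rightarrow> real"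
  assumes P: "prob_space P" and Y[measurable]: "case_prod Y \<in> borel_measurable (borel \<Otimes>\<^sub>M P)"
    and F[measurable]: "(\<lambda>\<omega>. F (\<lambda>s. Y s \<omega>)) \<in> borel_measurable P" and K: "\<And>p. norm (F p) \<le> K"
    and [measurable]: "g \<in> borel_measurable borel" and g: "\<And>u. 0 \<le> g u" "\<And>u. g u \<le> 1"
  shows "(\<integral>\<omega>. F (\<lambda>s. Y s \<omega>) * complex_of_real (occupation g a b (\<lambda>s. Y s \<omega>)) \<partial>P) =
      (LBINT s:{a..b}. (\<integral>\<omega>. F (\<lambda>s. Y s \<omega>) * complex_of_real (g (Y s \<omega>)) \<partial>P))"
proof -
  interpret prob_space P by (rule P)
  interpret pair_sigma_finite lborel P ..
  have K0: "0 \<le> K" using K norm_ge_zero order_trans by blast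
  have int: "integrable (lborel \<Otimes>\<^sub>M P) (\<lambda>(s, \<omega>). indicator {a..b} s *\<^sub>R (F (\<lambda>s. Y s \<omega>) * complex_of_real (g (Y s \<omega>))))"
  proof (rule integrableI_bounded_set[where A = "{a..b} \<times> space P" and B = K])
    show "emeasure (lborel \<Otimes>\<^sub>M P) ({a..b} \<times> space P) < \<infinity>"
      by (subst sigma_finite_measure.emeasure_pair_measure_Times[OF prob_space_imp_sigma_finite[OF P]]) (auto simp: emeasure_space_1 ennreal_mult_less_top emeasure_lborel_Icc_eq)
    show "AE x in lborel \<Otimes>\<^sub>M P. x \<in> {a..b} \<times> space P \<longrightarrow> norm (case x of (s, \<omega>) \<Rightarrow> indicator {a..b} s *\<^sub>R (F (\<lambda>s. Y s \<omega>) * complex_of_real (g (Y s \<omega>)))) \<le> K"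
    proof (intro AE_I2 impI, clarsimp simp: norm_mult)
      fix s \<omega>
      have "norm (F (\<lambda>s. Y s \<omega>)) * \<bar>g (Y s \<omega>)\<bar> \<le> K * 1"
        using K g K0 by (intro mult_mono) auto
      then show "norm (F (\<lambda>s. Y s \<omega>)) * \<bar>g (Y s \<omega>)\<bar> \<le> K" by simp
    qed
    show "AE x in lborel \<Otimes>\<^sub>M P. x \<notin> {a..b} \<times> space P \<longrightarrow> (case x of (s, \<omega>) \<Rightarrow> indicator {a..b} s *\<^sub>R (F (\<lambda>s. Y s \<omega>) * complex_of_real (g (Y s \<omega>)))) = 0"
      by (intro AE_I2) (auto simp: space_pair_measure indicator_def)
  qed auto
  have "(\<integral>\<omega>. F (\<lambda>s. Y s \<omega>) * complex_of_real (occupation g a b (\<lambda>s. Y s \<omega>)) \<partial>P) =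
    (\<integral>\<omega>. (\<integral>s. indicator {a..b} s *\<^sub>R (F (\<lambda>s. Y s \<omega>) * complex_of_real (g (Y s \<omega>))) \<partial>lborel) \<partial>P)"
  proof (intro Bochner_Integration.integral_cong refl)
    fix \<omega>
    have "complex_of_real (occupation g a b (\<lambda>s. Y s \<omega>)) = (\<integral>s. complex_of_real (indicator {a..b} s * g (Y s \<omega>)) \<partial>lborel)"
      unfolding occupation_def set_lebesgue_integral_def by (subst integral_complex_of_real) simp
    then show "F (\<lambda>s. Y s \<omega>) * complex_of_real (occupation g a b (\<lambda>s. Y s \<omega>)) = 
       (\<integral>s. indicator {a..b} s *\<^sub>R (F (\<lambda>s. Y s \<omega>) * complex_of_real (g (Y s \<omega>))) \<partial>lborel)"
      by (simp add: integral_mult_right_zero[symmetric] scaleR_conv_of_real mult_ac del: integral_mult_right_zero integral_complex_of_real)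
  qed
  also have "\<dots> = (\<integral>s. (\<integral>\<omega>. indicator {a..b} s *\<^sub>R (F (\<lambda>s. Y s \<omega>) * complex_of_real (g (Y s \<omega>))) \<partial>P) \<partial>lborel)"
    using int by (rule Fubini_integral)
  finally show ?thesis
    unfolding set_lebesgue_integral_def by simp
qed

section \<open>Convergence of occupation times from convergence of finite-dimensional laws\<close>

lemma norm_integral_le:
  fixes f :: "'a \<Rightarrow> 'b :: {banach, second_countable_topology}"
  assumes "integrable M f" "integrable M g" "\<And>x. x \<in> space M \<Longrightarrow> norm (f x) \<le> g x"
  shows "norm (integral\<^sup>L M f) \<le> integral\<^sup>L M g"
  by (rule order_trans[OF integral_norm_bound]) (intro integral_mono integrable_norm assms)

text \<open>
  Convergence of finite-dimensional laws is expressed by the characteristic functions of finite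
  linear combinations, given by lists of coefficients and times, and by tightness of every single
  coordinate.
\<close>

locale fdd_convergence =
  fixes Q :: "nat \<Rightarrow> 'a measure" and X :: "nat \<Rightarrow> real \<Rightarrow> 'a \<Rightarrow> real"
    and Q' :: "'b measure" and X' :: "real \<Rightarrow> 'b \<Rightarrow> real"
  assumes prob: "\<And>n. prob_space (Q n)" and prob': "prob_space Q'"
    and X_meas: "\<And>n. case_prod (X n) \<in> borel_measurable (borel \<Otimes>\<^sub>M Q n)"
    and X'_meas: "case_prod X' \<in> borel_measurable (borel \<Otimes>\<^sub>M Q')"
    and char_tendsto: "\<And>xs. \<forall>(a, s)\<in>set xs. 0 \<le> s \<Longrightarrow>
      (\<lambda>n. \<integral>\<omega>. cis (\<Sum>(a, s)\<leftarrow>xs. a * X n s \<omega>) \<partial>Q n) \<longlonglongrightarrow> (\<integral>\<omega>. cis (\<Sum>(a, s)\<leftarrow>xs. a * X' s \<omega>) \<partial>Q')"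
    and tight: "\<And>s e. 0 \<le> s \<Longrightarrow> 0 < e \<Longrightarrow>
      \<exists>R. (\<forall>n. measure (Q n) {\<omega>\<in>space (Q n). R < \<bar>X n s \<omega>\<bar>} \<le> e) \<and>
        measure Q' {\<omega>\<in>space Q'. R < \<bar>X' s \<omega>\<bar>} \<le> e"
begin

definition converges :: "((real \<Rightarrow> real) \<Rightarrow> complex) \<Rightarrow> bool" where
  "converges F \<longleftrightarrow> (\<exists>K. \<forall>p. norm (F p) \<le> K) \<and>
    (\<forall>n. (\<lambda>\<omega>. F (\<lambda>s. X n s \<omega>)) \<in> borel_measurable (Q n)) \<and>
    (\<lambda>\<omega>. F (\<lambda>s. X' s \<omega>)) \<in> borel_measurable Q' \<and>
    (\<lambda>n. \<integral>\<omega>. F (\<lambda>s. X n s \<omega>) \<partial>Q n) \<longlonglongrightarrow> (\<integral>\<omega>. F (\<lambda>s. X' s \<omega>) \<partial>Q')"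

lemma X_section [measurable]: "X n s \<in> borel_measurable (Q n)" "X' s \<in> borel_measurable Q'"
  using measurable_compose[OF measurable_Pair1' X_meas, of s n]
    measurable_compose[OF measurable_Pair1' X'_meas, of s] by simp_all

lemma converges_measurable:
  assumes "converges F"
  shows "(\<lambda>\<omega>. F (\<lambda>s. X n s \<omega>)) \<in> borel_measurable (Q n)" "(\<lambda>\<omega>. F (\<lambda>s. X' s \<omega>)) \<in> borel_measurable Q'"
  using assms by (auto simp: converges_def)

lemma bounded_integrable:
  assumes "converges F"
  shows "integrable (Q n) (\<lambda>\<omega>. F (\<lambda>s. X n s \<omega>))" "integrable Q' (\<lambda>\<omega>. F (\<lambda>s. X' s \<omega>))"
proof -
  interpret prob_space "Q n" by (rule prob)
  interpret P': prob_space Q' by (rule prob')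
  obtain K where "norm (F p) \<le> K" for p using assms by (auto simp: converges_def)
  then show "integrable (Q n) (\<lambda>\<omega>. F (\<lambda>s. X n s \<omega>))" "integrable Q' (\<lambda>\<omega>. F (\<lambda>s. X' s \<omega>))"
    using assms by (auto simp: converges_def intro!: integrable_const_bound[where B = K] P'.integrable_const_bound[where B = K])
qed

lemma converges_cmult:
  assumes "converges F" shows "converges (\<lambda>p. c * F p)"
proof -
  obtain K where K: "norm (F p) \<le> K" for p using assms by (auto simp: converges_def)
  have *: "norm (c * F p) \<le> norm c * K" for p
    unfolding norm_mult by (intro mult_left_mono K) auto
  note [measurable] = converges_measurable[OF assms]
  show ?thesis
    unfolding converges_def
  proof (intro conjI allI)
    show "\<exists>K. \<forall>p. norm (c * F p) \<le> K" using * by blast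
    show "(\<lambda>n. \<integral>\<omega>. c * F (\<lambda>s. X n s \<omega>) \<partial>Q n) \<longlonglongrightarrow> (\<integral>\<omega>. c * F (\<lambda>s. X' s \<omega>) \<partial>Q')"
      using assms by (auto simp: converges_def intro!: tendsto_intros)
  qed measurable
qed

lemma converges_add:
  assumes F: "converges F" and G: "converges G" shows "converges (\<lambda>p. F p + G p)"
proof -
  obtain K where K: "norm (F p) \<le> K" for p using F by (auto simp: converges_def)
  obtain L where L: "norm (G p) \<le> L" for p using G by (auto simp: converges_def)
  note [measurable] = converges_measurable[OF F] converges_measurable[OF G]
  have *: "norm (F p + G p) \<le> K + L" for p
    using K[of p] L[of p] norm_triangle_ineq[of "F p" "G p"] by linarith
  have lim: "(\<lambda>n. \<integral>\<omega>. F (\<lambda>s. X n s \<omega>) + G (\<lambda>s. X n s \<omega>) \<partial>Q n) \<longlonglongrightarrow> (\<integral>\<omega>. F (\<lambda>s. X' s \<omega>) + G (\<lambda>s. X' s \<omega>) \<partial>Q')"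
    using F G by (simp add: bounded_integrable) (auto simp: converges_def intro!: tendsto_intros)
  show ?thesis
    unfolding converges_def
  proof (intro conjI allI lim)
    show "\<exists>K. \<forall>p. norm (F p + G p) \<le> K" using * by blast
  qed measurable
qed

lemma converges_sum:
  assumes "finite I" "\<And>i. i \<in> I \<Longrightarrow> converges (F i)" shows "converges (\<lambda>p. \<Sum>i\<in>I. F i p)"
  using assms
proof (induction I rule: finite_induct)
  case empty
  then show ?case by (auto simp: converges_def intro: exI[of _ 0])
qed (simp add: converges_add)

lemma converges_approx:
  assumes F: "\<exists>K. \<forall>p. norm (F p) \<le> K" "\<And>n. (\<lambda>\<omega>. F (\<lambda>s. X n s \<omega>)) \<in> borel_measurable (Q n)"
      "(\<lambda>\<omega>. F (\<lambda>s. X' s \<omega>)) \<in> borel_measurable Q'"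
    and approx: "\<And>e. 0 < e \<Longrightarrow> \<exists>G. converges G \<and>
      (\<forall>n. norm ((\<integral>\<omega>. F (\<lambda>s. X n s \<omega>) \<partial>Q n) - (\<integral>\<omega>. G (\<lambda>s. X n s \<omega>) \<partial>Q n)) \<le> e) \<and>
      norm ((\<integral>\<omega>. F (\<lambda>s. X' s \<omega>) \<partial>Q') - (\<integral>\<omega>. G (\<lambda>s. X' s \<omega>) \<partial>Q')) \<le> e"
  shows "converges F"
  unfolding converges_def
proof (intro conjI allI F)
  show "(\<lambda>n. \<integral>\<omega>. F (\<lambda>s. X n s \<omega>) \<partial>Q n) \<longlonglongrightarrow> (\<integral>\<omega>. F (\<lambda>s. X' s \<omega>) \<partial>Q')"
  proof (rule tendstoI)
    fix e :: real assume e: "0 < e"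
    then obtain G where G: "converges G"
      "\<And>n. norm ((\<integral>\<omega>. F (\<lambda>s. X n s \<omega>) \<partial>Q n) - (\<integral>\<omega>. G (\<lambda>s. X n s \<omega>) \<partial>Q n)) \<le> e / 3"
      "norm ((\<integral>\<omega>. F (\<lambda>s. X' s \<omega>) \<partial>Q') - (\<integral>\<omega>. G (\<lambda>s. X' s \<omega>) \<partial>Q')) \<le> e / 3"
      using approx[of "e / 3"] by auto
    have "\<forall>\<^sub>F n in sequentially. dist (\<integral>\<omega>. G (\<lambda>s. X n s \<omega>) \<partial>Q n) (\<integral>\<omega>. G (\<lambda>s. X' s \<omega>) \<partial>Q') < e / 3"
      using G(1) e by (intro tendstoD) (auto simp: converges_def)
    then show "\<forall>\<^sub>F n in sequentially. dist (\<integral>\<omega>. F (\<lambda>s. X n s \<omega>) \<partial>Q n) (\<integral>\<omega>. F (\<lambda>s. X' s \<omega>) \<partial>Q') < e"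
    proof eventually_elim
      case (elim n)
      have G2: "dist (\<integral>\<omega>. F (\<lambda>s. X n s \<omega>) \<partial>Q n) (\<integral>\<omega>. G (\<lambda>s. X n s \<omega>) \<partial>Q n) \<le> e / 3"
        and G3: "dist (\<integral>\<omega>. G (\<lambda>s. X' s \<omega>) \<partial>Q') (\<integral>\<omega>. F (\<lambda>s. X' s \<omega>) \<partial>Q') \<le> e / 3"
        using G(2)[of n] G(3) by (simp_all add: dist_norm norm_minus_commute)
      show ?case
        using elim G2 G3 dist_triangle[of "\<integral>\<omega>. F (\<lambda>s. X n s \<omega>) \<partial>Q n" "\<integral>\<omega>. F (\<lambda>s. X' s \<omega>) \<partial>Q'" "\<integral>\<omega>. G (\<lambda>s. X n s \<omega>) \<partial>Q n"]
          dist_triangle[of "\<integral>\<omega>. G (\<lambda>s. X n s \<omega>) \<partial>Q n" "\<integral>\<omega>. F (\<lambda>s. X' s \<omega>) \<partial>Q'" "\<integral>\<omega>. G (\<lambda>s. X' s \<omega>) \<partial>Q'"]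
        by linarith
    qed
  qed
qed

text \<open>
  On \<open>[- R, R]\<close> the identity \<open>f u = f (S * arcsin (sin (u / S)))\<close> with \<open>S = 2 * R / pi\<close> turns an
  approximation of \<open>f (S * arcsin v)\<close> by polynomials in \<open>v\<close> into one of \<open>f\<close> by polynomials in
  \<open>sin (u / S)\<close>. Outside of \<open>[- R, R]\<close> the approximation is still close to some value of \<open>f\<close>, hence
  bounded, and tightness makes the error small. Multiplication by a sine shifts the frequency \<open>a\<close> and
  stays within the assumption.
\<close>

lemma converges_coordinate:
  assumes F: "\<And>a. converges (\<lambda>p. F p * cis (a * p s))" and s: "0 \<le> s"
    and f: "continuous_on UNIV f" "\<And>u. \<bar>f u\<bar> \<le> (1::real)"
  shows "converges (\<lambda>p. F p * complex_of_real (f (p s)))"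
proof -
  have F0: "converges F" using F[of 0] by simp
  then obtain K0 where K0: "norm (F p) \<le> K0" for p by (auto simp: converges_def)
  define K where "K = max 1 K0"
  have K: "norm (F p) \<le> K" "0 < K" for p using K0[of p] by (auto simp: K_def)
  have [measurable]: "f \<in> borel_measurable borel" using f(1) by (rule borel_measurable_continuous_onI)
  have [measurable]: "(\<lambda>\<omega>. F (\<lambda>s. X n s \<omega>)) \<in> borel_measurable (Q n)"
     "(\<lambda>\<omega>. F (\<lambda>s. X' s \<omega>)) \<in> borel_measurable Q'" for n
    using F0 by (auto simp: converges_def)
  have sin_pow: "converges (\<lambda>p. F p * cis (a * p s) * complex_of_real (sin (p s / R) ^ k))" for a R k
  proof (induction k arbitrary: a)
    case 0
    then show ?case using F by simp
  next
    case (Suc k)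
    have eq: "F p * cis (a * p s) * complex_of_real (sin (p s / R) ^ Suc k) =
      (1 / (2 * \<i>)) * (F p * cis ((a + 1 / R) * p s) * complex_of_real (sin (p s / R) ^ k)) +
      (- 1 / (2 * \<i>)) * (F p * cis ((a - 1 / R) * p s) * complex_of_real (sin (p s / R) ^ k))" for p
    proof -
      have "complex_of_real (sin (p s / R)) ^ Suc k = (cis (p s / R) - cis (- (p s / R))) / (2 * \<i>) * complex_of_real (sin (p s / R)) ^ k"
        by (simp add: complex_eq_iff)
      moreover have "cis ((a + 1 / R) * p s) = cis (a * p s) * cis (p s / R)"
        "cis ((a - 1 / R) * p s) = cis (a * p s) * cis (- (p s / R))"
        by (simp_all only: cis_mult) (simp_all add: algebra_simps)
      moreover have "f * c * ((e1 - e2) / d * S) = (1 / d) * (f * (c * e1) * S) + (- 1 / d) * (f * (c * e2) * S)"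
        for f c e1 e2 d S :: complex by (simp add: divide_inverse algebra_simps)
      ultimately show ?thesis by (simp only: of_real_power)
    qed
    show ?case unfolding eq by (intro converges_add converges_cmult Suc)
  qed
  show ?thesis
  proof (rule converges_approx)
    show "\<exists>K. \<forall>p. norm (F p * complex_of_real (f (p s))) \<le> K"
    proof (intro exI allI)
      fix p show "norm (F p * complex_of_real (f (p s))) \<le> K * 1"
        unfolding norm_mult using K f(2)[of "p s"] by (intro mult_mono) auto
    qed
    fix e :: real assume e: "0 < e"
    define d where "d = min 1 (e / (4 * K))"
    have d: "0 < d" "d \<le> 1" "4 * K * d \<le> e" using e K(2) by (auto simp: d_def min_def field_simps)
    obtain R0 where R0: "\<And>n. measure (Q n) {\<omega>\<in>space (Q n). R0 < \<bar>X n s \<omega>\<bar>} \<le> d"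
        "measure Q' {\<omega>\<in>space Q'. R0 < \<bar>X' s \<omega>\<bar>} \<le> d"
      using tight[OF s d(1)] by auto
    define R where "R = max 1 R0"
    have R: "0 < R" "R0 \<le> R" by (auto simp: R_def)
    define S where "S = 2 * R / pi"
    have S: "0 < S" using R by (simp add: S_def)
    have "continuous_on {-1..1} (\<lambda>u. f (S * arcsin u))"
      using f(1) by (intro continuous_on_compose2[OF f(1)] continuous_intros) auto
    then obtain q where q: "real_polynomial_function q" "\<And>u. u \<in> {-1..1} \<Longrightarrow> \<bar>f (S * arcsin u) - q u\<bar> < d"
      using Stone_Weierstrass_real_polynomial_function[of "{-1..1::real}" "\<lambda>u. f (S * arcsin u)" d] d(1) by auto
    then obtain c N where qc: "q = (\<lambda>u. \<Sum>i\<le>N. c i * u ^ i)"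
      unfolding real_polynomial_function_iff_sum by auto
    define G where "G p = (\<Sum>i\<le>N. complex_of_real (c i) * (F p * cis (0 * p s) * complex_of_real (sin (p s / S) ^ i)))" for p
    have GF: "G p = F p * complex_of_real (q (sin (p s / S)))" for p
      unfolding G_def qc by (simp add: sum_distrib_left mult_ac)
    have near: "norm (F p * complex_of_real (f (p s)) - G p) \<le> K * d + 3 * K * indicator {R0<..} \<bar>p s\<bar>" for p
    proof -
      have "\<bar>f (p s) - q (sin (p s / S))\<bar> \<le> d + 3 * indicator {R0<..} \<bar>p s\<bar>"
      proof (cases "\<bar>p s\<bar> \<le> R")
        case True
        then have "\<bar>p s / S\<bar> \<le> pi / 2" using R S by (simp add: S_def abs_mult field_simps)
        then have "- (pi / 2) \<le> p s / S" "p s / S \<le> pi / 2" by linarith+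
        then have "arcsin (sin (p s / S)) = p s / S" by (intro arcsin_sin) auto
        then have "S * arcsin (sin (p s / S)) = p s" using S by simp
        then have "\<bar>f (p s) - q (sin (p s / S))\<bar> < d" using q(2)[of "sin (p s / S)"] by simp
        then show ?thesis by (auto split: split_indicator)
      next
        case False
        then have "indicator {R0<..} \<bar>p s\<bar> = (1::real)" using R by (auto split: split_indicator)
        moreover have "\<bar>f (S * arcsin (sin (p s / S))) - q (sin (p s / S))\<bar> < d"
          using q(2)[of "sin (p s / S)"] by simp
        ultimately show ?thesis
          using f(2)[of "p s"] f(2)[of "S * arcsin (sin (p s / S))"] d by simp
      qed
      then have "norm (F p) * \<bar>f (p s) - q (sin (p s / S))\<bar> \<le> K * (d + 3 * indicator {R0<..} \<bar>p s\<bar>)"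
        using K d by (intro mult_mono) auto
      moreover have "norm (F p * complex_of_real (f (p s)) - G p) = norm (F p) * \<bar>f (p s) - q (sin (p s / S))\<bar>"
        unfolding GF right_diff_distrib[symmetric] norm_mult of_real_diff[symmetric] norm_of_real ..
      ultimately show ?thesis by (simp add: algebra_simps)
    qed
    have G: "converges G"
      unfolding G_def by (intro converges_sum converges_cmult sin_pow) auto
    have bound: "norm ((\<integral>\<omega>. F (\<lambda>s. Y s \<omega>) * complex_of_real (f (Y s \<omega>)) \<partial>P) - (\<integral>\<omega>. G (\<lambda>s. Y s \<omega>) \<partial>P)) \<le> e"
      if P: "prob_space P" and Y[measurable]: "Y s \<in> borel_measurable P" "(\<lambda>\<omega>. F (\<lambda>s. Y s \<omega>)) \<in> borel_measurable P"
      and GY: "integrable P (\<lambda>\<omega>. G (\<lambda>s. Y s \<omega>))"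
      and m: "measure P {\<omega>\<in>space P. R0 < \<bar>Y s \<omega>\<bar>} \<le> d" for P and Y :: "real \<Rightarrow> 'c \<Rightarrow> real"
    proof -
      interpret prob_space P by (rule P)
      have FY: "integrable P (\<lambda>\<omega>. F (\<lambda>s. Y s \<omega>) * complex_of_real (f (Y s \<omega>)))"
      proof (rule integrable_const_bound[where B = "K * 1"])
        show "AE \<omega> in P. norm (F (\<lambda>s. Y s \<omega>) * complex_of_real (f (Y s \<omega>))) \<le> K * 1"
          unfolding norm_mult using K f(2) by (intro AE_I2 mult_mono) auto
      qed measurable
      have ind: "integrable P (\<lambda>\<omega>. K * d + 3 * K * indicator {R0<..} \<bar>Y s \<omega>\<bar>)"
        by (rule integrable_const_bound[where B = "K * d + 3 * K"]) (use K d in \<open>auto split: split_indicator\<close>)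
      have ind': "integrable P (\<lambda>\<omega>. indicator {R0<..} \<bar>Y s \<omega>\<bar> :: real)"
        by (rule integrable_const_bound[where B = 1]) (auto split: split_indicator)
      have "norm ((\<integral>\<omega>. F (\<lambda>s. Y s \<omega>) * complex_of_real (f (Y s \<omega>)) \<partial>P) - (\<integral>\<omega>. G (\<lambda>s. Y s \<omega>) \<partial>P)) =
         norm (\<integral>\<omega>. F (\<lambda>s. Y s \<omega>) * complex_of_real (f (Y s \<omega>)) - G (\<lambda>s. Y s \<omega>) \<partial>P)"
        using FY GY by simp
      also have "\<dots> \<le> (\<integral>\<omega>. K * d + 3 * K * indicator {R0<..} \<bar>Y s \<omega>\<bar> \<partial>P)"
        using near[of "\<lambda>s. Y s _"] FY GY ind by (intro norm_integral_le) auto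
      also have "\<dots> = K * d + 3 * K * (\<integral>\<omega>. indicator {R0<..} \<bar>Y s \<omega>\<bar> \<partial>P)"
        using ind' by (simp add: prob_space)
      also have "(\<integral>\<omega>. indicator {R0<..} \<bar>Y s \<omega>\<bar> \<partial>P) = (\<integral>\<omega>. indicator {\<omega>\<in>space P. R0 < \<bar>Y s \<omega>\<bar>} \<omega> \<partial>P)"
        by (intro Bochner_Integration.integral_cong) (auto split: split_indicator)
      also have "\<dots> = measure P {\<omega>\<in>space P. R0 < \<bar>Y s \<omega>\<bar>}" by simp
      also have "K * d + 3 * K * \<dots> \<le> K * d + 3 * K * d" using m K by simp
      also have "\<dots> \<le> e" using d by simp
      finally show ?thesis .
    qed
    show "\<exists>G. converges G \<and>
      (\<forall>n. norm ((\<integral>\<omega>. F (\<lambda>s. X n s \<omega>) * complex_of_real (f (X n s \<omega>)) \<partial>Q n) - (\<integral>\<omega>. G (\<lambda>s. X n s \<omega>) \<partial>Q n)) \<le> e) \<and>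
      norm ((\<integral>\<omega>. F (\<lambda>s. X' s \<omega>) * complex_of_real (f (X' s \<omega>)) \<partial>Q') - (\<integral>\<omega>. G (\<lambda>s. X' s \<omega>) \<partial>Q')) \<le> e"
      using bounded_integrable[OF G] R0 by (intro exI[of _ G] conjI allI G bound prob prob') auto
  qed measurable
qed

lemma converges_products:
  assumes "\<forall>(f, s)\<in>set fs. continuous_on UNIV f \<and> (\<forall>u. \<bar>f u\<bar> \<le> (1::real)) \<and> 0 \<le> s"
    "\<forall>(a, s)\<in>set xs. 0 \<le> s"
  shows "converges (\<lambda>p. complex_of_real (\<Prod>(f, s)\<leftarrow>fs. f (p s)) * cis (\<Sum>(a, s)\<leftarrow>xs. a * p s))"
  using assms
proof (induction fs arbitrary: xs)
  case Nil
  have [measurable]: "(\<lambda>\<omega>. \<Sum>(a, s)\<leftarrow>xs. a * X n s \<omega>) \<in> borel_measurable (Q n)"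
    "(\<lambda>\<omega>. \<Sum>(a, s)\<leftarrow>xs. a * X' s \<omega>) \<in> borel_measurable Q'" for n
    by (induction xs) (auto simp: case_prod_beta)
  show ?case
    unfolding converges_def
  proof (intro conjI allI)
    show "(\<lambda>n. \<integral>\<omega>. complex_of_real (\<Prod>(f, s)\<leftarrow>[]. f (X n s \<omega>)) * cis (\<Sum>(a, s)\<leftarrow>xs. a * X n s \<omega>) \<partial>Q n) \<longlonglongrightarrow>
      (\<integral>\<omega>. complex_of_real (\<Prod>(f, s)\<leftarrow>[]. f (X' s \<omega>)) * cis (\<Sum>(a, s)\<leftarrow>xs. a * X' s \<omega>) \<partial>Q')"
      using char_tendsto[of xs] Nil by simp
  qed (auto intro!: exI[of _ 1])
next
  case (Cons fs' fs)
  obtain f s where fs': "fs' = (f, s)" by force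
  have "converges (\<lambda>p. (complex_of_real (\<Prod>(f, s)\<leftarrow>fs. f (p s)) * cis (\<Sum>(a, s)\<leftarrow>xs. a * p s)) * complex_of_real (f (p s)))"
  proof (rule converges_coordinate)
    fix a
    have "converges (\<lambda>p. complex_of_real (\<Prod>(f, s)\<leftarrow>fs. f (p s)) * cis (\<Sum>(a, s)\<leftarrow>(a, s) # xs. a * p s))"
      using Cons.prems fs' by (intro Cons.IH) auto
    then show "converges (\<lambda>p. (complex_of_real (\<Prod>(f, s)\<leftarrow>fs. f (p s)) * cis (\<Sum>(a, s)\<leftarrow>xs. a * p s)) * cis (a * p s))"
      by (simp add: mult.assoc cis_mult add.commute)
  qed (use Cons.prems fs' in auto)
  then show ?case unfolding fs' by (simp add: mult_ac)
qed

text \<open>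
  Moments of an occupation time are time integrals of finite-dimensional expectations: by Fubini one
  factor becomes an integral over \<open>s\<close>, and for fixed \<open>s\<close> it is one more coordinate function.
\<close>

lemma converges_occupation_power:
  assumes g: "continuous_on UNIV g" "\<And>u. 0 \<le> g u" "\<And>u. g u \<le> 1" and A: "0 \<le> A"
    and fs: "\<forall>(f, s)\<in>set fs. continuous_on UNIV f \<and> (\<forall>u. \<bar>f u\<bar> \<le> (1::real)) \<and> 0 \<le> s"
  shows "converges (\<lambda>p. complex_of_real (occupation g 0 A p) ^ m * complex_of_real (\<Prod>(f, s)\<leftarrow>fs. f (p s)))"
  using fs
proof (induction m arbitrary: fs)
  case 0
  then show ?case using converges_products[of fs "[]"] by simp
next
  case (Suc m)
  have gm[measurable]: "g \<in> borel_measurable borel" using g(1) by (rule borel_measurable_continuous_onI)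
  have g1: "\<bar>g u\<bar> \<le> 1" for u using g(2,3)[of u] by simp
  define F where "F p = complex_of_real (occupation g 0 A p) ^ m * complex_of_real (\<Prod>(f, s)\<leftarrow>fs. f (p s))" for p
  have F: "converges F" unfolding F_def using Suc by blast
  then obtain K where K: "\<And>p. norm (F p) \<le> K" by (auto simp: converges_def)
  have K0: "0 \<le> K" using K norm_ge_zero order_trans by blast
  note Fm[measurable] = converges_measurable[OF F]
  have Fg: "converges (\<lambda>p. F p * complex_of_real (g (p s)))" if "0 \<le> s" for s
    using Suc.IH[of "(g, s) # fs"] Suc.prems that g g1 by (simp add: F_def mult_ac)
  note [measurable] = X_meas X'_meas occupation_measurable[OF X_meas gm] occupation_measurable[OF X'_meas gm]
  have eq: "complex_of_real (occupation g 0 A p) ^ Suc m * complex_of_real (\<Prod>(f, s)\<leftarrow>fs. f (p s)) =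
    F p * complex_of_real (occupation g 0 A p)" for p by (simp add: F_def mult_ac)
  have FX: "(\<lambda>s. \<integral>\<omega>. F (\<lambda>s. X n s \<omega>) * complex_of_real (g (X n s \<omega>)) \<partial>Q n) \<in> borel_measurable borel" for n
  proof -
    interpret prob_space "Q n" by (rule prob)
    show ?thesis by (rule borel_measurable_lebesgue_integral) measurable
  qed
  have FX': "(\<lambda>s. \<integral>\<omega>. F (\<lambda>s. X' s \<omega>) * complex_of_real (g (X' s \<omega>)) \<partial>Q') \<in> borel_measurable borel"
  proof -
    interpret prob_space Q' by (rule prob')
    show ?thesis by (rule borel_measurable_lebesgue_integral) measurable
  qed
  have nrm: "norm (F p * complex_of_real (g u)) \<le> K" for p u
  proof -
    have "norm (F p) * \<bar>g u\<bar> \<le> K * 1" using K K0 g1 by (intro mult_mono) auto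
    then show ?thesis by (simp add: norm_mult)
  qed
  have bnd: "norm (\<integral>\<omega>. F (\<lambda>s. X n s \<omega>) * complex_of_real (g (X n s \<omega>)) \<partial>Q n) \<le> K" for n s
  proof -
    interpret prob_space "Q n" by (rule prob)
    have "norm (\<integral>\<omega>. F (\<lambda>s. X n s \<omega>) * complex_of_real (g (X n s \<omega>)) \<partial>Q n) \<le> (\<integral>\<omega>. K \<partial>Q n)"
      by (rule norm_integral_le) (auto intro!: integrable_const_bound[where B = K] simp: nrm)
    then show ?thesis by (simp add: prob_space)
  qed
  show ?case
    unfolding eq converges_def
  proof (intro conjI allI)
    show "\<exists>K. \<forall>p. norm (F p * complex_of_real (occupation g 0 A p)) \<le> K"
    proof (intro exI allI)
      fix p show "norm (F p * complex_of_real (occupation g 0 A p)) \<le> K * A"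
        unfolding norm_mult using K K0 occupation_bounds[OF A, of g p] g by (intro mult_mono) auto
    qed
    have "(\<lambda>n. LBINT s:{0..A}. (\<integral>\<omega>. F (\<lambda>s. X n s \<omega>) * complex_of_real (g (X n s \<omega>)) \<partial>Q n))
      \<longlonglongrightarrow> (LBINT s:{0..A}. (\<integral>\<omega>. F (\<lambda>s. X' s \<omega>) * complex_of_real (g (X' s \<omega>)) \<partial>Q'))"
      unfolding set_lebesgue_integral_def
    proof (rule integral_dominated_convergence[where w = "\<lambda>s. indicator {0..A} s * K"])
      show "AE s in lborel. (\<lambda>n. indicator {0..A} s *\<^sub>R (\<integral>\<omega>. F (\<lambda>s. X n s \<omega>) * complex_of_real (g (X n s \<omega>)) \<partial>Q n))
        \<longlonglongrightarrow> indicator {0..A} s *\<^sub>R (\<integral>\<omega>. F (\<lambda>s. X' s \<omega>) * complex_of_real (g (X' s \<omega>)) \<partial>Q')"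
        using Fg by (intro AE_I2) (auto simp: converges_def intro!: tendsto_intros split: split_indicator)
      show "AE s in lborel. norm (indicator {0..A} s *\<^sub>R (\<integral>\<omega>. F (\<lambda>s. X n s \<omega>) * complex_of_real (g (X n s \<omega>)) \<partial>Q n))
         \<le> indicator {0..A} s * K" for n
        using bnd K0 by (intro AE_I2) (auto split: split_indicator)
    qed (use FX FX' integrable_indicator_Icc in auto)
    then show "(\<lambda>n. \<integral>\<omega>. F (\<lambda>s. X n s \<omega>) * complex_of_real (occupation g 0 A (\<lambda>s. X n s \<omega>)) \<partial>Q n) \<longlonglongrightarrow>
      (\<integral>\<omega>. F (\<lambda>s. X' s \<omega>) * complex_of_real (occupation g 0 A (\<lambda>s. X' s \<omega>)) \<partial>Q')"
      by (subst integral_against_occupation[OF prob X_meas Fm(1) K gm g(2,3)],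
          subst integral_against_occupation[OF prob' X'_meas Fm(2) K gm g(2,3)])
  qed measurable
qed

text \<open>
  An occupation time of \<open>[0, A]\<close> takes values in \<open>[0, A]\<close>, so by Weierstrass convergence of its moments is
  enough. This replaces a limit theorem in a space of continuous paths.
\<close>

theorem occupation_tendsto:
  fixes f :: "real \<Rightarrow> real"
  assumes g: "continuous_on UNIV g" "\<And>u. 0 \<le> g u" "\<And>u. g u \<le> 1" and A: "0 \<le> A"
    and f: "continuous_on UNIV f"
  shows "(\<lambda>n. \<integral>\<omega>. f (occupation g 0 A (\<lambda>s. X n s \<omega>)) \<partial>Q n) \<longlonglongrightarrow> (\<integral>\<omega>. f (occupation g 0 A (\<lambda>s. X' s \<omega>)) \<partial>Q')"
proof -
  have gm[measurable]: "g \<in> borel_measurable borel" using g(1) by (rule borel_measurable_continuous_onI)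
  have fm[measurable]: "f \<in> borel_measurable borel" using f(1) by (rule borel_measurable_continuous_onI)
  note om[measurable] = occupation_measurable[OF X_meas gm] occupation_measurable[OF X'_meas gm]
  have occ: "occupation g 0 A p \<in> {0..A}" for p
    using occupation_bounds[OF A, of g p] g by simp
  have "compact (f ` {0..A})"
    using f by (intro compact_continuous_image) (auto intro: continuous_on_subset)
  then have "bounded (f ` {0..A})" by (rule compact_imp_bounded)
  then obtain K where "\<forall>y\<in>f ` {0..A}. norm y \<le> K" unfolding bounded_iff by blast
  then have K: "\<And>u. u \<in> {0..A} \<Longrightarrow> \<bar>f u\<bar> \<le> K" by auto
  have "converges (\<lambda>p. complex_of_real (f (occupation g 0 A p)))"
  proof (rule converges_approx)
    show "\<exists>K. \<forall>p. norm (complex_of_real (f (occupation g 0 A p))) \<le> K"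
      using K occ by (intro exI[of _ K]) auto
    fix e :: real assume "0 < e"
    then obtain q where q: "real_polynomial_function q" "\<And>u. u \<in> {0..A} \<Longrightarrow> \<bar>f u - q u\<bar> < e"
      using Stone_Weierstrass_real_polynomial_function[of "{0..A}" f e] f by (auto intro: continuous_on_subset)
    then obtain c N where qc: "q = (\<lambda>u. \<Sum>i\<le>N. c i * u ^ i)"
      unfolding real_polynomial_function_iff_sum by auto
    define G where "G p = (\<Sum>i\<le>N. complex_of_real (c i) * complex_of_real (occupation g 0 A p) ^ i)" for p
    have G: "converges G"
      unfolding G_def using converges_occupation_power[OF g A, of "[]"] by (intro converges_sum converges_cmult) auto
    have Gq: "G p = complex_of_real (q (occupation g 0 A p))" for p unfolding G_def qc by simp
    have bound: "norm ((\<integral>\<omega>. complex_of_real (f (occupation g 0 A (\<lambda>s. Y s \<omega>))) \<partial>P) - (\<integral>\<omega>. G (\<lambda>s. Y s \<omega>) \<partial>P)) \<le> e"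
      if P: "prob_space P" and Y[measurable]: "(\<lambda>\<omega>. occupation g 0 A (\<lambda>s. Y s \<omega>)) \<in> borel_measurable P"
       and GY: "integrable P (\<lambda>\<omega>. G (\<lambda>s. Y s \<omega>))" for P and Y :: "real \<Rightarrow> 'c \<Rightarrow> real"
    proof -
      interpret prob_space P by (rule P)
      have FY: "integrable P (\<lambda>\<omega>. complex_of_real (f (occupation g 0 A (\<lambda>s. Y s \<omega>))))"
        by (rule integrable_const_bound[where B = K]) (use K occ in auto)
      have "norm ((\<integral>\<omega>. complex_of_real (f (occupation g 0 A (\<lambda>s. Y s \<omega>))) \<partial>P) - (\<integral>\<omega>. G (\<lambda>s. Y s \<omega>) \<partial>P)) =
         norm (\<integral>\<omega>. complex_of_real (f (occupation g 0 A (\<lambda>s. Y s \<omega>))) - G (\<lambda>s. Y s \<omega>) \<partial>P)"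
        using FY GY by (subst Bochner_Integration.integral_diff) auto
      also have "\<dots> \<le> (\<integral>\<omega>. e \<partial>P)"
      proof (rule norm_integral_le)
        show "norm (complex_of_real (f (occupation g 0 A (\<lambda>s. Y s \<omega>))) - G (\<lambda>s. Y s \<omega>)) \<le> e" for \<omega>
          unfolding Gq of_real_diff[symmetric] norm_of_real using q(2)[OF occ] by (rule less_imp_le)
      qed (use FY GY in auto)
      finally show ?thesis by (simp add: prob_space)
    qed
    show "\<exists>G. converges G \<and>
      (\<forall>n. norm ((\<integral>\<omega>. complex_of_real (f (occupation g 0 A (\<lambda>s. X n s \<omega>))) \<partial>Q n) - (\<integral>\<omega>. G (\<lambda>s. X n s \<omega>) \<partial>Q n)) \<le> e) \<and>
      norm ((\<integral>\<omega>. complex_of_real (f (occupation g 0 A (\<lambda>s. X' s \<omega>))) \<partial>Q') - (\<integral>\<omega>. G (\<lambda>s. X' s \<omega>) \<partial>Q')) \<le> e"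
      using bounded_integrable[OF G] om by (intro exI[of _ G] conjI allI G bound prob prob') auto
  qed measurable
  then show ?thesis
    unfolding converges_def integral_complex_of_real tendsto_of_real_iff by blast
qed

end

section \<open>The law of the path seen from a given time\<close>

text \<open>
  The path is the limit of step functions that freeze it at the multiples of \<open>1 / (n + 1)\<close>.
\<close>

lemma continuous_paths_measurable:
  fixes Z :: "real \<Rightarrow> 'a \<Rightarrow> real"
  assumes [measurable]: "\<And>t. Z t \<in> borel_measurable M"
    and cont: "\<And>\<omega>. \<omega> \<in> space M \<Longrightarrow> continuous_on UNIV (\<lambda>t. Z t \<omega>)"
  shows "case_prod Z \<in> borel_measurable (borel \<Otimes>\<^sub>M M)"
proof -
  define F where "F n p = Z (real_of_int \<lfloor>fst p * real (Suc n)\<rfloor> / real (Suc n)) (snd p)" for n and p :: "real \<times> 'a"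
  have F: "F n \<in> borel_measurable (borel \<Otimes>\<^sub>M M)" for n
    unfolding F_def
    by (rule measurable_compose_countable[where f = "\<lambda>i p. Z (real_of_int i / real (Suc n)) (snd p)"]) measurable
  show ?thesis
  proof (rule borel_measurable_LIMSEQ_real[OF _ F])
    fix p :: "real \<times> 'a" assume "p \<in> space (borel \<Otimes>\<^sub>M M)"
    then have p: "snd p \<in> space M" by (auto simp: space_pair_measure)
    have "(\<lambda>n. real_of_int \<lfloor>fst p * real (Suc n)\<rfloor> / real (Suc n)) \<longlonglongrightarrow> fst p"
    proof (rule Lim_transform2[OF tendsto_const[of "fst p"]])
      show "(\<lambda>n. fst p - real_of_int \<lfloor>fst p * real (Suc n)\<rfloor> / real (Suc n)) \<longlonglongrightarrow> 0"
      proof (rule tendsto_sandwich[OF _ _ tendsto_const LIMSEQ_inverse_real_of_nat])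
        show "\<forall>\<^sub>F n in sequentially. 0 \<le> fst p - real_of_int \<lfloor>fst p * real (Suc n)\<rfloor> / real (Suc n)"
          by (intro always_eventually allI) (simp add: field_simps del: of_nat_Suc)
        have "fst p - real_of_int \<lfloor>fst p * real (Suc n)\<rfloor> / real (Suc n) \<le> inverse (real (Suc n))" for n
        proof -
          have "fst p * real (Suc n) - real_of_int \<lfloor>fst p * real (Suc n)\<rfloor> \<le> 1"
            by linarith
          then have "(fst p * real (Suc n) - real_of_int \<lfloor>fst p * real (Suc n)\<rfloor>) / real (Suc n) \<le> 1 / real (Suc n)"
            by (intro divide_right_mono) auto
          then show ?thesis by (simp add: diff_divide_distrib inverse_eq_divide del: of_nat_Suc)
        qed
        then show "\<forall>\<^sub>F n in sequentially. fst p - real_of_int \<lfloor>fst p * real (Suc n)\<rfloor> / real (Suc n) \<le> inverse (real (Suc n))"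
          by simp
      qed
    qed
    then have "(\<lambda>n. Z (real_of_int \<lfloor>fst p * real (Suc n)\<rfloor> / real (Suc n)) (snd p)) \<longlonglongrightarrow> Z (fst p) (snd p)"
      by (rule continuous_on_tendsto_compose[OF cont[OF p]]) auto
    then show "(\<lambda>n. F n p) \<longlonglongrightarrow> case_prod Z p"
      by (simp add: F_def case_prod_beta)
  qed
qed

lemma exp_tail_integral:
  "(\<integral>\<^sup>+z. ennreal (exp (- z)) * indicator {\<theta><..} z \<partial>lborel) = ennreal (exp (- \<theta>))"
proof -
  have "(\<integral>\<^sup>+z. ennreal (exp (- z)) * indicator {\<theta><..} z \<partial>lborel) =
    (\<integral>\<^sup>+z. ennreal (exp (- z)) * indicator {\<theta>..} z \<partial>lborel)"
    using AE_lborel_singleton[of \<theta>]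
    by (intro nn_integral_cong_AE, eventually_elim) (auto split: split_indicator)
  also have "\<dots> = ennreal (0 - - exp (- \<theta>))"
  proof (rule nn_integral_FTC_atLeast)
    show "((\<lambda>z. - exp (- z)) has_real_derivative exp (- x)) (at x)" for x :: real
      by (auto intro!: derivative_eq_intros)
    have "((\<lambda>z::real. exp (- z)) \<longlongrightarrow> 0) at_top"
      by (rule filterlim_compose[OF exp_at_bot filterlim_uminus_at_bot_at_top])
    from tendsto_minus[OF this] show "((\<lambda>z::real. - exp (- z)) \<longlongrightarrow> 0) at_top" by simp
  qed auto
  finally show ?thesis by simp
qed

lemma sum_list_mult_sum_list:
  fixes f :: "'a \<Rightarrow> real"
  shows "(\<Sum>x\<leftarrow>xs. f x) * (\<Sum>y\<leftarrow>ys. g y) = (\<Sum>x\<leftarrow>xs. \<Sum>y\<leftarrow>ys. f x * g y)"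
  by (induction xs) (auto simp: distrib_right sum_list_const_mult)

text \<open>
  Negative times avoid side conditions on continuity; a process on the half-line enters as one that is
  constant on negative times. Linear combinations are indexed by lists, so that times may repeat.
\<close>

locale gaussian_paths = prob_space M for M :: "'a measure" +
  fixes Z :: "real \<Rightarrow> 'a \<Rightarrow> real"
  assumes Z_meas [measurable]: "\<And>t. Z t \<in> borel_measurable M"
    and Z_cont: "\<And>\<omega>. \<omega> \<in> space M \<Longrightarrow> continuous_on UNIV (\<lambda>t. Z t \<omega>)"
    and gaussian: "\<And>xs. centered_normal M (\<lambda>\<omega>. \<Sum>(a, s)\<leftarrow>xs. a * Z s \<omega>)"
    and var_cont: "continuous_on UNIV (\<lambda>t. expectation (\<lambda>\<omega>. (Z t \<omega>)\<^sup>2))"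
begin

definition "v t = expectation (\<lambda>\<omega>. (Z t \<omega>)\<^sup>2)"

definition "V s t = expectation (\<lambda>\<omega>. (Z s \<omega> - Z t \<omega>)\<^sup>2)"

definition "W t \<omega> = sqrt 2 * Z t \<omega> - v t"

text \<open>
  As \<open>exp (W t)\<close> has mean 1, this is a probability measure.
\<close>

definition "Q t = density M (\<lambda>\<omega>. ennreal (exp (W t \<omega>)))"

lemma Z_pair_meas: "case_prod Z \<in> borel_measurable (borel \<Otimes>\<^sub>M M)"
  using Z_meas Z_cont by (rule continuous_paths_measurable)

lemma v_meas [measurable]: "v \<in> borel_measurable borel"
  unfolding v_def using var_cont by (rule borel_measurable_continuous_onI)

lemma W_pair_meas: "case_prod W \<in> borel_measurable (borel \<Otimes>\<^sub>M M)"
proof -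
  have [measurable]: "(\<lambda>p. Z (fst p) (snd p)) \<in> borel_measurable (borel \<Otimes>\<^sub>M M)"
    using Z_pair_meas by (simp add: case_prod_beta')
  show ?thesis unfolding W_def case_prod_beta' by measurable
qed

lemma W_meas [measurable]: "W t \<in> borel_measurable M"
  unfolding W_def by measurable

lemma W_cont: "\<omega> \<in> space M \<Longrightarrow> continuous_on UNIV (\<lambda>t. W t \<omega>)"
  unfolding W_def v_def by (intro continuous_intros Z_cont var_cont)

lemma Z_sq_integrable [simp]: "integrable M (\<lambda>\<omega>. (Z t \<omega>)\<^sup>2)"
  using centered_normal_exp(1)[OF gaussian[of "[(1, t)]"]] by simp

lemma Z_mult_integrable [simp]: "integrable M (\<lambda>\<omega>. Z s \<omega> * Z t \<omega>)"
proof (rule Bochner_Integration.integrable_bound[of M "\<lambda>\<omega>. (Z s \<omega>)\<^sup>2 + (Z t \<omega>)\<^sup>2"])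
  have "\<bar>a * b\<bar> \<le> \<bar>a\<^sup>2 + b\<^sup>2\<bar>" for a b :: real
  proof -
    have "0 \<le> (\<bar>a\<bar> - \<bar>b\<bar>)\<^sup>2" "0 \<le> \<bar>a * b\<bar>" by auto
    moreover have "(\<bar>a\<bar> - \<bar>b\<bar>)\<^sup>2 = a\<^sup>2 + b\<^sup>2 - 2 * \<bar>a * b\<bar>" by (simp add: power2_diff abs_mult)
    ultimately show ?thesis by linarith
  qed
  then show "AE \<omega> in M. norm (Z s \<omega> * Z t \<omega>) \<le> norm ((Z s \<omega>)\<^sup>2 + (Z t \<omega>)\<^sup>2)" by simp
qed auto

lemma V_eq: "V s t = v s + v t - 2 * expectation (\<lambda>\<omega>. Z s \<omega> * Z t \<omega>)"
  unfolding V_def v_def by (simp add: power2_diff mult.assoc)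

lemma V_refl [simp]: "V t t = 0"
  unfolding V_def by simp

lemma V_nonneg [simp]: "0 \<le> V s t"
  unfolding V_def by simp

text \<open>
  The weights \<open>\<theta>\<close> and \<open>1 - \<theta>\<close> add up to 1, which makes the subtracted variances combine with the
  variance of the exponent to a multiple of the variogram.
\<close>

lemma exp_interpolation:
  "integrable M (\<lambda>\<omega>. exp (\<theta> * W s \<omega> + (1 - \<theta>) * W t \<omega>))"
  "expectation (\<lambda>\<omega>. exp (\<theta> * W s \<omega> + (1 - \<theta>) * W t \<omega>)) = exp (- \<theta> * (1 - \<theta>) * V s t)"
proof -
  define N where "N \<omega> = sqrt 2 * \<theta> * Z s \<omega> + sqrt 2 * (1 - \<theta>) * Z t \<omega>" for \<omega>
  have [measurable]: "N \<in> borel_measurable M" unfolding N_def by measurable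
  have N: "centered_normal M N"
    using gaussian[of "[(sqrt 2 * \<theta>, s), (sqrt 2 * (1 - \<theta>), t)]"] unfolding N_def by simp
  have N_eq: "N \<omega> = sqrt 2 * (\<theta> * Z s \<omega> + (1 - \<theta>) * Z t \<omega>)" for \<omega>
    by (simp add: N_def algebra_simps)
  have "expectation (\<lambda>\<omega>. (N \<omega>)\<^sup>2) = expectation (\<lambda>\<omega>. 2 * \<theta>\<^sup>2 * (Z s \<omega>)\<^sup>2 + 2 * (1 - \<theta>)\<^sup>2 * (Z t \<omega>)\<^sup>2 +
      4 * \<theta> * (1 - \<theta>) * (Z s \<omega> * Z t \<omega>))"
    by (intro Bochner_Integration.integral_cong refl)
       (simp add: N_eq power_mult_distrib, simp add: power2_eq_square algebra_simps)
  also have "\<dots> = 2 * \<theta>\<^sup>2 * v s + 2 * (1 - \<theta>)\<^sup>2 * v t + 4 * \<theta> * (1 - \<theta>) * expectation (\<lambda>\<omega>. Z s \<omega> * Z t \<omega>)"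
    by (simp add: v_def)
  finally have EN: "expectation (\<lambda>\<omega>. (N \<omega>)\<^sup>2) / 2 - (\<theta> * v s + (1 - \<theta>) * v t) = - \<theta> * (1 - \<theta>) * V s t"
    by (simp add: V_eq power2_eq_square algebra_simps)
  have eq: "exp (\<theta> * W s \<omega> + (1 - \<theta>) * W t \<omega>) = exp (N \<omega>) * exp (- (\<theta> * v s + (1 - \<theta>) * v t))" for \<omega>
    unfolding exp_add[symmetric] by (simp add: W_def N_def algebra_simps)
  show "integrable M (\<lambda>\<omega>. exp (\<theta> * W s \<omega> + (1 - \<theta>) * W t \<omega>))"
    unfolding eq using centered_normal_exp(4)[OF N] by simp
  show "expectation (\<lambda>\<omega>. exp (\<theta> * W s \<omega> + (1 - \<theta>) * W t \<omega>)) = exp (- \<theta> * (1 - \<theta>) * V s t)"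
    unfolding eq integral_mult_left_zero centered_normal_exp(5)[OF N \<open>N \<in> borel_measurable M\<close>]
    unfolding exp_add[symmetric] EN[symmetric] by simp
qed

lemma space_Q [simp]: "space (Q t) = space M" and sets_Q [measurable_cong, simp]: "sets (Q t) = sets M"
  by (simp_all add: Q_def)

lemma prob_space_Q: "prob_space (Q t)"
proof
  have "emeasure (Q t) (space (Q t)) = (\<integral>\<^sup>+\<omega>. ennreal (exp (W t \<omega>)) \<partial>M)"
    by (auto simp: Q_def emeasure_density intro!: nn_integral_cong)
  also have "\<dots> = 1"
    using exp_interpolation[of 0 t t] by (simp add: nn_integral_eq_integral)
  finally show "emeasure (Q t) (space (Q t)) = 1" .
qed

lemma integral_Q:
  fixes f :: "'a \<Rightarrow> 'b :: {banach, second_countable_topology}"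
  assumes [measurable]: "f \<in> borel_measurable M"
  shows "integral\<^sup>L (Q t) f = (\<integral>\<omega>. exp (W t \<omega>) *\<^sub>R f \<omega> \<partial>M)"
  unfolding Q_def by (rule integral_density) auto

lemma nn_integral_Q:
  assumes [measurable]: "f \<in> borel_measurable M"
  shows "(\<integral>\<^sup>+\<omega>. f \<omega> \<partial>Q t) = (\<integral>\<^sup>+\<omega>. ennreal (exp (W t \<omega>)) * f \<omega> \<partial>M)"
  unfolding Q_def by (rule nn_integral_density) auto

lemma nn_exp_increment:
  "(\<integral>\<^sup>+\<omega>. ennreal (exp (\<theta> * (W s \<omega> - W t \<omega>))) \<partial>Q t) = ennreal (exp (- \<theta> * (1 - \<theta>) * V s t))"
proof -
  have "(\<integral>\<^sup>+\<omega>. ennreal (exp (\<theta> * (W s \<omega> - W t \<omega>))) \<partial>Q t) = (\<integral>\<^sup>+\<omega>. ennreal (exp (\<theta> * W s \<omega> + (1 - \<theta>) * W t \<omega>)) \<partial>M)"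
    by (subst nn_integral_Q) (auto intro!: nn_integral_cong simp: algebra_simps simp flip: ennreal_mult exp_add)
  also have "\<dots> = ennreal (exp (- \<theta> * (1 - \<theta>) * V s t))"
    using exp_interpolation[of \<theta> s t] by (subst nn_integral_eq_integral) auto
  finally show ?thesis .
qed

lemma increment_tail:
  "emeasure (Q t) {\<omega>\<in>space M. u \<le> \<theta> * (W s \<omega> - W t \<omega>)} \<le> ennreal (exp (- u - \<theta> * (1 - \<theta>) * V s t))"
proof -
  have "emeasure (Q t) {\<omega>\<in>space M. u \<le> \<theta> * (W s \<omega> - W t \<omega>)} = (\<integral>\<^sup>+\<omega>. indicator {\<omega>\<in>space M. u \<le> \<theta> * (W s \<omega> - W t \<omega>)} \<omega> \<partial>Q t)"
    by (subst nn_integral_indicator) auto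
  also have "\<dots> \<le> (\<integral>\<^sup>+\<omega>. ennreal (exp (- u)) * ennreal (exp (\<theta> * (W s \<omega> - W t \<omega>))) \<partial>Q t)"
  proof (intro nn_integral_mono)
    fix \<omega>
    show "indicator {\<omega>\<in>space M. u \<le> \<theta> * (W s \<omega> - W t \<omega>)} \<omega> \<le> ennreal (exp (- u)) * ennreal (exp (\<theta> * (W s \<omega> - W t \<omega>)))"
      by (auto split: split_indicator simp flip: ennreal_mult exp_add)
  qed
  also have "\<dots> = ennreal (exp (- u - \<theta> * (1 - \<theta>) * V s t))"
    by (subst nn_integral_cmult) (auto simp: nn_exp_increment simp flip: ennreal_mult exp_add)
  finally show ?thesis .
qed

text \<open>
  Tilting by \<open>exp (W t)\<close> adds twice the covariance with \<open>Z t\<close> to the mean of \<open>W\<close>. Together with the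
  subtracted variances this gives the increments from \<open>t\<close> the mean \<open>- V s t\<close>, and no trace of the
  individual variances is left.
\<close>

lemma tilted_increments_char:
  "(\<integral>\<omega>. cis (\<Sum>(a, s)\<leftarrow>xs. a * (W s \<omega> - W t \<omega>)) \<partial>Q t) =
    exp (complex_of_real (- (\<Sum>(a, s)\<leftarrow>xs. \<Sum>(b, u)\<leftarrow>xs. a * b * (V s t + V u t - V s u)) / 2) -
      \<i> * complex_of_real (\<Sum>(a, s)\<leftarrow>xs. a * V s t))"
proof -
  define G where "G \<omega> = sqrt 2 * Z t \<omega>" for \<omega>
  define S where "S \<omega> = (\<Sum>(a, s)\<leftarrow>xs. a * (sqrt 2 * (Z s \<omega> - Z t \<omega>)))" for \<omega>
  have [measurable]: "G \<in> borel_measurable M" unfolding G_def by measurable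
  have [measurable]: "(\<lambda>\<omega>. \<Sum>(a, s)\<leftarrow>ys. f a s \<omega>) \<in> borel_measurable M"
    if [measurable]: "\<And>a s. f a s \<in> borel_measurable M" for f :: "real \<Rightarrow> real \<Rightarrow> 'a \<Rightarrow> real" and ys
    by (induction ys) (auto simp: case_prod_beta)
  have Sm[measurable]: "S \<in> borel_measurable M" unfolding S_def by measurable
  have int_incr: "integrable M (\<lambda>\<omega>. (Z s \<omega> - Z t \<omega>) * (Z u \<omega> - Z t \<omega>))" for s u
    by (simp add: algebra_simps flip: power2_eq_square)
  have int_list: "integrable M (\<lambda>\<omega>. \<Sum>(a, s)\<leftarrow>ys. f a s \<omega>)"
    and E_list: "expectation (\<lambda>\<omega>. \<Sum>(a, s)\<leftarrow>ys. f a s \<omega>) = (\<Sum>(a, s)\<leftarrow>ys. expectation (f a s))"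
    if "\<And>a s. integrable M (f a s)" for f :: "real \<Rightarrow> real \<Rightarrow> 'a \<Rightarrow> real" and ys
  proof -
    have "integrable M (\<lambda>\<omega>. \<Sum>(a, s)\<leftarrow>ys. f a s \<omega>) \<and>
      expectation (\<lambda>\<omega>. \<Sum>(a, s)\<leftarrow>ys. f a s \<omega>) = (\<Sum>(a, s)\<leftarrow>ys. expectation (f a s))"
      using that by (induction ys) auto
    then show "integrable M (\<lambda>\<omega>. \<Sum>(a, s)\<leftarrow>ys. f a s \<omega>)"
      "expectation (\<lambda>\<omega>. \<Sum>(a, s)\<leftarrow>ys. f a s \<omega>) = (\<Sum>(a, s)\<leftarrow>ys. expectation (f a s))" by auto
  qed
  have S2_eq: "(S \<omega>)\<^sup>2 = (\<Sum>(a, s)\<leftarrow>xs. \<Sum>(b, u)\<leftarrow>xs. a * b * (2 * ((Z s \<omega> - Z t \<omega>) * (Z u \<omega> - Z t \<omega>))))" for \<omega>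
    unfolding S_def power2_eq_square sum_list_mult_sum_list
    by (intro arg_cong[where f = sum_list] map_cong refl) (auto simp: algebra_simps intro!: arg_cong[where f = sum_list] map_cong)
  have S2_int: "integrable M (\<lambda>\<omega>. (S \<omega>)\<^sup>2)"
    unfolding S2_eq using int_incr by (intro int_list) auto
  have incr_cov: "2 * expectation (\<lambda>\<omega>. (Z s \<omega> - Z t \<omega>) * (Z u \<omega> - Z t \<omega>)) = V s t + V u t - V s u" for s u
    by (simp add: V_eq v_def algebra_simps flip: power2_eq_square)
  have S2: "expectation (\<lambda>\<omega>. (S \<omega>)\<^sup>2) = (\<Sum>(a, s)\<leftarrow>xs. \<Sum>(b, u)\<leftarrow>xs. a * b * (V s t + V u t - V s u))"
    unfolding S2_eq using int_incr
    by (subst E_list) (auto intro!: int_list simp: E_list incr_cov simp del: distrib_left_numeral)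
  have GS_eq: "G \<omega> * S \<omega> = (\<Sum>(a, s)\<leftarrow>xs. a * (2 * (Z s \<omega> * Z t \<omega> - (Z t \<omega>)\<^sup>2)))" for \<omega>
    unfolding S_def G_def sum_list_const_mult[symmetric] 
    by (intro arg_cong[where f = sum_list] map_cong refl) (auto simp: algebra_simps power2_eq_square)
  have GS_int: "integrable M (\<lambda>\<omega>. G \<omega> * S \<omega>)"
    unfolding GS_eq by (intro int_list) auto
  have GS: "expectation (\<lambda>\<omega>. G \<omega> * S \<omega>) = (\<Sum>(a, s)\<leftarrow>xs. a * (v s - v t - V s t))"
    unfolding GS_eq by (subst E_list) (auto simp: V_eq v_def algebra_simps)
  have G2: "expectation (\<lambda>\<omega>. (G \<omega>)\<^sup>2) = 2 * v t" "integrable M (\<lambda>\<omega>. (G \<omega>)\<^sup>2)"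
    by (simp_all add: G_def power_mult_distrib v_def)
  have "expectation (\<lambda>\<omega>. exp (G \<omega>) * cis (S \<omega>)) =
    exp (complex_of_real ((2 * v t - expectation (\<lambda>\<omega>. (S \<omega>)\<^sup>2)) / 2) + \<i> * expectation (\<lambda>\<omega>. G \<omega> * S \<omega>))"
  proof (rule tilted_characteristic_function)
    fix \<tau> :: real
    define xs' where "xs' = (sqrt 2 * \<tau> - (\<Sum>(a, s)\<leftarrow>xs. sqrt 2 * a), t) # map (\<lambda>(a, s). (sqrt 2 * a, s)) xs"
    have eq: "\<tau> * G \<omega> + S \<omega> = (\<Sum>(a, s)\<leftarrow>xs'. a * Z s \<omega>)" for \<omega>
    proof -
      have "S \<omega> = (\<Sum>(a, s)\<leftarrow>map (\<lambda>(a, s). (sqrt 2 * a, s)) xs. a * Z s \<omega>) - (\<Sum>(a, s)\<leftarrow>xs. sqrt 2 * a) * Z t \<omega>"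
        unfolding S_def by (induction xs) (auto simp: algebra_simps)
      then show ?thesis unfolding xs'_def G_def by (simp add: algebra_simps)
    qed
    have "expectation (\<lambda>\<omega>. cis (\<tau> * G \<omega> + S \<omega>)) = exp (- complex_of_real (expectation (\<lambda>\<omega>. (\<tau> * G \<omega> + S \<omega>)\<^sup>2) / 2))"
      using gaussian[of xs'] unfolding eq[symmetric] by (rule centered_normal_exp) measurable
    also have "expectation (\<lambda>\<omega>. (\<tau> * G \<omega> + S \<omega>)\<^sup>2) = expectation (\<lambda>\<omega>. \<tau>\<^sup>2 * (G \<omega>)\<^sup>2 + 2 * \<tau> * (G \<omega> * S \<omega>) + (S \<omega>)\<^sup>2)"
      by (intro Bochner_Integration.integral_cong refl) (simp add: power2_sum power_mult_distrib algebra_simps)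
    also have "\<dots> = 2 * v t * \<tau>\<^sup>2 + 2 * expectation (\<lambda>\<omega>. G \<omega> * S \<omega>) * \<tau> + expectation (\<lambda>\<omega>. (S \<omega>)\<^sup>2)"
      using G2 GS_int S2_int by simp
    finally show "expectation (\<lambda>\<omega>. cis (\<tau> * G \<omega> + S \<omega>)) =
      exp (- complex_of_real ((2 * v t * \<tau>\<^sup>2 + 2 * expectation (\<lambda>\<omega>. G \<omega> * S \<omega>) * \<tau> + expectation (\<lambda>\<omega>. (S \<omega>)\<^sup>2)) / 2))" .
  next
    fix r :: real
    show "integrable M (\<lambda>\<omega>. exp (r * G \<omega>))"
      using centered_normal_exp(4)[OF gaussian[of "[(r * sqrt 2, t)]"]] by (simp add: G_def mult.assoc)
  qed measurable
  note E = this
  define m where "m = (\<Sum>(a, s)\<leftarrow>xs. a * (v s - v t))"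
  have cs: "(\<Sum>(a, s)\<leftarrow>xs. a * (W s \<omega> - W t \<omega>)) = S \<omega> - m" for \<omega>
    unfolding S_def m_def W_def by (induction xs) (auto simp: algebra_simps)
  have "(\<integral>\<omega>. cis (\<Sum>(a, s)\<leftarrow>xs. a * (W s \<omega> - W t \<omega>)) \<partial>Q t) =
    (\<integral>\<omega>. (exp (G \<omega>) * cis (S \<omega>)) * (exp (- v t) * cis (- m)) \<partial>M)"
    unfolding cs
  proof (subst integral_Q)
    show "(\<integral>\<omega>. exp (W t \<omega>) *\<^sub>R cis (S \<omega> - m) \<partial>M) = (\<integral>\<omega>. (exp (G \<omega>) * cis (S \<omega>)) * (exp (- v t) * cis (- m)) \<partial>M)"
    proof (intro Bochner_Integration.integral_cong refl)
      fix \<omega>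
      have "exp (W t \<omega>) = exp (G \<omega>) * exp (- v t)" unfolding G_def W_def by (simp flip: exp_add)
      moreover have "cis (S \<omega> - m) = cis (S \<omega>) * cis (- m)" by (simp add: cis_mult)
      ultimately show "exp (W t \<omega>) *\<^sub>R cis (S \<omega> - m) = (exp (G \<omega>) * cis (S \<omega>)) * (exp (- v t) * cis (- m))"
        by (simp add: scaleR_conv_of_real)
    qed
  qed measurable
  also have "\<dots> = expectation (\<lambda>\<omega>. exp (G \<omega>) * cis (S \<omega>)) * (exp (- v t) * cis (- m))"
    by (rule integral_mult_left_zero)
  also have "\<dots> = exp (complex_of_real ((2 * v t - expectation (\<lambda>\<omega>. (S \<omega>)\<^sup>2)) / 2) + \<i> * expectation (\<lambda>\<omega>. G \<omega> * S \<omega>)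
     + complex_of_real (- v t) + \<i> * complex_of_real (- m))"
    unfolding E by (simp only: exp_add exp_of_real cis_conv_exp mult.assoc)
  also have "complex_of_real ((2 * v t - expectation (\<lambda>\<omega>. (S \<omega>)\<^sup>2)) / 2) + \<i> * expectation (\<lambda>\<omega>. G \<omega> * S \<omega>)
     + complex_of_real (- v t) + \<i> * complex_of_real (- m) =
     complex_of_real (- expectation (\<lambda>\<omega>. (S \<omega>)\<^sup>2) / 2) - \<i> * complex_of_real (m - expectation (\<lambda>\<omega>. G \<omega> * S \<omega>))"
    by (simp add: field_simps)
  also have "m - expectation (\<lambda>\<omega>. G \<omega> * S \<omega>) = (\<Sum>(a, s)\<leftarrow>xs. a * V s t)"
    unfolding m_def GS by (induction xs) (auto simp: algebra_simps)
  finally show ?thesis unfolding S2 .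
qed

text \<open>
  An infinite measure: the level \<open>y\<close>, by which the path is shifted, has density \<open>exp (- y)\<close> on the whole
  real line.
\<close>

definition "mu = density (lborel \<Otimes>\<^sub>M M) (\<lambda>p. ennreal (exp (- fst p)))"

definition "w s p = W s (snd p) + fst p"

lemma space_mu [simp]: "space mu = UNIV \<times> space M"
  by (simp add: mu_def space_pair_measure)

lemma sets_mu [measurable_cong]: "sets mu = sets (borel \<Otimes>\<^sub>M M)"
  unfolding mu_def sets_density by (rule sets_pair_measure_cong) auto

lemma w_meas [measurable]: "w s \<in> borel_measurable (borel \<Otimes>\<^sub>M M)"
  unfolding w_def by measurable

lemma w_pair_meas: "case_prod w \<in> borel_measurable (borel \<Otimes>\<^sub>M (borel \<Otimes>\<^sub>M M))"
proof -
  have [measurable]: "(\<lambda>p. W (fst p) (snd (snd p))) \<in> borel_measurable (borel \<Otimes>\<^sub>M (borel \<Otimes>\<^sub>M M))"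
    using W_pair_meas by (auto intro: measurable_compose[where f = "\<lambda>p. (fst p, snd (snd p))" and g = "case_prod W", simplified])
  show ?thesis unfolding w_def case_prod_beta' by measurable
qed

lemma w_cont: "p \<in> space mu \<Longrightarrow> continuous_on UNIV (\<lambda>s. w s p)"
  unfolding w_def by (auto intro!: continuous_intros W_cont)

lemma sigma_finite_mu: "sigma_finite_measure mu"
proof -
  interpret pair_sigma_finite lborel M ..
  show ?thesis
    unfolding mu_def by (subst sigma_finite_iff_density_finite) auto
qed

text \<open>
  Substituting \<open>y = z - W t\<close> turns \<open>exp (- y)\<close> into \<open>exp (- z) * exp (W t)\<close>. Here \<open>z\<close> is the value of the
  path at time \<open>t\<close>, so that under \<open>mu\<close> this value and the increments from \<open>t\<close> form a product measure.
\<close>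

lemma nn_integral_mu:
  assumes [measurable]: "\<Phi> \<in> borel_measurable (borel \<Otimes>\<^sub>M M)"
  shows "(\<integral>\<^sup>+p. \<Phi> p \<partial>mu) = (\<integral>\<^sup>+\<omega>. \<integral>\<^sup>+z. \<Phi> (z - W t \<omega>, \<omega>) * ennreal (exp (- z)) \<partial>lborel \<partial>Q t)"
proof -
  interpret pair_sigma_finite lborel M ..
  have m[measurable]: "\<Phi> \<in> borel_measurable (lborel \<Otimes>\<^sub>M M)"
    by (subst measurable_cong_sets[OF sets_pair_measure_cong[OF sets_lborel refl] refl]) measurable
  have "(\<integral>\<^sup>+p. \<Phi> p \<partial>mu) = (\<integral>\<^sup>+p. ennreal (exp (- fst p)) * \<Phi> p \<partial>(lborel \<Otimes>\<^sub>M M))"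
    unfolding mu_def by (rule nn_integral_density) auto
  also have "\<dots> = (\<integral>\<^sup>+\<omega>. \<integral>\<^sup>+y. ennreal (exp (- y)) * \<Phi> (y, \<omega>) \<partial>lborel \<partial>M)"
    by (subst nn_integral_snd[symmetric]) (auto simp: case_prod_beta')
  also have "\<dots> = (\<integral>\<^sup>+\<omega>. ennreal (exp (W t \<omega>)) * (\<integral>\<^sup>+z. \<Phi> (z - W t \<omega>, \<omega>) * ennreal (exp (- z)) \<partial>lborel) \<partial>M)"
  proof (rule nn_integral_cong)
    fix \<omega> assume \<omega>[measurable]: "\<omega> \<in> space M"
    have [measurable]: "(\<lambda>y. \<Phi> (y, \<omega>)) \<in> borel_measurable borel"
      by (rule measurable_compose[OF measurable_Pair2'[OF \<omega>]]) measurable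
    have "(\<integral>\<^sup>+y. ennreal (exp (- y)) * \<Phi> (y, \<omega>) \<partial>lborel) =
      (\<integral>\<^sup>+z. ennreal (exp (- (- W t \<omega> + 1 * z))) * \<Phi> (- W t \<omega> + 1 * z, \<omega>) \<partial>lborel)"
      by (subst nn_integral_real_affine[where c = 1 and t = "- W t \<omega>"]) auto
    also have "\<dots> = (\<integral>\<^sup>+z. ennreal (exp (W t \<omega>)) * (\<Phi> (z - W t \<omega>, \<omega>) * ennreal (exp (- z))) \<partial>lborel)"
    proof (rule nn_integral_cong)
      fix z
      have "ennreal (exp (- (- W t \<omega> + 1 * z))) = ennreal (exp (W t \<omega>)) * ennreal (exp (- z))"
        by (simp flip: ennreal_mult exp_add)
      then show "ennreal (exp (- (- W t \<omega> + 1 * z))) * \<Phi> (- W t \<omega> + 1 * z, \<omega>) =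
         ennreal (exp (W t \<omega>)) * (\<Phi> (z - W t \<omega>, \<omega>) * ennreal (exp (- z)))"
        by (simp add: mult_ac)
    qed
    also have "\<dots> = ennreal (exp (W t \<omega>)) * (\<integral>\<^sup>+z. \<Phi> (z - W t \<omega>, \<omega>) * ennreal (exp (- z)) \<partial>lborel)"
      by (rule nn_integral_cmult) measurable
    finally show "(\<integral>\<^sup>+y. ennreal (exp (- y)) * \<Phi> (y, \<omega>) \<partial>lborel) =
       ennreal (exp (W t \<omega>)) * (\<integral>\<^sup>+z. \<Phi> (z - W t \<omega>, \<omega>) * ennreal (exp (- z)) \<partial>lborel)" .
  qed
  also have "\<dots> = (\<integral>\<^sup>+\<omega>. \<integral>\<^sup>+z. \<Phi> (z - W t \<omega>, \<omega>) * ennreal (exp (- z)) \<partial>lborel \<partial>Q t)"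
    by (rule nn_integral_Q[symmetric]) measurable
  finally show ?thesis .
qed

lemma emeasure_level:
  assumes [measurable]: "A \<in> sets M"
  shows "emeasure mu {p\<in>space mu. \<theta> < w t p \<and> snd p \<in> A} = ennreal (exp (- \<theta>)) * emeasure (Q t) A"
proof -
  have "emeasure mu {p\<in>space mu. \<theta> < w t p \<and> snd p \<in> A} =
    (\<integral>\<^sup>+p. indicator {\<theta><..} (w t p) * indicator A (snd p) \<partial>mu)"
  proof -
    have "emeasure mu {p\<in>space mu. \<theta> < w t p \<and> snd p \<in> A} =
      (\<integral>\<^sup>+p. indicator {p\<in>space mu. \<theta> < w t p \<and> snd p \<in> A} p \<partial>mu)"
      by (rule nn_integral_indicator[symmetric]) measurable
    also have "\<dots> = (\<integral>\<^sup>+p. indicator {\<theta><..} (w t p) * indicator A (snd p) \<partial>mu)"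
      by (intro nn_integral_cong) (auto split: split_indicator)
    finally show ?thesis .
  qed
  also have "\<dots> = (\<integral>\<^sup>+\<omega>. \<integral>\<^sup>+z. (indicator {\<theta><..} (w t (z - W t \<omega>, \<omega>)) * indicator A (snd (z - W t \<omega>, \<omega>))) * ennreal (exp (- z)) \<partial>lborel \<partial>Q t)"
    by (subst nn_integral_mu[where t = t]) auto
  also have "\<dots> = (\<integral>\<^sup>+\<omega>. indicator A \<omega> * ennreal (exp (- \<theta>)) \<partial>Q t)"
  proof (rule nn_integral_cong)
    fix \<omega>
    have "(\<integral>\<^sup>+z. (indicator {\<theta><..} (w t (z - W t \<omega>, \<omega>)) * indicator A (snd (z - W t \<omega>, \<omega>))) * ennreal (exp (- z)) \<partial>lborel) =
      (\<integral>\<^sup>+z. indicator A \<omega> * (ennreal (exp (- z)) * indicator {\<theta><..} z) \<partial>lborel)"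
      by (intro nn_integral_cong) (simp add: w_def mult_ac)
    then show "(\<integral>\<^sup>+z. (indicator {\<theta><..} (w t (z - W t \<omega>, \<omega>)) * indicator A (snd (z - W t \<omega>, \<omega>))) * ennreal (exp (- z)) \<partial>lborel) =
      indicator A \<omega> * ennreal (exp (- \<theta>))"
      by (simp add: nn_integral_cmult exp_tail_integral)
  qed
  also have "\<dots> = ennreal (exp (- \<theta>)) * emeasure (Q t) A"
    by (subst nn_integral_multc) (auto simp: mult.commute)
  finally show ?thesis .
qed

lemma emeasure_level_UNIV: "emeasure mu {p\<in>space mu. \<theta> < w t p} = ennreal (exp (- \<theta>))"
proof -
  interpret Qt: prob_space "Q t" by (rule prob_space_Q)
  have "{p\<in>space mu. \<theta> < w t p} = {p\<in>space mu. \<theta> < w t p \<and> snd p \<in> space M}" by auto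
  then show ?thesis using emeasure_level[of "space M" \<theta> t] Qt.emeasure_space_1 by simp
qed

text \<open>
  Exponential Markov inequality for the increment, with the exponent 1/2 that minimises
  \<open>- \<theta> * (1 - \<theta>) * V s t\<close>.
\<close>

lemma two_point_bound:
  "emeasure mu {p\<in>space mu. 0 < w t p \<and> 0 < w s p} \<le> ennreal (2 * exp (- V s t / 4))"
proof -
  have half: "(\<integral>\<^sup>+z. ennreal (exp (- z / 2)) * indicator {0<..} z \<partial>lborel) = 2"
  proof -
    have "(\<integral>\<^sup>+z. ennreal (exp (- z / 2)) * indicator {0<..} z \<partial>lborel) =
       ennreal \<bar>2\<bar> * (\<integral>\<^sup>+z. ennreal (exp (- (0 + 2 * z) / 2)) * indicator {0<..} (0 + 2 * z) \<partial>lborel)"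
      by (subst nn_integral_real_affine[where c = 2 and t = 0]) auto
    also have "(\<integral>\<^sup>+z. ennreal (exp (- (0 + 2 * z) / 2)) * indicator {0<..} (0 + 2 * z) \<partial>lborel) =
      (\<integral>\<^sup>+z. ennreal (exp (- z)) * indicator {0<..} z \<partial>lborel)"
      by (intro nn_integral_cong) (auto split: split_indicator)
    finally show ?thesis by (simp add: exp_tail_integral)
  qed
  have "emeasure mu {p\<in>space mu. 0 < w t p \<and> 0 < w s p} =
      (\<integral>\<^sup>+p. indicator {p\<in>space mu. 0 < w t p \<and> 0 < w s p} p \<partial>mu)"
      by (rule nn_integral_indicator[symmetric]) measurable
  also have "\<dots> = (\<integral>\<^sup>+p. indicator {0<..} (w t p) * indicator {0<..} (w s p) \<partial>mu)"
      by (intro nn_integral_cong) (auto split: split_indicator)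
  also have "\<dots> = (\<integral>\<^sup>+\<omega>. \<integral>\<^sup>+z. (indicator {0<..} (w t (z - W t \<omega>, \<omega>)) * indicator {0<..} (w s (z - W t \<omega>, \<omega>))) * ennreal (exp (- z)) \<partial>lborel \<partial>Q t)"
    by (subst nn_integral_mu[where t = t]) auto
  also have "\<dots> \<le> (\<integral>\<^sup>+\<omega>. \<integral>\<^sup>+z. ennreal (exp ((1/2) * (W s \<omega> - W t \<omega>))) * (ennreal (exp (- z / 2)) * indicator {0<..} z) \<partial>lborel \<partial>Q t)"
  proof (intro nn_integral_mono)
    fix \<omega> and z :: real
    show "(indicator {0<..} (w t (z - W t \<omega>, \<omega>)) * indicator {0<..} (w s (z - W t \<omega>, \<omega>))) * ennreal (exp (- z))
      \<le> ennreal (exp ((1/2) * (W s \<omega> - W t \<omega>))) * (ennreal (exp (- z / 2)) * indicator {0<..} z)"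
      by (auto simp: w_def split: split_indicator simp flip: ennreal_mult exp_add) (simp add: field_simps)
  qed
  also have "\<dots> = (\<integral>\<^sup>+\<omega>. ennreal (exp ((1/2) * (W s \<omega> - W t \<omega>))) * 2 \<partial>Q t)"
    by (intro nn_integral_cong, subst nn_integral_cmult) (simp_all only: half, measurable)
  also have "\<dots> = ennreal (exp (- (1/2) * (1 - 1/2) * V s t)) * 2"
    by (subst nn_integral_multc, measurable) (subst nn_exp_increment, simp)
  also have "\<dots> = ennreal (2 * exp (- V s t / 4))"
    by (subst ennreal_mult) (auto simp: mult.commute)
  finally show ?thesis .
qed

text \<open>
  Under \<open>Q t\<close> the increment has mean \<open>- V s t\<close> and variance \<open>2 * V s t\<close>. The exponent \<open>u / (2 * b)\<close> is the
  optimal one for a centred Gaussian variable of variance \<open>2 * b\<close>; the mean costs the factor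
  \<open>exp (u / 2)\<close> only.
\<close>

lemma drop_tail:
  assumes "V s t \<le> b" "0 < b" "0 \<le> u"
  shows "emeasure (Q t) {\<omega>\<in>space M. W s \<omega> - W t \<omega> \<le> - u} \<le> ennreal (exp (u / 2 - u\<^sup>2 / (4 * b)))"
proof -
  define \<tau> where "\<tau> = u / (2 * b)"
  have \<tau>: "0 \<le> \<tau>" using assms by (simp add: \<tau>_def)
  have "emeasure (Q t) {\<omega>\<in>space M. W s \<omega> - W t \<omega> \<le> - u} \<le> emeasure (Q t) {\<omega>\<in>space M. \<tau> * u \<le> (- \<tau>) * (W s \<omega> - W t \<omega>)}"
  proof (intro emeasure_mono)
    show "{\<omega> \<in> space M. W s \<omega> - W t \<omega> \<le> - u} \<subseteq> {\<omega> \<in> space M. \<tau> * u \<le> - \<tau> * (W s \<omega> - W t \<omega>)}"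
    proof safe
      fix \<omega> assume "W s \<omega> - W t \<omega> \<le> - u"
      then have "\<tau> * u \<le> \<tau> * (- (W s \<omega> - W t \<omega>))" using \<tau> by (intro mult_left_mono) auto
      then show "\<tau> * u \<le> - \<tau> * (W s \<omega> - W t \<omega>)" by (simp only: mult_minus_left mult_minus_right)
    qed
  qed measurable
  also have "\<dots> \<le> ennreal (exp (- (\<tau> * u) - (- \<tau>) * (1 - (- \<tau>)) * V s t))"
    by (rule increment_tail)
  also have "\<dots> \<le> ennreal (exp (u / 2 - u\<^sup>2 / (4 * b)))"
  proof (intro ennreal_leI, subst exp_le_cancel_iff)
    have "\<tau> * (1 + \<tau>) * V s t \<le> \<tau> * (1 + \<tau>) * b" using assms \<tau> by (intro mult_left_mono) auto
    also have "\<tau> * (1 + \<tau>) * b = u / 2 + u\<^sup>2 / (4 * b)"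
      using assms by (simp add: \<tau>_def field_simps power2_eq_square)
    finally have "\<tau> * (1 + \<tau>) * V s t \<le> u / 2 + u\<^sup>2 / (4 * b)" .
    moreover have "\<tau> * u = u\<^sup>2 / (4 * b) + u\<^sup>2 / (4 * b)" by (simp add: \<tau>_def power2_eq_square)
    ultimately show "- (\<tau> * u) - (- \<tau>) * (1 - (- \<tau>)) * V s t \<le> u / 2 - u\<^sup>2 / (4 * b)" by simp
  qed
  finally show ?thesis .
qed

end

section \<open>Variograms of power type and chaining\<close>

lemma exp_neg_le_power:
  fixes u :: real assumes "0 < u" shows "exp (- u) \<le> fact k / u ^ k"
proof -
  have "summable (\<lambda>n. u ^ n /\<^sub>R fact n)" by (rule summable_exp_generic)
  then have "sum (\<lambda>n. u ^ n /\<^sub>R fact n) {k} \<le> exp u"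
    unfolding exp_def using assms by (intro sum_le_suminf) auto
  then have "u ^ k / fact k \<le> exp u" by (simp add: divide_inverse mult.commute)
  then have "inverse (exp u) \<le> inverse (u ^ k / fact k)"
    using assms by (intro le_imp_inverse_le) auto
  then show ?thesis by (simp add: exp_minus)
qed

text \<open>
  The upper bound controls the oscillation of the paths, the lower bound makes distant times nearly
  incompatible, and the limit identifies the increments after a late time with those of a multiple of
  fractional Brownian motion.
\<close>

locale brown_resnick = gaussian_paths M Z for M :: "'a measure" and Z +
  fixes \<kappa> C1 C2 c :: real
  assumes pos: "0 < \<kappa>" "0 < C1" "0 < C2" "0 < c"
    and V_lower: "\<And>s t. 0 \<le> s \<Longrightarrow> 0 \<le> t \<Longrightarrow> C1 * \<bar>s - t\<bar> powr \<kappa> \<le> V s t"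
    and V_upper: "\<And>s t. 0 \<le> s \<Longrightarrow> 0 \<le> t \<Longrightarrow> V s t \<le> C2 * \<bar>s - t\<bar> powr \<kappa>"
    and V_local: "\<And>s t. 0 \<le> s \<Longrightarrow> 0 \<le> t \<Longrightarrow> ((\<lambda>r. V (r + s) (r + t)) \<longlongrightarrow> c * \<bar>s - t\<bar> powr \<kappa>) at_top"
begin

text \<open>
  Take levels \<open>- \<epsilon> * q ^ n\<close> increasing to 0. A path that is below \<open>- \<epsilon>\<close> at \<open>d\<close> and positive somewhere in
  the cell must, for some \<open>n\<close>, be below level \<open>n\<close> at a dyadic point of order \<open>n\<close> and above level \<open>n + 1\<close>
  at a neighbour of order \<open>n + 1\<close>. By \<open>emeasure_level\<close> this costs a tail probability of a single
  increment, and since the gaps between the levels shrink more slowly than the standard deviations of the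
  increments, these tails decay faster than the number of dyadic points grows. The exponent 2 of \<open>h\<close>
  makes the bound negligible against \<open>h\<close>, and so in a sum over the \<open>T / h\<close> cells of \<open>[0, T]\<close>.
\<close>

lemma chaining_cell:
  assumes \<epsilon>: "0 < \<epsilon>"
  obtains C where "0 < C" "\<And>d h. 0 \<le> d \<Longrightarrow> 0 < h \<Longrightarrow> h \<le> 1 \<Longrightarrow> \<exists>B\<in>sets mu.
    {p\<in>space mu. w d p \<le> - \<epsilon> \<and> (\<exists>s\<in>{d..<d + h}. 0 < w s p)} \<subseteq> B \<and> emeasure mu B \<le> ennreal (C * h\<^sup>2)"
proof -
  \<comment> \<open>Halving a distance multiplies the bound on the variogram by \<open>2 powr (- \<kappa>) = q ^ 4\<close>, and the square
    of a gap between levels by \<open>q\<^sup>2\<close> only.\<close>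
  define q where "q = 2 powr (- \<kappa> / 4)"
  have q: "0 < q" "q < 1" using pos by (auto simp: q_def powr_less_one)
  define b where "b = \<epsilon>\<^sup>2 * (1 - q)\<^sup>2 / (4 * C2 * q ^ 4)"
  have b: "0 < b" using q \<epsilon> pos by (simp add: b_def)
  define k where "k = nat \<lceil>4 / \<kappa>\<rceil>"
  have k: "4 \<le> \<kappa> * real k" 
  proof -
    have "4 / \<kappa> \<le> real k" unfolding k_def by (rule real_nat_ceiling_ge)
    then show ?thesis using pos by (simp add: field_simps)
  qed
  define C where "C = 4 * exp (2 * \<epsilon>) * fact k / b ^ k"
  show thesis
  proof (rule that[of C])
    show "0 < C" using b by (simp add: C_def)
    fix d h :: real assume d: "0 \<le> d" and h: "0 < h" "h \<le> 1"
    define P where "P n j = d + real j * (h / 2 ^ n)" for n j :: nat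
    define \<theta> where "\<theta> n = - \<epsilon> * q ^ n" for n :: nat
    define E where "E n j = {p\<in>space mu. \<theta> (Suc n) < w (P (Suc n) j) p \<and> w (P n (j div 2)) p \<le> \<theta> n}" for n j
    have Em[measurable]: "E n j \<in> sets mu" for n j unfolding E_def by measurable
    define B where "B = (\<Union>n. \<Union>j<2 ^ Suc n. E n j)"
    have P0: "0 \<le> P n j" for n j using d h by (simp add: P_def)
    have Em_bound: "emeasure mu (E n j) \<le> ennreal (exp (2 * \<epsilon>) * (fact k / b ^ k) * h\<^sup>2 * (1/4) ^ n)" for n j
    proof -
      define \<Delta> where "\<Delta> = \<theta> (Suc n) - \<theta> n"
      have \<Delta>_eq: "\<Delta> = \<epsilon> * q ^ n * (1 - q)" by (simp add: \<Delta>_def \<theta>_def algebra_simps)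
      have qn: "0 < q ^ n" "q ^ n \<le> 1" using q by (auto intro: power_le_one)
      have \<Delta>: "0 < \<Delta>" using \<epsilon> q unfolding \<Delta>_eq by simp
      have "\<epsilon> * q ^ n * (1 - q) \<le> \<epsilon> * 1 * 1" using \<epsilon> q qn by (intro mult_mono) auto
      then have \<Delta>': "\<Delta> \<le> \<epsilon>" by (simp add: \<Delta>_eq)
      define \<nu> where "\<nu> = C2 * (h / 2 ^ Suc n) powr \<kappa>"
      have \<nu>: "0 < \<nu>" using pos h by (simp add: \<nu>_def)
      have dist: "\<bar>P n (j div 2) - P (Suc n) j\<bar> \<le> h / 2 ^ Suc n"
      proof -
        have "real j = 2 * real (j div 2) + real (j mod 2)"
          by (metis mult_div_mod_eq of_nat_add of_nat_mult of_nat_numeral)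
        then have "P (Suc n) j - P n (j div 2) = real (j mod 2) * (h / 2 ^ Suc n)"
          by (simp add: P_def field_simps)
        then have "\<bar>P n (j div 2) - P (Suc n) j\<bar> = real (j mod 2) * (h / 2 ^ Suc n)"
          using h by (subst abs_minus_commute) simp
        also have "\<dots> \<le> 1 * (h / 2 ^ Suc n)"
          using h by (intro mult_right_mono) auto
        finally show ?thesis by simp
      qed
      have V\<nu>: "V (P n (j div 2)) (P (Suc n) j) \<le> \<nu>"
        using V_upper[OF P0 P0, of n "j div 2" "Suc n" j] powr_mono2[OF _ _ dist, of \<kappa>] pos
        unfolding \<nu>_def by (meson abs_ge_zero less_imp_le mult_left_mono order_trans)
      have "emeasure mu (E n j) \<le> emeasure mu {p\<in>space mu. \<theta> (Suc n) < w (P (Suc n) j) p \<and>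
          snd p \<in> {\<omega>\<in>space M. W (P n (j div 2)) \<omega> - W (P (Suc n) j) \<omega> \<le> - \<Delta>}}"
        unfolding E_def \<Delta>_def by (intro emeasure_mono) (auto simp: w_def)
      also have "\<dots> = ennreal (exp (- \<theta> (Suc n))) * emeasure (Q (P (Suc n) j)) {\<omega>\<in>space M. W (P n (j div 2)) \<omega> - W (P (Suc n) j) \<omega> \<le> - \<Delta>}"
        by (rule emeasure_level) measurable
      also have "\<dots> \<le> ennreal (exp (- \<theta> (Suc n))) * ennreal (exp (\<Delta> / 2 - \<Delta>\<^sup>2 / (4 * \<nu>)))"
        using \<Delta> by (intro mult_left_mono drop_tail V\<nu> \<nu>) auto
      also have "\<dots> = ennreal (exp (- \<theta> (Suc n) + \<Delta> / 2) * exp (- (\<Delta>\<^sup>2 / (4 * \<nu>))))"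
        by (simp add: exp_add[symmetric] flip: ennreal_mult)
      also have "\<dots> \<le> ennreal (exp (2 * \<epsilon>) * ((fact k / b ^ k) * (h\<^sup>2 * (1/4) ^ n)))"
      proof (intro ennreal_leI mult_mono)
        have "\<epsilon> * q ^ Suc n \<le> \<epsilon> * 1" using \<epsilon> q by (intro mult_left_mono power_le_one) auto
        then have "- \<theta> (Suc n) \<le> \<epsilon>" by (simp add: \<theta>_def)
        then show "exp (- \<theta> (Suc n) + \<Delta> / 2) \<le> exp (2 * \<epsilon>)" using \<Delta>' \<epsilon> by simp
        have q4: "(1 / 2 ^ Suc n) powr \<kappa> = q ^ (4 * Suc n)"
        proof -
          have "(1 / 2 ^ Suc n) powr \<kappa> = (2 powr (- real (Suc n))) powr \<kappa>"
            by (simp add: powr_minus powr_realpow inverse_eq_divide del: of_nat_Suc)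
          also have "\<dots> = (2 powr (- \<kappa> / 4)) powr real (4 * Suc n)"
            unfolding powr_powr by (intro arg_cong[where f = "\<lambda>x. 2 powr x"]) (simp add: field_simps)
          finally show ?thesis unfolding q_def[symmetric] using q by (subst (asm) powr_realpow) auto
        qed
        have \<nu>_eq: "\<nu> = C2 * h powr \<kappa> * q ^ (4 * Suc n)"
          unfolding \<nu>_def q4[symmetric] using h by (simp add: powr_divide powr_mult)
        define u where "u = b / h powr \<kappa> / q ^ (2 * n)"
        have u: "0 < u" using b h q by (simp add: u_def)
        have "\<Delta>\<^sup>2 / (4 * \<nu>) = u"
        proof -
          have "(e * y * r)\<^sup>2 / (4 * (C * H * (Q * y ^ 4))) = e\<^sup>2 * r\<^sup>2 / (4 * C * Q) / H / y\<^sup>2"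
            if "y \<noteq> 0" for e y r C H Q :: real
            using that by (simp add: power_mult_distrib power4_eq_xxxx power2_eq_square mult_ac)
          from this[of "q ^ n" \<epsilon> "1 - q" C2 "h powr \<kappa>" "q ^ 4"] show ?thesis
            using qn q unfolding \<Delta>_eq \<nu>_eq u_def b_def
            by (simp add: power_add power_mult[symmetric] mult.commute[of n])
        qed
        then have "exp (- (\<Delta>\<^sup>2 / (4 * \<nu>))) \<le> fact k / u ^ k" using exp_neg_le_power[OF u] by simp
        also have "\<dots> = (fact k / b ^ k) * ((h powr \<kappa>) ^ k * (q ^ (2 * n)) ^ k)"
          unfolding u_def using b h q by (simp add: power_divide power_mult_distrib)
        also have "\<dots> \<le> (fact k / b ^ k) * (h\<^sup>2 * (1/4) ^ n)"
        proof (intro mult_left_mono mult_mono)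
          have "(h powr \<kappa>) ^ k = h powr (\<kappa> * real k)"
            using h by (simp add: powr_realpow[symmetric] powr_powr)
          also have "\<dots> \<le> h powr 2" using h k by (intro powr_mono') auto
          also have "h powr 2 = h\<^sup>2" using h by simp
          finally show "(h powr \<kappa>) ^ k \<le> h\<^sup>2" .
          have "(q ^ (2 * n)) ^ k = (q powr (2 * real k)) ^ n"
            using q by (simp add: powr_realpow[symmetric] powr_powr mult_ac)
          also have "\<dots> \<le> (1/4) ^ n"
          proof (rule power_mono)
            have "q powr (2 * real k) = 2 powr (- (\<kappa> * real k / 2))" unfolding q_def powr_powr by (intro arg_cong[where f = "\<lambda>x. 2 powr x"]) (simp add: field_simps)
            also have "\<dots> \<le> 2 powr (- 2)" using k by (intro powr_mono) auto
            also have "(2::real) powr (- 2) = 1 / 4" by (simp add: powr_minus)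
            finally show "q powr (2 * real k) \<le> 1 / 4" .
          qed simp
          finally show "(q ^ (2 * n)) ^ k \<le> (1/4) ^ n" .
        qed (use b h q in auto)
        finally show "exp (- (\<Delta>\<^sup>2 / (4 * \<nu>))) \<le> (fact k / b ^ k) * (h\<^sup>2 * (1/4) ^ n)" .
      qed auto
      finally show ?thesis by (simp add: mult.assoc)
    qed
    show "\<exists>B\<in>sets mu. {p\<in>space mu. w d p \<le> - \<epsilon> \<and> (\<exists>s\<in>{d..<d + h}. 0 < w s p)} \<subseteq> B \<and> emeasure mu B \<le> ennreal (C * h\<^sup>2)"
    proof (intro bexI[of _ B] conjI subsetI)
      show "B \<in> sets mu" unfolding B_def by measurable
      define K where "K = exp (2 * \<epsilon>) * (fact k / b ^ k) * h\<^sup>2"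
      have K: "0 \<le> K" using b by (simp add: K_def)
      have "emeasure mu B \<le> (\<Sum>n. emeasure mu (\<Union>j<2 ^ Suc n. E n j))"
        unfolding B_def by (rule emeasure_subadditive_countably) (auto intro!: sets.countable_UN)
      also have "\<dots> \<le> (\<Sum>n. ennreal (2 * K * (1/2) ^ n))"
      proof (intro suminf_le allI)
        fix n
        have "emeasure mu (\<Union>j<2 ^ Suc n. E n j) \<le> (\<Sum>j<2 ^ Suc n. emeasure mu (E n j))"
          by (rule emeasure_subadditive_finite) auto
        also have "\<dots> \<le> (\<Sum>j<2 ^ Suc n::nat. ennreal (K * (1/4) ^ n))"
          unfolding K_def by (intro sum_mono Em_bound)
        also have "\<dots> = ennreal (2 ^ Suc n * (K * (1/4) ^ n))"
          using K by (simp add: ennreal_of_nat_eq_real_of_nat ennreal_mult flip: ennreal_power)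
        also have "2 ^ Suc n * (K * (1/4) ^ n) = 2 * K * (1/2) ^ n"
          by (simp add: field_simps flip: power_mult_distrib)
        finally show "emeasure mu (\<Union>j<2 ^ Suc n. E n j) \<le> ennreal (2 * K * (1/2) ^ n)" .
      qed auto
      also have "\<dots> = ennreal (2 * K * 2)"
      proof (rule suminf_ennreal_eq)
        show "(\<lambda>n. 2 * K * (1/2) ^ n) sums (2 * K * 2)"
          using geometric_sums[of "1/2::real"] by (intro sums_mult) simp
      qed (use K in simp)
      finally show "emeasure mu B \<le> ennreal (C * h\<^sup>2)" by (simp add: K_def C_def mult_ac)
    next
      fix p assume "p \<in> {p\<in>space mu. w d p \<le> - \<epsilon> \<and> (\<exists>s\<in>{d..<d + h}. 0 < w s p)}"
      then obtain s where p: "p \<in> space mu" "w d p \<le> - \<epsilon>" and s: "d \<le> s" "s < d + h" "0 < w s p" by auto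
      have "isCont (\<lambda>s. w s p) s" using w_cont[OF p(1)] by (simp add: continuous_on_eq_continuous_at)
      then obtain \<delta> where \<delta>: "0 < \<delta>" "\<And>r. \<bar>r - s\<bar> < \<delta> \<Longrightarrow> \<bar>w r p - w s p\<bar> < w s p"
        using s(3) unfolding continuous_at_eps_delta by (metis dist_real_def)
      obtain n where n: "(1/2) ^ n < \<delta> / h"
        using real_arch_pow_inv[of "\<delta> / h" "1/2"] \<delta>(1) h by auto
      define j where "j = nat \<lfloor>(s - d) * 2 ^ n / h\<rfloor>"
      have x: "0 \<le> (s - d) * 2 ^ n / h" using s h by simp
      have j1: "real j \<le> (s - d) * 2 ^ n / h" "(s - d) * 2 ^ n / h < real j + 1"
        unfolding j_def using x by (auto simp: of_nat_nat)
      have "(s - d) * 2 ^ n / h < h * 2 ^ n / h"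
        using s h by (intro divide_strict_right_mono mult_strict_right_mono) auto
      then have "(s - d) * 2 ^ n / h < 2 ^ n" using h by simp
      with j1(1) have "real j < 2 ^ n" by (rule le_less_trans)
      then have j2: "j < 2 ^ n" by simp
      define y where "y = real j * (h / 2 ^ n)"
      have "y \<le> s - d" "s - d < y + h / 2 ^ n"
        unfolding y_def using j1 h by (auto simp: field_simps)
      moreover have "h / 2 ^ n < \<delta>" using n h by (simp add: field_simps power_divide)
      ultimately have "\<bar>P n j - s\<bar> < \<delta>" unfolding P_def y_def[symmetric] by linarith
      then have "0 < w (P n j) p" using \<delta>(2)[of "P n j"] by auto
      moreover have "\<theta> n \<le> 0" using \<epsilon> q by (simp add: \<theta>_def)
      ultimately have ex: "\<exists>j<2 ^ n. \<theta> n < w (P n j) p" using j2 by force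
      \<comment> \<open>The first order at which some dyadic point is above its level; one order earlier its
        neighbour was still below.\<close>
      define m where "m = (LEAST n. \<exists>j<2 ^ n. \<theta> n < w (P n j) p)"
      have m: "\<exists>j<2 ^ m. \<theta> m < w (P m j) p"
        unfolding m_def using ex by (rule LeastI)
      have "\<not> (\<exists>j<2 ^ 0. \<theta> 0 < w (P 0 j) p)" using p by (simp add: P_def \<theta>_def not_less)
      with m have "m \<noteq> 0" by metis
      then obtain m' where m': "m = Suc m'" using not0_implies_Suc by auto
      then have no: "\<not> (\<exists>j<2 ^ m'. \<theta> m' < w (P m' j) p)"
        using not_less_Least[of m' "\<lambda>n. \<exists>j<2 ^ n. \<theta> n < w (P n j) p"] by (simp add: m_def)
      obtain j' where j': "j' < 2 ^ Suc m'" "\<theta> (Suc m') < w (P (Suc m') j') p" using m m' by auto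
      have "j' div 2 < 2 ^ m'" using j'(1) by auto
      then have "w (P m' (j' div 2)) p \<le> \<theta> m'" using no by (meson not_less)
      then have "p \<in> E m' j'" using j' p by (simp add: E_def)
      then show "p \<in> B" using j' by (auto simp: B_def)
    qed
  qed
qed

end

section \<open>Occupation of a window after a given time\<close>

lemma integrable_exp_tail: "integrable lborel (\<lambda>z. indicator {\<theta><..} z * exp (- z :: real))"
proof (rule integrableI_bounded)
  have "(\<integral>\<^sup>+z. ennreal (norm (indicator {\<theta><..} z * exp (- z))) \<partial>lborel) =
    (\<integral>\<^sup>+z. ennreal (exp (- z)) * indicator {\<theta><..} z \<partial>lborel)"
    by (intro nn_integral_cong) (auto split: split_indicator)
  then show "(\<integral>\<^sup>+z. ennreal (norm (indicator {\<theta><..} z * exp (- z))) \<partial>lborel) < \<infinity>"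
    by (simp add: exp_tail_integral)
qed measurable

context gaussian_paths begin

definition "window_at g f A t z = (\<integral>\<omega>. f (occupation (\<lambda>u. g (u + z)) 0 A (\<lambda>s. W (t + s) \<omega> - W t \<omega>)) \<partial>Q t)"

text \<open>
  The integral over \<open>mu\<close> of \<open>m (w t)\<close> times \<open>f\<close> of the occupation of \<open>[t, t + A]\<close>
  (\<open>nn_integral_window\<close>), written with the value \<open>z\<close> of the path at \<open>t\<close> as the outer variable.
\<close>

definition "window g f m A t = (\<integral>z. m z * exp (- z) * window_at g f A t z \<partial>lborel)"

lemma W_path_meas [measurable]: "\<omega> \<in> space M \<Longrightarrow> (\<lambda>s. W s \<omega>) \<in> borel_measurable borel"
  by (intro borel_measurable_continuous_onI W_cont)

lemma w_path_meas: "p \<in> space mu \<Longrightarrow> (\<lambda>s. w s p) \<in> borel_measurable borel"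
  by (intro borel_measurable_continuous_onI w_cont)

lemma increment_pair_meas: "case_prod (\<lambda>s \<omega>. W (t + s) \<omega> - W t \<omega>) \<in> borel_measurable (borel \<Otimes>\<^sub>M M)"
proof -
  have [measurable]: "(\<lambda>p. W (t + fst p) (snd p)) \<in> borel_measurable (borel \<Otimes>\<^sub>M M)"
    using measurable_compose[where f = "\<lambda>p. (t + fst p, snd p)" and g = "case_prod W", OF _ W_pair_meas] by simp
  show ?thesis unfolding case_prod_beta' by measurable
qed

lemma occupation_mu_meas [measurable]:
  "g \<in> borel_measurable borel \<Longrightarrow> (\<lambda>p. occupation g a b (\<lambda>s. w s p)) \<in> borel_measurable (borel \<Otimes>\<^sub>M M)"
  by (rule occupation_measurable[OF w_pair_meas])

lemma occupation_window_meas: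
  assumes [measurable]: "g \<in> borel_measurable borel"
  shows "(\<lambda>p. occupation (\<lambda>u. g (u + fst p)) 0 A (\<lambda>s. W (t + s) (snd p) - W t (snd p))) \<in> borel_measurable (borel \<Otimes>\<^sub>M M)"
proof -
  have "case_prod (\<lambda>s p. W (t + s) (snd p) - W t (snd p) + fst p) \<in> borel_measurable (borel \<Otimes>\<^sub>M (borel \<Otimes>\<^sub>M M))"
  proof -
    have [measurable]: "(\<lambda>x. W (t + fst x) (snd (snd x)) - W t (snd (snd x))) \<in> borel_measurable (borel \<Otimes>\<^sub>M (borel \<Otimes>\<^sub>M M))"
    proof -
      have "(\<lambda>x. (fst x, snd (snd x))) \<in> (borel \<Otimes>\<^sub>M (borel \<Otimes>\<^sub>M M)) \<rightarrow>\<^sub>M (borel \<Otimes>\<^sub>M M)" by measurable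
      from measurable_compose[OF this increment_pair_meas[of t]] show ?thesis by simp
    qed
    show ?thesis unfolding case_prod_beta' by measurable
  qed
  from occupation_measurable[OF this, of g 0 A] show ?thesis
    unfolding occupation_translate by simp
qed

context
  fixes g f m :: "real \<Rightarrow> real" and b K A :: real
  assumes g: "continuous_on UNIV g" "\<And>u. 0 \<le> g u" "\<And>u. g u \<le> 1"
    and f: "continuous_on UNIV f" "\<And>u. 0 \<le> f u" "\<And>u. f u \<le> K"
    and m: "m \<in> borel_measurable borel" "\<And>z. 0 \<le> m z" "\<And>z. m z \<le> indicator {b<..} z"
begin

lemma g_f_meas: "g \<in> borel_measurable borel" "f \<in> borel_measurable borel"
  using g f by (auto intro: borel_measurable_continuous_onI)

lemma window_at_meas: "(\<lambda>z. window_at g f A t z) \<in> borel_measurable borel"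
proof -
  interpret Qt: prob_space "Q t" by (rule prob_space_Q)
  note [measurable] = occupation_window_meas[OF g_f_meas(1), of A t] g_f_meas
  show ?thesis
    unfolding window_at_def by (rule Qt.borel_measurable_lebesgue_integral) (simp add: case_prod_beta')
qed

lemma window_at_bounds: "0 \<le> window_at g f A t z" "window_at g f A t z \<le> K"
  and window_at_nn: "(\<integral>\<^sup>+\<omega>. ennreal (f (occupation (\<lambda>u. g (u + z)) 0 A (\<lambda>s. W (t + s) \<omega> - W t \<omega>))) \<partial>Q t) = ennreal (window_at g f A t z)"
proof -
  interpret Qt: prob_space "Q t" by (rule prob_space_Q)
  note [measurable] = g_f_meas
  have [measurable]: "(\<lambda>\<omega>. occupation (\<lambda>u. g (u + z)) 0 A (\<lambda>s. W (t + s) \<omega> - W t \<omega>)) \<in> borel_measurable M"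
    by (rule occupation_measurable[OF increment_pair_meas]) measurable
  have int: "integrable (Q t) (\<lambda>\<omega>. f (occupation (\<lambda>u. g (u + z)) 0 A (\<lambda>s. W (t + s) \<omega> - W t \<omega>)))"
    by (rule Qt.integrable_const_bound[where B = K]) (use f in auto)
  show "0 \<le> window_at g f A t z" unfolding window_at_def using f by (intro Bochner_Integration.integral_nonneg) auto
  have "window_at g f A t z \<le> (\<integral>\<omega>. K \<partial>Q t)" unfolding window_at_def using int f by (intro integral_mono) auto
  then show "window_at g f A t z \<le> K" using Qt.prob_space by simp
  show "(\<integral>\<^sup>+\<omega>. ennreal (f (occupation (\<lambda>u. g (u + z)) 0 A (\<lambda>s. W (t + s) \<omega> - W t \<omega>))) \<partial>Q t) = ennreal (window_at g f A t z)"
    unfolding window_at_def using int f by (intro nn_integral_eq_integral) auto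
qed

lemma window_bound: "norm (m z * exp (- z) * window_at g f A t z) \<le> K * (indicator {b<..} z * exp (- z))"
proof -
  have "m z * exp (- z) * window_at g f A t z \<le> (indicator {b<..} z * exp (- z)) * K"
    using m window_at_bounds[of t z] by (intro mult_mono) auto
  then show ?thesis using m window_at_bounds[of t z] by (simp add: abs_mult mult.commute)
qed

lemma window_integrable: "integrable lborel (\<lambda>z. m z * exp (- z) * window_at g f A t z)"
proof (rule Bochner_Integration.integrable_bound[where f = "\<lambda>z. K * (indicator {b<..} z * exp (- z))"])
  show "integrable lborel (\<lambda>z. K * (indicator {b<..} z * exp (- z)))"
    using integrable_exp_tail[of b] by simp
  have K: "0 \<le> K" using f(2,3)[of 0] by (rule order_trans)
  show "AE z in lborel. norm (m z * exp (- z) * window_at g f A t z) \<le> norm (K * (indicator {b<..} z * exp (- z)))"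
    using window_bound K by (intro AE_I2) (auto simp: abs_mult intro: order_trans)
  show "(\<lambda>z. m z * exp (- z) * window_at g f A t z) \<in> borel_measurable lborel"
    using m(1) window_at_meas[of t] by simp
qed

lemma nn_integral_window:
  "(\<integral>\<^sup>+p. ennreal (m (w t p) * f (occupation g t (t + A) (\<lambda>s. w s p))) \<partial>mu) = ennreal (window g f m A t)"
proof -
  interpret Qt: prob_space "Q t" by (rule prob_space_Q)
  interpret QL: pair_sigma_finite lborel "Q t" ..
  note [measurable] = g_f_meas m(1) occupation_window_meas[OF g_f_meas(1), of A t]
  have eq: "occupation g t (t + A) (\<lambda>s. w s (z - W t \<omega>, \<omega>)) = occupation (\<lambda>u. g (u + z)) 0 A (\<lambda>s. W (t + s) \<omega> - W t \<omega>)" for z \<omega>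
    using occupation_shift[of g t 0 A "\<lambda>s. w s (z - W t \<omega>, \<omega>)"]
    by (simp add: occupation_translate w_def algebra_simps)
  have "(\<integral>\<^sup>+p. ennreal (m (w t p) * f (occupation g t (t + A) (\<lambda>s. w s p))) \<partial>mu) =
    (\<integral>\<^sup>+\<omega>. \<integral>\<^sup>+z. ennreal (m z * f (occupation (\<lambda>u. g (u + z)) 0 A (\<lambda>s. W (t + s) \<omega> - W t \<omega>))) * ennreal (exp (- z)) \<partial>lborel \<partial>Q t)"
    by (subst nn_integral_mu[where t = t], measurable) (simp only: eq, simp add: w_def)
  also have "\<dots> = (\<integral>\<^sup>+z. \<integral>\<^sup>+\<omega>. ennreal (m z * f (occupation (\<lambda>u. g (u + z)) 0 A (\<lambda>s. W (t + s) \<omega> - W t \<omega>))) * ennreal (exp (- z)) \<partial>Q t \<partial>lborel)"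
  proof (rule QL.Fubini')
    have "(\<lambda>x. ennreal (m (fst x) * f (occupation (\<lambda>u. g (u + fst x)) 0 A (\<lambda>s. W (t + s) (snd x) - W t (snd x)))) * ennreal (exp (- fst x)))
      \<in> borel_measurable (borel \<Otimes>\<^sub>M M)" by measurable
    then show "(\<lambda>(z, \<omega>). ennreal (m z * f (occupation (\<lambda>u. g (u + z)) 0 A (\<lambda>s. W (t + s) \<omega> - W t \<omega>))) * ennreal (exp (- z)))
      \<in> borel_measurable (lborel \<Otimes>\<^sub>M Q t)"
      by (subst measurable_cong_sets[OF sets_pair_measure_cong[OF sets_lborel sets_Q] refl]) (simp add: case_prod_beta')
  qed
  also have "\<dots> = (\<integral>\<^sup>+z. ennreal (m z * exp (- z) * window_at g f A t z) \<partial>lborel)"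
  proof (rule nn_integral_cong)
    fix z
    have [measurable]: "(\<lambda>\<omega>. occupation (\<lambda>u. g (u + z)) 0 A (\<lambda>s. W (t + s) \<omega> - W t \<omega>)) \<in> borel_measurable M"
      by (rule occupation_measurable[OF increment_pair_meas]) measurable
    have "(\<integral>\<^sup>+\<omega>. ennreal (m z * f (occupation (\<lambda>u. g (u + z)) 0 A (\<lambda>s. W (t + s) \<omega> - W t \<omega>))) * ennreal (exp (- z)) \<partial>Q t) =
      (\<integral>\<^sup>+\<omega>. ennreal (m z * exp (- z)) * ennreal (f (occupation (\<lambda>u. g (u + z)) 0 A (\<lambda>s. W (t + s) \<omega> - W t \<omega>))) \<partial>Q t)"
      using m f by (intro nn_integral_cong) (simp add: mult_ac flip: ennreal_mult)
    also have "\<dots> = ennreal (m z * exp (- z)) * ennreal (window_at g f A t z)"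
      by (subst nn_integral_cmult) (auto simp: window_at_nn)
    finally show "(\<integral>\<^sup>+\<omega>. ennreal (m z * f (occupation (\<lambda>u. g (u + z)) 0 A (\<lambda>s. W (t + s) \<omega> - W t \<omega>))) * ennreal (exp (- z)) \<partial>Q t) =
      ennreal (m z * exp (- z) * window_at g f A t z)"
      using m window_at_bounds[of t z] by (simp flip: ennreal_mult)
  qed
  also have "\<dots> = ennreal (window g f m A t)"
    unfolding window_def using window_integrable m window_at_bounds by (intro nn_integral_eq_integral) auto
  finally show ?thesis .
qed

end

lemma increments_tight:
  assumes "0 < e"
  obtains R where "\<And>s t. V s t \<le> b \<Longrightarrow> measure (Q t) {\<omega>\<in>space M. R < \<bar>W s \<omega> - W t \<omega>\<bar>} \<le> e"
proof -
  define R where "R = ln ((1 + exp (2 * b)) / e)"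
  have R: "exp (- R) * (1 + exp (2 * b)) = e"
  proof -
    have "0 < 1 + exp (2 * b)" by (simp add: add_pos_pos)
    then show ?thesis using assms by (simp add: R_def exp_minus)
  qed
  show thesis
  proof (rule that[of R])
    fix s t assume V: "V s t \<le> b"
    interpret Qt: prob_space "Q t" by (rule prob_space_Q)
    have "ennreal (measure (Q t) {\<omega>\<in>space M. R < \<bar>W s \<omega> - W t \<omega>\<bar>}) \<le>
       emeasure (Q t) ({\<omega>\<in>space M. R \<le> 1 * (W s \<omega> - W t \<omega>)} \<union> {\<omega>\<in>space M. R \<le> (-1) * (W s \<omega> - W t \<omega>)})"
      unfolding Qt.emeasure_eq_measure[symmetric] by (intro emeasure_mono) auto
    also have "\<dots> \<le> emeasure (Q t) {\<omega>\<in>space M. R \<le> 1 * (W s \<omega> - W t \<omega>)} + emeasure (Q t) {\<omega>\<in>space M. R \<le> (-1) * (W s \<omega> - W t \<omega>)}"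
      by (rule emeasure_subadditive) auto
    also have "\<dots> \<le> ennreal (exp (- R - 1 * (1 - 1) * V s t)) + ennreal (exp (- R - (-1) * (1 - (-1)) * V s t))"
      by (intro add_mono increment_tail)
    also have "\<dots> = ennreal (exp (- R) + exp (- R + 2 * V s t))"
      by (simp flip: ennreal_plus)
    also have "\<dots> \<le> ennreal (exp (- R) + exp (- R + 2 * b))"
      using V by (intro ennreal_leI) simp
    also have "exp (- R) + exp (- R + 2 * b) = e" unfolding exp_add using R by (simp add: distrib_left)
    finally show "measure (Q t) {\<omega>\<in>space M. R < \<bar>W s \<omega> - W t \<omega>\<bar>} \<le> e"
      using assms by simp
  qed
qed

end

lemma tendsto_sum_list:
  fixes l :: "'a \<Rightarrow> real"
  assumes "\<And>x. x \<in> set xs \<Longrightarrow> (f x \<longlongrightarrow> l x) F"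
  shows "((\<lambda>n. \<Sum>x\<leftarrow>xs. f x n) \<longlongrightarrow> (\<Sum>x\<leftarrow>xs. l x)) F"
  using assms by (induction xs) (auto intro!: tendsto_add)

text \<open>
  For \<open>\<epsilon> > 0\<close>, positive exactly on the strip \<open>(- \<epsilon>, 0)\<close>.
\<close>

definition bump :: "real \<Rightarrow> real \<Rightarrow> real" where
  "bump \<epsilon> u = max 0 (min 1 (min (u + \<epsilon>) (- u)))"

text \<open>
  A continuous majorant of the indicator of \<open>k \<le> \<delta>\<close> that vanishes from \<open>2 * \<delta>\<close> on.
\<close>

definition cutoff :: "real \<Rightarrow> real \<Rightarrow> real" where
  "cutoff \<delta> k = max 0 (min 1 (2 - k / \<delta>))"

text \<open>
  For \<open>\<epsilon> > 0\<close>, positive exactly on the strip \<open>(- \<epsilon>, 0)\<close>.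
\<close>

lemma bump_continuous_bounded: "continuous_on UNIV (bump \<epsilon>)" "0 \<le> bump \<epsilon> u" "bump \<epsilon> u \<le> 1"
  unfolding bump_def by (auto intro!: continuous_intros)

text \<open>
  A continuous majorant of the indicator of \<open>k \<le> \<delta>\<close> that vanishes from \<open>2 * \<delta>\<close> on.
\<close>

lemma cutoff_continuous_bounded: "continuous_on UNIV (cutoff \<delta>)" "0 \<le> cutoff \<delta> u" "cutoff \<delta> u \<le> 1"
  unfolding cutoff_def divide_inverse by (auto intro!: continuous_intros)

lemma cutoff_eq_1: "0 < \<delta> \<Longrightarrow> k \<le> \<delta> \<Longrightarrow> cutoff \<delta> k = 1"
  and cutoff_eq_0: "0 < \<delta> \<Longrightarrow> 2 * \<delta> \<le> k \<Longrightarrow> cutoff \<delta> k = 0"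
  by (auto simp: cutoff_def field_simps max_def min_def)

lemma bump_meas [measurable]: "bump \<epsilon> \<in> borel_measurable borel"
  by (rule borel_measurable_continuous_onI[OF bump_continuous_bounded(1)])

section \<open>Visits to a strip below zero\<close>

context brown_resnick begin

text \<open>
  The probability that the increment at time \<open>n\<close> exceeds \<open>- u\<close> is at most a multiple of
  \<open>exp (- C1 * n powr \<kappa> / 4)\<close>, because of the negative drift.
\<close>

lemma increments_unbounded_below:
  "AE \<omega> in Q 0. \<exists>n::nat. W (real n) \<omega> - W 0 \<omega> \<le> - u"
proof -
  define B where "B = {\<omega>\<in>space M. \<forall>n::nat. - u < W (real n) \<omega> - W 0 \<omega>}"
  have [measurable]: "B \<in> sets M" unfolding B_def by measurable
  have bound: "emeasure (Q 0) B \<le> ennreal (exp (u / 2 - C1 * real n powr \<kappa> / 4))" for n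
  proof -
    have "emeasure (Q 0) B \<le> emeasure (Q 0) {\<omega>\<in>space M. - u / 2 \<le> (1/2) * (W (real n) \<omega> - W 0 \<omega>)}"
      by (intro emeasure_mono) (auto simp: B_def less_imp_le field_simps)
    also have "\<dots> \<le> ennreal (exp (- (- u / 2) - (1/2) * (1 - 1/2) * V (real n) 0))"
      by (rule increment_tail)
    also have "\<dots> \<le> ennreal (exp (u / 2 - C1 * real n powr \<kappa> / 4))"
      using V_lower[of "real n" 0] by (intro ennreal_leI) simp
    finally show ?thesis .
  qed
  have pw: "filterlim (\<lambda>n. real n powr \<kappa>) at_top sequentially"
    using pos(1) by real_asymp
  have "filterlim (\<lambda>n. - (u / 2) + C1 / 4 * real n powr \<kappa>) at_top sequentially"
    using pos by (intro filterlim_tendsto_add_at_top[OF tendsto_const] filterlim_tendsto_pos_mult_at_top[OF tendsto_const _ pw]) auto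
  then have "(\<lambda>n. exp (- (- (u / 2) + C1 / 4 * real n powr \<kappa>))) \<longlonglongrightarrow> 0"
    by (intro filterlim_compose[OF exp_at_bot] filterlim_compose[OF filterlim_uminus_at_bot_at_top])
  then have lim: "(\<lambda>n. ennreal (exp (u / 2 - C1 * real n powr \<kappa> / 4))) \<longlonglongrightarrow> ennreal 0"
    by (intro tendsto_ennrealI) simp
  have "emeasure (Q 0) B \<le> ennreal 0"
    by (rule LIMSEQ_le_const[OF lim]) (use bound in auto)
  then have "AE \<omega> in Q 0. \<omega> \<notin> B"
    by (intro AE_I[of _ _ B]) auto
  then show ?thesis using AE_space by eventually_elim (auto simp: B_def not_less)
qed

lemma strip_visited:
  assumes \<epsilon>: "0 < \<epsilon>" and z: "- \<epsilon> / 2 < z" and \<omega>: "\<omega> \<in> space M"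
    and below: "W (real n) \<omega> - W 0 \<omega> \<le> - (z + \<epsilon>)"
  shows "0 < occupation (\<lambda>u. bump \<epsilon> (u + z)) 0 (real (Suc n)) (\<lambda>s. W (0 + s) \<omega> - W 0 \<omega>)"
proof -
  have cont: "continuous_on UNIV (\<lambda>s. W (0 + s) \<omega> - W 0 \<omega>)"
    using W_cont[OF \<omega>] by (intro continuous_intros) auto
  have "\<exists>s. 0 \<le> s \<and> s \<le> real n \<and> W (0 + s) \<omega> - W 0 \<omega> = - (z + 3 * \<epsilon> / 4)"
    by (rule IVT2') (use below z \<epsilon> cont in \<open>auto intro: continuous_on_subset\<close>)
  then obtain s where s: "0 \<le> s" "s \<le> real n" "W (0 + s) \<omega> - W 0 \<omega> = - (z + 3 * \<epsilon> / 4)" by auto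
  have "0 < bump \<epsilon> (W (0 + s) \<omega> - W 0 \<omega> + z)"
    unfolding s(3) using \<epsilon> by (simp add: bump_def)
  then show ?thesis
    using s bump_continuous_bounded by (intro occupation_pos[OF cont _ _ _ s(1)]) (auto intro!: continuous_on_compose2[OF bump_continuous_bounded(1)] continuous_intros)
qed

text \<open>
  A path that starts above \<open>- \<epsilon> / 2\<close> and is unbounded below spends a positive time in the strip
  \<open>(- \<epsilon>, 0)\<close> by continuity. So \<open>A = n + 1\<close> and \<open>\<delta> = 1 / (n + 1)\<close> work for large \<open>n\<close>, by dominated
  convergence in the path and in the starting level.
\<close>

lemma strip_window_small:
  assumes \<epsilon>: "0 < \<epsilon>" and e: "0 < e"
  obtains A \<delta> where "0 < A" "0 < \<delta>" "window (bump \<epsilon>) (cutoff \<delta>) (indicator {- \<epsilon> / 2<..}) A 0 \<le> e"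
proof -
  define m where "m = (indicator {- \<epsilon> / 2<..} :: real \<Rightarrow> real)"
  have m: "m \<in> borel_measurable borel" "\<And>z. 0 \<le> m z" "\<And>z. m z \<le> indicator {- \<epsilon> / 2<..} z"
    by (auto simp: m_def)
  define d where "d n = inverse (real (Suc n))" for n
  have d: "0 < d n" for n by (simp add: d_def)
  have at: "(\<lambda>n. window_at (bump \<epsilon>) (cutoff (d n)) (real (Suc n)) 0 z) \<longlonglongrightarrow> 0" if z: "- \<epsilon> / 2 < z" for z
  proof -
    interpret Q0: prob_space "Q 0" by (rule prob_space_Q)
    have cm[measurable]: "cutoff (d n) \<in> borel_measurable borel" for n
      by (rule borel_measurable_continuous_onI[OF cutoff_continuous_bounded(1)])
    have [measurable]: "(\<lambda>\<omega>. occupation (\<lambda>u. bump \<epsilon> (u + z)) 0 (real (Suc n)) (\<lambda>s. W (0 + s) \<omega> - W 0 \<omega>)) \<in> borel_measurable (Q 0)" for n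
      by (subst measurable_cong_sets[OF sets_Q refl], rule occupation_measurable[OF increment_pair_meas]) measurable
    have "(\<lambda>n. window_at (bump \<epsilon>) (cutoff (d n)) (real (Suc n)) 0 z) \<longlonglongrightarrow> (\<integral>\<omega>. 0 \<partial>Q 0)"
      unfolding window_at_def
    proof (rule integral_dominated_convergence[where w = "\<lambda>_. 1"])
      show "AE \<omega> in Q 0. (\<lambda>n. cutoff (d n) (occupation (\<lambda>u. bump \<epsilon> (u + z)) 0 (real (Suc n)) (\<lambda>s. W (0 + s) \<omega> - W 0 \<omega>))) \<longlonglongrightarrow> 0"
        using increments_unbounded_below[of "z + \<epsilon>"] AE_space
      proof eventually_elim
        case (elim \<omega>)
        then obtain n where n: "W (real n) \<omega> - W 0 \<omega> \<le> - (z + \<epsilon>)" and \<omega>: "\<omega> \<in> space M" by auto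
        define occ where "occ k = occupation (\<lambda>u. bump \<epsilon> (u + z)) 0 (real (Suc k)) (\<lambda>s. W (0 + s) \<omega> - W 0 \<omega>)" for k
        have occ_pos: "0 < occ n" unfolding occ_def by (rule strip_visited[OF \<epsilon> z \<omega> n])
        have pm[measurable]: "(\<lambda>s. W (0 + s) \<omega> - W 0 \<omega>) \<in> borel_measurable borel"
          using W_cont[OF \<omega>] by (intro borel_measurable_continuous_onI) (auto intro!: continuous_intros)
        have mono: "occ n \<le> occ k" if "n \<le> k" for k
          unfolding occ_def using that bump_continuous_bounded by (intro occupation_mono[OF pm]) auto
        have "(\<lambda>n. 2 * d n) \<longlonglongrightarrow> 2 * 0"
          unfolding d_def by (intro tendsto_mult tendsto_const LIMSEQ_inverse_real_of_nat)
        then have "\<forall>\<^sub>F k in sequentially. 2 * d k < occ n"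
          using occ_pos by (intro order_tendstoD) auto
        then have "\<forall>\<^sub>F k in sequentially. cutoff (d k) (occ k) = 0"
          using eventually_ge_at_top[of n]
        proof eventually_elim
          case (elim k)
          then show ?case using mono[of k] d[of k] by (intro cutoff_eq_0) auto
        qed
        then show ?case unfolding occ_def by (rule tendsto_eventually)
      qed
      show "(\<lambda>\<omega>. cutoff (d n) (occupation (\<lambda>u. bump \<epsilon> (u + z)) 0 (real (Suc n)) (\<lambda>s. W (0 + s) \<omega> - W 0 \<omega>))) \<in> borel_measurable (Q 0)" for n
        by measurable
    qed (use cutoff_continuous_bounded in auto)
    then show ?thesis by simp
  qed
  have "(\<lambda>n. window (bump \<epsilon>) (cutoff (d n)) m (real (Suc n)) 0) \<longlonglongrightarrow> (LBINT z::real. 0)"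
    unfolding window_def
  proof (rule integral_dominated_convergence[where w = "\<lambda>z. 1 * (indicator {- \<epsilon> / 2<..} z * exp (- z))"])
    show "AE z in lborel. (\<lambda>n. m z * exp (- z) * window_at (bump \<epsilon>) (cutoff (d n)) (real (Suc n)) 0 z) \<longlonglongrightarrow> 0"
    proof (intro AE_I2)
      fix z :: real
      show "(\<lambda>n. m z * exp (- z) * window_at (bump \<epsilon>) (cutoff (d n)) (real (Suc n)) 0 z) \<longlonglongrightarrow> 0"
      proof (cases "- \<epsilon> / 2 < z")
        case True
        then show ?thesis using tendsto_mult[OF tendsto_const[of "m z * exp (- z)"] at[OF True]] by simp
      qed (simp add: m_def)
    qed
    show "AE z in lborel. norm (m z * exp (- z) * window_at (bump \<epsilon>) (cutoff (d n)) (real (Suc n)) 0 z) \<le> 1 * (indicator {- \<epsilon> / 2<..} z * exp (- z))" for n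
      by (intro AE_I2 window_bound bump_continuous_bounded cutoff_continuous_bounded m)
    show "(\<lambda>z. m z * exp (- z) * window_at (bump \<epsilon>) (cutoff (d n)) (real (Suc n)) 0 z) \<in> borel_measurable lborel" for n
      using window_at_meas[OF bump_continuous_bounded[of \<epsilon>] cutoff_continuous_bounded[of "d n"] m, where A = "real (Suc n)" and t = 0] m(1) by (simp del: of_nat_Suc)
    show "integrable lborel (\<lambda>z. 1 * (indicator {- \<epsilon> / 2<..} z * exp (- z :: real)))"
      using integrable_exp_tail by simp
  qed auto
  then have "\<forall>\<^sub>F n in sequentially. window (bump \<epsilon>) (cutoff (d n)) m (real (Suc n)) 0 < e"
    using e by (intro order_tendstoD) auto
  then obtain n where "window (bump \<epsilon>) (cutoff (d n)) m (real (Suc n)) 0 < e"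
    by (auto dest: eventually_happens)
  then show thesis using d[of n] by (intro that[of "real (Suc n)" "d n"]) (auto simp: m_def)
qed

definition "sojourn_time T p = occupation (indicator {0<..}) 0 T (\<lambda>s. w s p)"

lemma sojourn_time_meas [measurable]: "sojourn_time T \<in> borel_measurable (borel \<Otimes>\<^sub>M M)"
  unfolding sojourn_time_def by measurable

lemma sojourn_cover:
  assumes h: "0 < h" and L: "0 < sojourn_time T p"
  obtains k where "real k * h \<le> T" "k \<le> nat \<lfloor>T / h\<rfloor>" "\<exists>s\<in>{real k * h..<real k * h + h}. 0 < w s p"
proof -
  have "\<exists>s\<in>{0..T}. 0 < w s p"
  proof (rule ccontr)
    assume no: "\<not> ?thesis"
    have "sojourn_time T p = (LBINT s::real. 0)"
      unfolding sojourn_time_def occupation_def set_lebesgue_integral_def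
      by (rule Bochner_Integration.integral_cong) (use no in \<open>auto split: split_indicator\<close>)
    then show False using L by simp
  qed
  then obtain s where s: "0 \<le> s" "s \<le> T" "0 < w s p" by auto
  define k where "k = nat \<lfloor>s / h\<rfloor>"
  have k: "real k \<le> s / h" "s / h < real k + 1" using s h by (auto simp: k_def)
  have "real k * h \<le> s" "s < real k * h + h" using k h by (auto simp: field_simps)
  moreover have "k \<le> nat \<lfloor>T / h\<rfloor>"
    unfolding k_def using s h by (intro nat_mono floor_mono divide_right_mono) auto
  ultimately show thesis using s by (intro that[of k]) auto
qed

text \<open>
  Cover \<open>[0, T]\<close> by unit cells: in each of them either the path is above \<open>- 1\<close> at the left end point or
  the event of \<open>chaining_cell\<close> occurs.
\<close>

lemma sojourn_positive_bound:
  obtains C0 where "0 < C0" "\<And>T. 1 \<le> T \<Longrightarrow> emeasure mu {p\<in>space mu. 0 < sojourn_time T p} \<le> ennreal (C0 * T)"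
proof -
  obtain C where C: "0 < C" "\<And>d h. 0 \<le> d \<Longrightarrow> 0 < h \<Longrightarrow> h \<le> 1 \<Longrightarrow> \<exists>B\<in>sets mu.
    {p\<in>space mu. w d p \<le> - 1 \<and> (\<exists>s\<in>{d..<d + h}. 0 < w s p)} \<subseteq> B \<and> emeasure mu B \<le> ennreal (C * h\<^sup>2)"
    using chaining_cell[of 1] by auto
  have "\<forall>k::nat. \<exists>B. B \<in> sets mu \<and> {p\<in>space mu. w (real k) p \<le> - 1 \<and> (\<exists>s\<in>{real k..<real k + 1}. 0 < w s p)} \<subseteq> B \<and> emeasure mu B \<le> ennreal C"
  proof
    fix k :: nat
    have "\<exists>B\<in>sets mu. {p\<in>space mu. w (real k) p \<le> - 1 \<and> (\<exists>s\<in>{real k..<real k + 1}. 0 < w s p)} \<subseteq> B \<and> emeasure mu B \<le> ennreal (C * 1\<^sup>2)"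
      by (rule C(2)) auto
    then show "\<exists>B. B \<in> sets mu \<and> {p\<in>space mu. w (real k) p \<le> - 1 \<and> (\<exists>s\<in>{real k..<real k + 1}. 0 < w s p)} \<subseteq> B \<and> emeasure mu B \<le> ennreal C"
      unfolding Bex_def by (simp only: power_one mult_1_right)
  qed
  from choice[OF this] obtain B where "\<forall>k::nat. B k \<in> sets mu \<and>
      {p\<in>space mu. w (real k) p \<le> - 1 \<and> (\<exists>s\<in>{real k..<real k + 1}. 0 < w s p)} \<subseteq> B k \<and> emeasure mu (B k) \<le> ennreal C"
    by (rule exE)
  then have B: "\<And>k::nat. B k \<in> sets mu"
    "\<And>k. {p\<in>space mu. w (real k) p \<le> - 1 \<and> (\<exists>s\<in>{real k..<real k + 1}. 0 < w s p)} \<subseteq> B k"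
    "\<And>k. emeasure mu (B k) \<le> ennreal C" by simp_all
  note [measurable] = B(1)
  show thesis
  proof (rule that[of "2 * (exp 1 + C)"])
    show "0 < 2 * (exp 1 + C)" using C(1) by (simp add: add_pos_pos)
    fix T :: real assume T: "1 \<le> T"
    define N where "N = nat \<lfloor>T\<rfloor>"
    have "emeasure mu {p\<in>space mu. 0 < sojourn_time T p} \<le> emeasure mu (\<Union>k\<le>N. {p\<in>space mu. - 1 < w (real k) p} \<union> B k)"
    proof (rule emeasure_mono)
      show "{p\<in>space mu. 0 < sojourn_time T p} \<subseteq> (\<Union>k\<le>N. {p\<in>space mu. - 1 < w (real k) p} \<union> B k)"
      proof
        fix p assume p: "p \<in> {p\<in>space mu. 0 < sojourn_time T p}"
        then have "0 < sojourn_time T p" by simp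
        then obtain k where k: "k \<le> N" "\<exists>s\<in>{real k..<real k + 1}. 0 < w s p"
          using sojourn_cover[OF zero_less_one] unfolding N_def mult_1_right div_by_1 by metis
        then have "p \<in> {p\<in>space mu. - 1 < w (real k) p} \<union> B k"
          using p B(2)[of k] by (cases "- 1 < w (real k) p") auto
        then show "p \<in> (\<Union>k\<le>N. {p\<in>space mu. - 1 < w (real k) p} \<union> B k)" using k(1) by blast
      qed
    qed measurable
    also have "\<dots> \<le> (\<Sum>k\<le>N. emeasure mu ({p\<in>space mu. - 1 < w (real k) p} \<union> B k))"
      by (rule emeasure_subadditive_finite) auto
    also have "\<dots> \<le> (\<Sum>k\<le>N. ennreal (exp 1 + C))"
    proof (rule sum_mono)
      fix k
      have "emeasure mu ({p\<in>space mu. - 1 < w (real k) p} \<union> B k) \<le> emeasure mu {p\<in>space mu. - 1 < w (real k) p} + emeasure mu (B k)"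
        by (rule emeasure_subadditive) measurable
      also have "\<dots> \<le> ennreal (exp 1) + ennreal C"
        using B(3)[of k] by (intro add_mono) (simp_all only: emeasure_level_UNIV minus_minus order_refl)
      finally show "emeasure mu ({p\<in>space mu. - 1 < w (real k) p} \<union> B k) \<le> ennreal (exp 1 + C)"
        using C(1) by simp
    qed
    also have "\<dots> = ennreal (real (Suc N) * (exp 1 + C))"
      using C(1) by (simp add: ennreal_of_nat_eq_real_of_nat ennreal_mult' del: of_nat_Suc ennreal_plus)
    also have "\<dots> \<le> ennreal (2 * (exp 1 + C) * T)"
    proof (rule ennreal_leI)
      have "real (Suc N) \<le> 2 * T" using T unfolding N_def by linarith
      then have "real (Suc N) * (exp 1 + C) \<le> 2 * T * (exp 1 + C)"
        using C(1) by (intro mult_right_mono) (auto simp: add_nonneg_nonneg)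
      then show "real (Suc N) * (exp 1 + C) \<le> 2 * (exp 1 + C) * T" by (simp add: mult_ac)
    qed
    finally show "emeasure mu {p\<in>space mu. 0 < sojourn_time T p} \<le> ennreal (2 * (exp 1 + C) * T)" .
  qed
qed

end

text \<open>
  The second process has a power variogram and serves as the reference with which the first one is
  compared. A reference process is also its own reference.
\<close>

locale brown_resnick_pair = brown_resnick M Z \<kappa> C1 C2 c + R: brown_resnick N Z' \<kappa> D1 D2 c
  for M :: "'a measure" and Z and \<kappa> C1 C2 c :: real and N :: "'b measure" and Z' and D1 D2 :: real +
  assumes R_exact: "\<And>s t. 0 \<le> s \<Longrightarrow> 0 \<le> t \<Longrightarrow> R.V s t = c * \<bar>s - t\<bar> powr \<kappa>"
begin

text \<open>
  Both characteristic functions are the same continuous expression in the variogram.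
\<close>

lemma increments_converge:
  assumes lim: "filterlim T at_top sequentially" and T: "\<And>n. 0 \<le> T n"
  shows "fdd_convergence (\<lambda>n. Q (T n)) (\<lambda>n s \<omega>. W (T n + s) \<omega> - W (T n) \<omega>) (R.Q 0) (\<lambda>s \<omega>. R.W (0 + s) \<omega> - R.W 0 \<omega>)"
proof (rule fdd_convergence.intro)
  show "prob_space (Q (T n))" for n by (rule prob_space_Q)
  show "prob_space (R.Q 0)" by (rule R.prob_space_Q)
  show "case_prod (\<lambda>s \<omega>. W (T n + s) \<omega> - W (T n) \<omega>) \<in> borel_measurable (borel \<Otimes>\<^sub>M Q (T n))" for n
    by (subst measurable_cong_sets[OF sets_pair_measure_cong[OF refl sets_Q] refl]) (rule increment_pair_meas)
  show "case_prod (\<lambda>s \<omega>. R.W (0 + s) \<omega> - R.W 0 \<omega>) \<in> borel_measurable (borel \<Otimes>\<^sub>M R.Q 0)"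
    by (subst measurable_cong_sets[OF sets_pair_measure_cong[OF refl R.sets_Q] refl]) (rule R.increment_pair_meas)
next
  fix xs :: "(real \<times> real) list" assume xs: "\<forall>(a, s)\<in>set xs. 0 \<le> s"
  have V_lim: "(\<lambda>n. V (T n + s) (T n + t)) \<longlonglongrightarrow> R.V (0 + s) (0 + t)" if "0 \<le> s" "0 \<le> t" for s t
    using filterlim_compose[OF V_local[OF that] lim] R_exact that by simp
  have V_lim0: "(\<lambda>n. V (T n + s) (T n)) \<longlonglongrightarrow> R.V (0 + s) 0" if "0 \<le> s" for s
    using V_lim[of s 0] that by simp
  define \<Phi> where "\<Phi> U T = exp (complex_of_real (- (\<Sum>(a, s)\<leftarrow>xs. \<Sum>(b, u)\<leftarrow>xs. a * b * (U (T + s) T + U (T + u) T - U (T + s) (T + u))) / 2) -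
      \<i> * complex_of_real (\<Sum>(a, s)\<leftarrow>xs. a * U (T + s) T))" for U :: "real \<Rightarrow> real \<Rightarrow> real" and T
  have eq: "(\<integral>\<omega>. cis (\<Sum>(a, s)\<leftarrow>xs. a * (W (T n + s) \<omega> - W (T n) \<omega>)) \<partial>Q (T n)) = \<Phi> V (T n)" for n
    using tilted_increments_char[where xs = "map (\<lambda>(a, s). (a, T n + s)) xs" and t = "T n"]
    by (simp add: \<Phi>_def o_def case_prod_beta')
  have R_eq: "(\<integral>\<omega>. cis (\<Sum>(a, s)\<leftarrow>xs. a * (R.W (0 + s) \<omega> - R.W 0 \<omega>)) \<partial>R.Q 0) = \<Phi> R.V 0"
    using R.tilted_increments_char[where xs = "map (\<lambda>(a, s). (a, 0 + s)) xs" and t = 0]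
    by (simp add: \<Phi>_def o_def case_prod_beta')
  have "(\<lambda>n. \<Phi> V (T n)) \<longlonglongrightarrow> \<Phi> R.V 0"
    unfolding \<Phi>_def
    by (intro tendsto_intros tendsto_sum_list) (use xs in \<open>auto intro!: tendsto_intros tendsto_sum_list V_lim[unfolded add_0] V_lim0[unfolded add_0]\<close>)
  then show "(\<lambda>n. \<integral>\<omega>. cis (\<Sum>(a, s)\<leftarrow>xs. a * (W (T n + s) \<omega> - W (T n) \<omega>)) \<partial>Q (T n)) \<longlonglongrightarrow>
    (\<integral>\<omega>. cis (\<Sum>(a, s)\<leftarrow>xs. a * (R.W (0 + s) \<omega> - R.W 0 \<omega>)) \<partial>R.Q 0)"
    unfolding eq R_eq .
next
  fix s e :: real assume s: "0 \<le> s" and e: "0 < e"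
  define b where "b = max (C2 * s powr \<kappa>) (R.V s 0)"
  obtain R1 where R1: "\<And>s t. V s t \<le> b \<Longrightarrow> measure (Q t) {\<omega>\<in>space M. R1 < \<bar>W s \<omega> - W t \<omega>\<bar>} \<le> e"
    using increments_tight[OF e, of b] by blast
  obtain R2 where R2: "\<And>s t. R.V s t \<le> b \<Longrightarrow> measure (R.Q t) {\<omega>\<in>space N. R2 < \<bar>R.W s \<omega> - R.W t \<omega>\<bar>} \<le> e"
    using R.increments_tight[OF e, of b] by blast
  define R0 where "R0 = max R1 R2"
  show "\<exists>R. (\<forall>n. measure (Q (T n)) {\<omega> \<in> space (Q (T n)). R < \<bar>W (T n + s) \<omega> - W (T n) \<omega>\<bar>} \<le> e) \<and>
    measure (R.Q 0) {\<omega> \<in> space (R.Q 0). R < \<bar>R.W (0 + s) \<omega> - R.W 0 \<omega>\<bar>} \<le> e"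
  proof (intro exI[of _ R0] conjI allI)
    fix n
    interpret Qn: prob_space "Q (T n)" by (rule prob_space_Q)
    have "V (T n + s) (T n) \<le> b" using V_upper[of "T n + s" "T n"] T s by (simp add: b_def)
    have "Qn.prob {\<omega> \<in> space (Q (T n)). R0 < \<bar>W (T n + s) \<omega> - W (T n) \<omega>\<bar>} \<le> Qn.prob {\<omega> \<in> space M. R1 < \<bar>W (T n + s) \<omega> - W (T n) \<omega>\<bar>}"
      by (intro Qn.finite_measure_mono) (auto simp: R0_def)
    also have "\<dots> \<le> e" by (rule R1) fact
    finally show "Qn.prob {\<omega> \<in> space (Q (T n)). R0 < \<bar>W (T n + s) \<omega> - W (T n) \<omega>\<bar>} \<le> e" .
  next
    interpret Q0: prob_space "R.Q 0" by (rule R.prob_space_Q)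
    have "R.V s 0 \<le> b" by (simp add: b_def)
    have "Q0.prob {\<omega> \<in> space (R.Q 0). R0 < \<bar>R.W (0 + s) \<omega> - R.W 0 \<omega>\<bar>} \<le> Q0.prob {\<omega> \<in> space N. R2 < \<bar>R.W s \<omega> - R.W 0 \<omega>\<bar>}"
      by (intro Q0.finite_measure_mono) (auto simp: R0_def)
    also have "\<dots> \<le> e" by (rule R2) fact
    finally show "Q0.prob {\<omega> \<in> space (R.Q 0). R0 < \<bar>R.W (0 + s) \<omega> - R.W 0 \<omega>\<bar>} \<le> e" .
  qed
qed

theorem window_tendsto:
  assumes g: "continuous_on UNIV g" "\<And>u. 0 \<le> g u" "\<And>u. g u \<le> 1"
    and f: "continuous_on UNIV f" "\<And>u. 0 \<le> f u" "\<And>u. f u \<le> K"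
    and m: "m \<in> borel_measurable borel" "\<And>z. 0 \<le> m z" "\<And>z. m z \<le> indicator {b<..} z"
    and A: "0 \<le> A"
  shows "(window g f m A \<longlongrightarrow> R.window g f m A 0) at_top"
  unfolding window_def[abs_def] R.window_def
proof (rule integral_dominated_convergence_at_top[where w = "\<lambda>z. K * (indicator {b<..} z * exp (- z))"])
  show "AE z in lborel. ((\<lambda>t. m z * exp (- z) * window_at g f A t z) \<longlongrightarrow> m z * exp (- z) * R.window_at g f A 0 z) at_top"
  proof (intro AE_I2 tendsto_mult[OF tendsto_const])
    fix z :: real
    show "((\<lambda>t. window_at g f A t z) \<longlongrightarrow> R.window_at g f A 0 z) at_top"
    proof (rule tendsto_at_topI_sequentially)
      fix T :: "nat \<Rightarrow> real" assume T: "filterlim T at_top sequentially"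
      have "\<forall>\<^sub>F n in sequentially. 0 \<le> T n" using T by (simp add: filterlim_at_top)
      then have ev: "\<forall>\<^sub>F n in sequentially. max 0 (T n) = T n" by eventually_elim simp
      have T': "filterlim (\<lambda>n. max 0 (T n)) at_top sequentially"
        using filterlim_cong[OF refl refl ev] T by simp
      interpret C: fdd_convergence "\<lambda>n. Q (max 0 (T n))" "\<lambda>n s \<omega>. W (max 0 (T n) + s) \<omega> - W (max 0 (T n)) \<omega>"
          "R.Q 0" "\<lambda>s \<omega>. R.W (0 + s) \<omega> - R.W 0 \<omega>"
        using T' by (intro increments_converge) auto
      have "(\<lambda>n. window_at g f A (max 0 (T n)) z) \<longlonglongrightarrow> R.window_at g f A 0 z"
        unfolding window_at_def R.window_at_def
        by (rule C.occupation_tendsto) (use g f A in \<open>auto intro!: continuous_on_compose2[OF g(1)] continuous_intros\<close>)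
      then show "(\<lambda>n. window_at g f A (T n) z) \<longlonglongrightarrow> R.window_at g f A 0 z"
        by (rule Lim_transform_eventually) (use ev in \<open>eventually_elim, simp\<close>)
    qed
  qed
  show "\<forall>\<^sub>F t in at_top. AE z in lborel. norm (m z * exp (- z) * window_at g f A t z) \<le> K * (indicator {b<..} z * exp (- z))"
    using window_bound[OF g f m] by (intro always_eventually allI AE_I2)
  show "(\<lambda>z. m z * exp (- z) * window_at g f A t z) \<in> borel_measurable lborel" for t
    using window_at_meas[OF g f m] m(1) by simp
  show "(\<lambda>z. m z * exp (- z) * R.window_at g f A 0 z) \<in> borel_measurable lborel"
    using R.window_at_meas[OF g f m] m(1) by simp
  show "integrable lborel (\<lambda>z. K * (indicator {b<..} z * exp (- z :: real)))"
    using integrable_exp_tail by simp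
qed

text \<open>
  If the path is positive in a cell of length \<open>h\<close>, then it is above \<open>- \<epsilon> / 2\<close> at the left end of the cell, up to an event of
  measure \<open>O (h\<^sup>2)\<close>. From there it spends more than \<open>\<delta>\<close> in the strip \<open>(- \<epsilon>, 0)\<close> within the next \<open>A\<close> units of
  time, up to an event whose measure converges, for late cells, to the corresponding one of the reference
  process, which is small by \<open>strip_window_small\<close>. The choice of \<open>h\<close> precedes that of \<open>A\<close> and \<open>\<delta>\<close>.
\<close>

theorem narrow_excursions_rare:
  assumes \<epsilon>: "0 < \<epsilon>" and e: "0 < e"
  obtains \<delta>0 where "0 < \<delta>0" "\<And>\<delta>. 0 < \<delta> \<Longrightarrow> \<delta> \<le> \<delta>0 \<Longrightarrow> \<forall>\<^sub>F T in at_top.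
    emeasure mu {p\<in>space mu. 0 < sojourn_time T p \<and> occupation (bump \<epsilon>) 0 T (\<lambda>s. w s p) < \<delta>} \<le> ennreal (e * T)"
proof -
  define \<epsilon>' where "\<epsilon>' = \<epsilon> / 2"
  have \<epsilon>': "0 < \<epsilon>'" using \<epsilon> by (simp add: \<epsilon>'_def)
  obtain C where C: "0 < C" "\<And>d h. 0 \<le> d \<Longrightarrow> 0 < h \<Longrightarrow> h \<le> 1 \<Longrightarrow> \<exists>B\<in>sets mu.
    {p\<in>space mu. w d p \<le> - \<epsilon>' \<and> (\<exists>s\<in>{d..<d + h}. 0 < w s p)} \<subseteq> B \<and> emeasure mu B \<le> ennreal (C * h\<^sup>2)"
    using chaining_cell[OF \<epsilon>'] by auto
  define h where "h = min 1 (e / (4 * C))"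
  have h: "0 < h" "h \<le> 1" "C * h \<le> e / 4" using C(1) e by (auto simp: h_def min_def field_simps)
  have "\<forall>k::nat. \<exists>B. B \<in> sets mu \<and> {p\<in>space mu. w (real k * h) p \<le> - \<epsilon>' \<and> (\<exists>s\<in>{real k * h..<real k * h + h}. 0 < w s p)} \<subseteq> B
      \<and> emeasure mu B \<le> ennreal (C * h\<^sup>2)"
  proof
    fix k :: nat
    have "\<exists>B\<in>sets mu. {p\<in>space mu. w (real k * h) p \<le> - \<epsilon>' \<and> (\<exists>s\<in>{real k * h..<real k * h + h}. 0 < w s p)} \<subseteq> B \<and> emeasure mu B \<le> ennreal (C * h\<^sup>2)"
      by (rule C(2)) (use h in auto)
    then show "\<exists>B. B \<in> sets mu \<and> {p\<in>space mu. w (real k * h) p \<le> - \<epsilon>' \<and> (\<exists>s\<in>{real k * h..<real k * h + h}. 0 < w s p)} \<subseteq> B \<and> emeasure mu B \<le> ennreal (C * h\<^sup>2)"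
      unfolding Bex_def .
  qed
  from choice[OF this] obtain B where "\<forall>k::nat. B k \<in> sets mu \<and>
      {p\<in>space mu. w (real k * h) p \<le> - \<epsilon>' \<and> (\<exists>s\<in>{real k * h..<real k * h + h}. 0 < w s p)} \<subseteq> B k \<and> emeasure mu (B k) \<le> ennreal (C * h\<^sup>2)"
    by (rule exE)
  then have B: "\<And>k::nat. B k \<in> sets mu"
    "\<And>k. {p\<in>space mu. w (real k * h) p \<le> - \<epsilon>' \<and> (\<exists>s\<in>{real k * h..<real k * h + h}. 0 < w s p)} \<subseteq> B k"
    "\<And>k. emeasure mu (B k) \<le> ennreal (C * h\<^sup>2)" by simp_all
  note [measurable] = B(1)
  define m where "m = (indicator {- \<epsilon>'<..} :: real \<Rightarrow> real)"
  have m: "m \<in> borel_measurable borel" "\<And>z. 0 \<le> m z" "\<And>z. m z \<le> indicator {- \<epsilon>'<..} z"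
    by (auto simp: m_def)
  have eh: "0 < e * h / 8" using e h by simp
  obtain A \<delta>0 where A: "0 < A" and \<delta>0: "0 < \<delta>0" and RW: "R.window (bump \<epsilon>) (cutoff \<delta>0) m A 0 \<le> e * h / 8"
    using R.strip_window_small[OF \<epsilon> eh] unfolding m_def \<epsilon>'_def by auto
  have "(window (bump \<epsilon>) (cutoff \<delta>0) m A \<longlongrightarrow> R.window (bump \<epsilon>) (cutoff \<delta>0) m A 0) at_top"
    using A by (intro window_tendsto[OF bump_continuous_bounded cutoff_continuous_bounded m]) auto
  then have "\<forall>\<^sub>F t in at_top. window (bump \<epsilon>) (cutoff \<delta>0) m A t < e * h / 4"
    using RW eh by (intro order_tendstoD) auto
  then obtain t1 where t1: "\<And>t. t1 \<le> t \<Longrightarrow> window (bump \<epsilon>) (cutoff \<delta>0) m A t < e * h / 4"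
    by (auto simp: eventually_at_top_linorder)
  \<comment> \<open>The first \<open>K1\<close> cells lie too early for the comparison, the last \<open>K2\<close> leave no room for a window of
    length \<open>A\<close>. Their number does not depend on \<open>T\<close>.\<close>
  define K1 where "K1 = nat \<lceil>t1 / h\<rceil>"
  define K2 where "K2 = nat \<lceil>A / h\<rceil>"
  define D where "D = real (K1 + K2) * exp \<epsilon>'"
  show thesis
  proof (rule that[OF \<delta>0])
    fix \<delta> :: real assume \<delta>: "0 < \<delta>" "\<delta> \<le> \<delta>0"
    have main: "emeasure mu {p\<in>space mu. 0 < sojourn_time T p \<and> occupation (bump \<epsilon>) 0 T (\<lambda>s. w s p) < \<delta>} \<le>
        ennreal ((T + 1) * (e / 2) + D)" if T: "0 \<le> T" for T
    proof -
      define n where "n = nat \<lfloor>T / h\<rfloor>"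
      have n: "real n \<le> T / h" unfolding n_def using T h by simp
      define S where "S k = {p\<in>space mu. - \<epsilon>' < w (real k * h) p \<and> occupation (bump \<epsilon>) 0 T (\<lambda>s. w s p) < \<delta>}" for k :: nat
      have Sm[measurable]: "S k \<in> sets mu" for k unfolding S_def by measurable
      define X where "X = {..<K1} \<union> {k. n < k + K2}"
      have S_any: "emeasure mu (S k) \<le> ennreal (exp \<epsilon>')" for k
      proof -
        have "emeasure mu (S k) \<le> emeasure mu {p\<in>space mu. - \<epsilon>' < w (real k * h) p}"
          unfolding S_def by (intro emeasure_mono) auto
        then show ?thesis by (simp only: emeasure_level_UNIV minus_minus)
      qed
      have S_good: "emeasure mu (S k) \<le> ennreal (e * h / 4)" if k: "k \<notin> X" for k
      proof -
        define d where "d = real k * h"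
        have d0: "0 \<le> d" using h by (simp add: d_def)
        have "t1 / h \<le> real K1" unfolding K1_def by (rule real_nat_ceiling_ge)
        also have "\<dots> \<le> real k" using k by (simp add: X_def)
        finally have d1: "t1 \<le> d" using h by (simp add: d_def field_simps)
        have "A / h \<le> real K2" unfolding K2_def by (rule real_nat_ceiling_ge)
        moreover have "real k + real K2 \<le> real n" using k by (simp add: X_def flip: of_nat_add)
        ultimately have "real k + A / h \<le> T / h" using n by linarith
        then have "(real k + A / h) * h \<le> T / h * h" using h by (intro mult_right_mono) auto
        then have dA: "d + A \<le> T" using h by (simp add: d_def distrib_right)
        have "emeasure mu (S k) = (\<integral>\<^sup>+p. indicator (S k) p \<partial>mu)" by simp
        also have "\<dots> \<le> (\<integral>\<^sup>+p. ennreal (m (w d p) * cutoff \<delta>0 (occupation (bump \<epsilon>) d (d + A) (\<lambda>s. w s p))) \<partial>mu)"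
        proof (rule nn_integral_mono)
          fix p assume p: "p \<in> space mu"
          show "indicator (S k) p \<le> ennreal (m (w d p) * cutoff \<delta>0 (occupation (bump \<epsilon>) d (d + A) (\<lambda>s. w s p)))"
          proof (cases "p \<in> S k")
            case True
            have "occupation (bump \<epsilon>) d (d + A) (\<lambda>s. w s p) \<le> occupation (bump \<epsilon>) 0 T (\<lambda>s. w s p)"
              using bump_continuous_bounded d0 dA by (intro occupation_mono[OF w_path_meas[OF p]]) auto
            also have "\<dots> \<le> \<delta>0" using True \<delta> by (simp add: S_def)
            finally have "cutoff \<delta>0 (occupation (bump \<epsilon>) d (d + A) (\<lambda>s. w s p)) = 1"
              using \<delta>0 by (intro cutoff_eq_1) auto
            then show ?thesis using True by (simp add: S_def m_def d_def)
          qed simp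
        qed
        also have "\<dots> = ennreal (window (bump \<epsilon>) (cutoff \<delta>0) m A d)"
          by (rule nn_integral_window[OF bump_continuous_bounded cutoff_continuous_bounded m])
        also have "\<dots> \<le> ennreal (e * h / 4)" using t1[OF d1] by (intro ennreal_leI) simp
        finally show ?thesis .
      qed
      have S_bound: "emeasure mu (S k) \<le> ennreal (e * h / 4 + indicator X k * exp \<epsilon>')" for k
      proof (cases "k \<in> X")
        case True
        have "emeasure mu (S k) \<le> ennreal (exp \<epsilon>')" by (rule S_any)
        also have "\<dots> \<le> ennreal (e * h / 4 + indicator X k * exp \<epsilon>')" using True e h by (intro ennreal_leI) simp
        finally show ?thesis .
      qed (use S_good in simp)
      have "emeasure mu {p\<in>space mu. 0 < sojourn_time T p \<and> occupation (bump \<epsilon>) 0 T (\<lambda>s. w s p) < \<delta>} \<le> emeasure mu (\<Union>k\<le>n. S k \<union> B k)"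
      proof (rule emeasure_mono)
        show "{p\<in>space mu. 0 < sojourn_time T p \<and> occupation (bump \<epsilon>) 0 T (\<lambda>s. w s p) < \<delta>} \<subseteq> (\<Union>k\<le>n. S k \<union> B k)"
        proof
          fix p assume p: "p \<in> {p\<in>space mu. 0 < sojourn_time T p \<and> occupation (bump \<epsilon>) 0 T (\<lambda>s. w s p) < \<delta>}"
          then have "0 < sojourn_time T p" by simp
          then obtain k where k: "k \<le> n" "\<exists>s\<in>{real k * h..<real k * h + h}. 0 < w s p"
            using sojourn_cover[OF h(1)] unfolding n_def by metis
          then have "p \<in> S k \<union> B k"
            using p B(2)[of k] by (cases "- \<epsilon>' < w (real k * h) p") (auto simp: S_def)
          then show "p \<in> (\<Union>k\<le>n. S k \<union> B k)" using k(1) by blast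
        qed
      qed measurable
      also have "\<dots> \<le> (\<Sum>k\<le>n. emeasure mu (S k \<union> B k))"
        by (rule emeasure_subadditive_finite) auto
      also have "\<dots> \<le> (\<Sum>k\<le>n. ennreal (e * h / 4 + indicator X k * exp \<epsilon>' + C * h\<^sup>2))"
      proof (rule sum_mono)
        fix k
        have "emeasure mu (S k \<union> B k) \<le> emeasure mu (S k) + emeasure mu (B k)"
          by (rule emeasure_subadditive) measurable
        also have "\<dots> \<le> ennreal (e * h / 4 + indicator X k * exp \<epsilon>') + ennreal (C * h\<^sup>2)"
          by (intro add_mono S_bound B(3))
        also have "\<dots> = ennreal (e * h / 4 + indicator X k * exp \<epsilon>' + C * h\<^sup>2)"
          using e h C(1) by (subst ennreal_plus[symmetric]) auto
        finally show "emeasure mu (S k \<union> B k) \<le> ennreal (e * h / 4 + indicator X k * exp \<epsilon>' + C * h\<^sup>2)" .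
      qed
      also have "\<dots> = ennreal (\<Sum>k\<le>n. e * h / 4 + indicator X k * exp \<epsilon>' + C * h\<^sup>2)"
        using e h C(1) by (subst sum_ennreal) auto
      also have "\<dots> \<le> ennreal ((T + 1) * (e / 2) + D)"
      proof (rule ennreal_leI)
        have "(\<Sum>k\<le>n. indicator X k :: real) \<le> real (K1 + K2)"
        proof -
          have "(\<Sum>k\<le>n. indicator X k :: real) = real (card ({..n} \<inter> X))"
            by (simp add: indicator_def sum.If_cases Int_def)
          moreover have "card ({..n} \<inter> X) \<le> card ({..<K1} \<union> {Suc n - K2..n})"
            by (intro card_mono) (auto simp: X_def)
          moreover have "\<dots> \<le> card {..<K1} + card {Suc n - K2..n}" by (rule card_Un_le)
          moreover have "\<dots> \<le> K1 + K2" by simp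
          ultimately show ?thesis by linarith
        qed
        then have "(\<Sum>k\<le>n. indicator X k * exp \<epsilon>') \<le> D"
          unfolding D_def sum_distrib_right[symmetric] by (intro mult_right_mono) auto
        moreover have "real (Suc n) * (e * h / 4 + C * h\<^sup>2) \<le> (T + 1) * (e / 2)"
        proof -
          have "real (Suc n) * h \<le> T + 1"
          proof -
            have "real n * h \<le> T" using n h by (simp add: field_simps)
            then show ?thesis using h by (simp add: distrib_right)
          qed
          moreover have "e / 4 + C * h \<le> e / 2" using h by simp
          ultimately have "(real (Suc n) * h) * (e / 4 + C * h) \<le> (T + 1) * (e / 2)"
            using T e h C(1) by (intro mult_mono) auto
          then show ?thesis by (simp add: power2_eq_square algebra_simps)
        qed
        moreover have "(\<Sum>k\<le>n. e * h / 4 + indicator X k * exp \<epsilon>' + C * h\<^sup>2) =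
          real (Suc n) * (e * h / 4 + C * h\<^sup>2) + (\<Sum>k\<le>n. indicator X k * exp \<epsilon>')"
          by (simp add: sum.distrib algebra_simps)
        ultimately show "(\<Sum>k\<le>n. e * h / 4 + indicator X k * exp \<epsilon>' + C * h\<^sup>2) \<le> (T + 1) * (e / 2) + D" by linarith
      qed
      finally show ?thesis .
    qed
    show "\<forall>\<^sub>F T in at_top. emeasure mu {p\<in>space mu. 0 < sojourn_time T p \<and> occupation (bump \<epsilon>) 0 T (\<lambda>s. w s p) < \<delta>} \<le> ennreal (e * T)"
      using eventually_ge_at_top[of "1 + 2 * D / e"] eventually_ge_at_top[of 0]
    proof eventually_elim
      case (elim T)
      have "(1 + 2 * D / e) * (e / 2) \<le> T * (e / 2)" using elim e by (intro mult_right_mono) auto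
      moreover have "(1 + 2 * D / e) * (e / 2) = e / 2 + D" using e by (simp add: distrib_right)
      ultimately have "(T + 1) * (e / 2) + D \<le> e * T" by (simp add: field_simps)
      then show ?case using main[OF elim(2)] by (meson ennreal_leI order_trans)
    qed
  qed
qed

end

section \<open>Smoothed exceedances as averages of local quantities\<close>

text \<open>
  A continuously differentiable step from 0 at 0 to 1 at 1; squared positive parts make \<open>tent\<close> its
  derivative without a distinction of cases.
\<close>

definition smooth_step :: "real \<Rightarrow> real" where
  "smooth_step u = 2 * (max 0 u)\<^sup>2 - 4 * (max 0 (u - 1/2))\<^sup>2 + 2 * (max 0 (u - 1))\<^sup>2"

text \<open>
  The tent on \<open>[0, 1]\<close> with height 2.
\<close>

definition tent :: "real \<Rightarrow> real" where
  "tent u = 4 * max 0 u - 8 * max 0 (u - 1/2) + 4 * max 0 (u - 1)"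

lemma DERIV_pos_part_square: "((\<lambda>u::real. (max 0 u)\<^sup>2) has_real_derivative 2 * max 0 u) (at u)"
proof (cases u "0 :: real" rule: linorder_cases)
  case less
  have "((\<lambda>u::real. 0) has_real_derivative 0) (at u)" by simp
  then have "((\<lambda>u::real. (max 0 u)\<^sup>2) has_real_derivative 0) (at u)"
    by (rule has_field_derivative_transform_within_open[where S = "{..<0}"]) (use less in auto)
  then show ?thesis using less by simp
next
  case greater
  have "((\<lambda>u::real. u\<^sup>2) has_real_derivative 2 * u) (at u)" by (auto intro!: derivative_eq_intros)
  then have "((\<lambda>u::real. (max 0 u)\<^sup>2) has_real_derivative 2 * u) (at u)"
    by (rule has_field_derivative_transform_within_open[where S = "{0<..}"]) (use greater in auto)
  then show ?thesis using greater by simp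
next
  case equal
  have lim: "((\<lambda>y::real. max 0 y) \<longlongrightarrow> max 0 0) (at 0)" by (intro tendsto_intros)
  have ev: "\<forall>\<^sub>F y in at (0::real). max 0 y = ((max 0 y)\<^sup>2 - (max 0 0)\<^sup>2) / (y - 0)"
    unfolding eventually_at by (rule exI[of _ 1]) (auto simp: power2_eq_square max_def)
  have "((\<lambda>y::real. ((max 0 y)\<^sup>2 - (max 0 0)\<^sup>2) / (y - 0)) \<longlongrightarrow> 0) (at 0)"
    using Lim_transform_eventually[OF lim ev] by simp
  then show ?thesis using equal by (simp add: has_field_derivative_iff)
qed

lemma DERIV_smooth_step: "(smooth_step has_real_derivative tent u) (at u)"
proof -
  have shift: "((\<lambda>u::real. (max 0 (u - a))\<^sup>2) has_real_derivative 2 * max 0 (u - a)) (at u)" for a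
  proof -
    have "((\<lambda>u. u - a) has_real_derivative 1) (at u)" by (auto intro!: derivative_eq_intros)
    from DERIV_chain2[where f = "\<lambda>u. (max 0 u)\<^sup>2" and g = "\<lambda>u. u - a", OF DERIV_pos_part_square this]
    show ?thesis by simp
  qed
  have "((\<lambda>u. 2 * (max 0 (u - 0))\<^sup>2 - 4 * (max 0 (u - 1/2))\<^sup>2 + 2 * (max 0 (u - 1))\<^sup>2) has_real_derivative
      2 * (2 * max 0 (u - 0)) - 4 * (2 * max 0 (u - 1/2)) + 2 * (2 * max 0 (u - 1))) (at u)"
    by (intro DERIV_add DERIV_diff DERIV_cmult shift)
  then show ?thesis by (simp add: smooth_step_def[abs_def] tent_def)
qed

lemma tent_bounds: "0 \<le> tent u" "tent u \<le> 2" and tent_lipschitz: "\<bar>tent u - tent v\<bar> \<le> 16 * \<bar>u - v\<bar>"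
  unfolding tent_def by (auto simp: max_def abs_if)

lemma smooth_step_eq_0: "u \<le> 0 \<Longrightarrow> smooth_step u = 0"
  by (simp add: smooth_step_def)

lemma smooth_step_eq_1: "1 \<le> u \<Longrightarrow> smooth_step u = 1"
  by (simp add: smooth_step_def power2_eq_square field_simps)

lemma smooth_step_bounds: "0 \<le> smooth_step u" "smooth_step u \<le> 1"
proof -
  have mono: "a \<le> b \<Longrightarrow> smooth_step a \<le> smooth_step b" for a b
    by (rule DERIV_nonneg_imp_nondecreasing) (auto intro!: exI DERIV_smooth_step tent_bounds)
  show "0 \<le> smooth_step u" using mono[of "min 0 u" u] smooth_step_eq_0[of "min 0 u"] by simp
  show "smooth_step u \<le> 1" using mono[of u "max 1 u"] smooth_step_eq_1[of "max 1 u"] by simp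
qed

definition threshold :: "real \<Rightarrow> real \<Rightarrow> real \<Rightarrow> real" where
  "threshold x \<delta> k = smooth_step ((k - x) / \<delta>)"

definition threshold_slope :: "real \<Rightarrow> real \<Rightarrow> real \<Rightarrow> real" where
  "threshold_slope x \<delta> k = tent ((k - x) / \<delta>) / \<delta>"

context
  fixes x \<delta> :: real assumes x: "0 \<le> x" and \<delta>: "0 < \<delta>"
begin

lemma DERIV_threshold: "(threshold x \<delta> has_real_derivative threshold_slope x \<delta> k) (at k)"
proof -
  have "((\<lambda>k. smooth_step ((k - x) / \<delta>)) has_real_derivative tent ((k - x) / \<delta>) * (1 / \<delta>)) (at k)"
    using \<delta> by (intro DERIV_chain2[OF DERIV_smooth_step]) (auto intro!: derivative_eq_intros)
  then show ?thesis by (simp add: threshold_def[abs_def] threshold_slope_def)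
qed

lemma threshold_bounds: "0 \<le> threshold x \<delta> k" "threshold x \<delta> k \<le> 1"
  by (auto simp: threshold_def smooth_step_bounds)

lemma threshold_eq_0: "k \<le> x \<Longrightarrow> threshold x \<delta> k = 0"
  using \<delta> by (auto simp: threshold_def divide_simps intro!: smooth_step_eq_0)

lemma threshold_eq_1: "x + \<delta> \<le> k \<Longrightarrow> threshold x \<delta> k = 1"
  using \<delta> by (auto simp: threshold_def divide_simps intro!: smooth_step_eq_1)

lemma threshold_slope_lipschitz: "\<bar>threshold_slope x \<delta> k - threshold_slope x \<delta> k'\<bar> \<le> 16 / \<delta>\<^sup>2 * \<bar>k - k'\<bar>"
proof -
  have "\<bar>threshold_slope x \<delta> k - threshold_slope x \<delta> k'\<bar> = \<bar>tent ((k - x) / \<delta>) - tent ((k' - x) / \<delta>)\<bar> / \<delta>"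
    using \<delta> by (simp add: threshold_slope_def flip: diff_divide_distrib)
  also have "\<dots> \<le> (16 * \<bar>(k - x) / \<delta> - (k' - x) / \<delta>\<bar>) / \<delta>"
    using \<delta> tent_lipschitz by (intro divide_right_mono) auto
  also have "(k - x) / \<delta> - (k' - x) / \<delta> = (k - k') / \<delta>" by (simp flip: diff_divide_distrib)
  also have "16 * \<bar>(k - k') / \<delta>\<bar> / \<delta> = 16 / \<delta>\<^sup>2 * \<bar>k - k'\<bar>"
    using \<delta> by (simp add: abs_divide power2_eq_square)
  finally show ?thesis .
qed

lemma threshold_slope_continuous_bounded: "continuous_on UNIV (threshold_slope x \<delta>)" "0 \<le> threshold_slope x \<delta> k" "threshold_slope x \<delta> k \<le> 2 / \<delta>"
proof -
  show "continuous_on UNIV (threshold_slope x \<delta>)"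
    unfolding threshold_slope_def tent_def using \<delta> by (auto intro!: continuous_intros)
  show "0 \<le> threshold_slope x \<delta> k" "threshold_slope x \<delta> k \<le> 2 / \<delta>"
    using \<delta> tent_bounds by (auto simp: threshold_slope_def divide_simps)
qed

end

context gaussian_paths begin

lemma occupation_start_meas:
  assumes [measurable]: "g \<in> borel_measurable borel"
  shows "(\<lambda>x. occupation g (fst x) T (\<lambda>s. w s (snd x))) \<in> borel_measurable (borel \<Otimes>\<^sub>M (borel \<Otimes>\<^sub>M M))"
proof -
  have [measurable]: "(\<lambda>y. w (snd y) (snd (fst y))) \<in> borel_measurable ((borel \<Otimes>\<^sub>M (borel \<Otimes>\<^sub>M M)) \<Otimes>\<^sub>M borel)"
  proof -
    have "(\<lambda>y. (snd y, snd (fst y))) \<in> ((borel \<Otimes>\<^sub>M (borel \<Otimes>\<^sub>M M)) \<Otimes>\<^sub>M borel) \<rightarrow>\<^sub>M (borel \<Otimes>\<^sub>M (borel \<Otimes>\<^sub>M M))" by measurable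
    from measurable_compose[OF this w_pair_meas] show ?thesis by simp
  qed
  have eq: "occupation g (fst x) T (\<lambda>s. w s (snd x)) = (\<integral>s. (if fst x \<le> s \<and> s \<le> T then g (w s (snd x)) else 0) \<partial>lborel)" for x
    unfolding occupation_def set_lebesgue_integral_def by (intro Bochner_Integration.integral_cong) auto
  have [measurable]: "(\<lambda>y. if fst (fst y) \<le> snd y \<and> snd y \<le> T then g (w (snd y) (snd (fst y))) else 0)
     \<in> borel_measurable ((borel \<Otimes>\<^sub>M (borel \<Otimes>\<^sub>M M)) \<Otimes>\<^sub>M borel)"
    by measurable
  show ?thesis
    unfolding eq by (rule lborel.borel_measurable_lebesgue_integral) (simp add: case_prod_beta', measurable)
qed

text \<open>
  The fundamental theorem of calculus for \<open>t \<mapsto> \<psi> (occupation g t T w)\<close>. It trades a functional of the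
  whole interval for functionals of the path after each time \<open>t\<close>, which the local limit controls.
\<close>

lemma threshold_occupation:
  assumes p: "p \<in> space mu" and T: "0 \<le> T" and g: "continuous_on UNIV g" "\<And>u. 0 \<le> g u" "\<And>u. g u \<le> 1"
    and \<psi>: "\<And>k. (\<psi> has_real_derivative \<rho> k) (at k)" "\<psi> 0 = 0" and \<rho>: "continuous_on UNIV \<rho>" "\<And>k. 0 \<le> \<rho> k"
  shows "ennreal (\<psi> (occupation g 0 T (\<lambda>s. w s p))) =
    (\<integral>\<^sup>+t. ennreal (g (w t p) * \<rho> (occupation g t T (\<lambda>s. w s p))) * indicator {0..T} t \<partial>lborel)"
proof -
  have gw: "continuous_on UNIV (\<lambda>s. g (w s p))"
    by (intro continuous_on_compose2[OF g(1) w_cont[OF p]]) auto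
  have gm: "g \<in> borel_measurable borel" using g(1) by (rule borel_measurable_continuous_onI)
  note pm = w_path_meas[OF p]
  define occ where "occ t = occupation g 0 t (\<lambda>s. w s p)" for t
  have occ_HK: "occ t = integral {0..t} (\<lambda>s. g (w s p))" for t
    unfolding occ_def occupation_def
    by (rule set_borel_integral_eq_integral(2)[OF occupation_set_integrable[OF pm gm g(2,3)]])
  have D: "(occ has_real_derivative g (w t p)) (at t within {0..T})" if "t \<in> {0..T}" for t
    unfolding occ_HK[abs_def] using that gw
    by (intro integral_has_real_derivative) (auto intro: continuous_on_subset)
  have split: "occupation g t T (\<lambda>s. w s p) = occ T - occ t" if "t \<in> {0..T}" for t
    using occupation_split[OF pm gm g(2,3), of 0 t T] that by (simp add: occ_def)
  have occ_cont: "continuous_on {0..T} occ"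
    by (rule DERIV_continuous_on[OF D])
  have bochner: "has_bochner_integral lborel (\<lambda>t. indicator {0..T} t *\<^sub>R (g (w t p) * \<rho> (occ T - occ t)))
     ((- \<psi> (occ T - occ T)) - (- \<psi> (occ T - occ 0)))"
  proof (rule has_bochner_integral_FTC_Icc[OF T])
    fix t assume t: "0 \<le> t" "t \<le> T"
    have "((\<lambda>t. occ T - occ t) has_real_derivative - g (w t p)) (at t within {0..T})"
      using D[of t] t by (auto intro!: derivative_eq_intros)
    then have "((\<lambda>t. - \<psi> (occ T - occ t)) has_real_derivative - (\<rho> (occ T - occ t) * - g (w t p))) (at t within {0..T})"
      by (intro DERIV_minus DERIV_chain2[OF \<psi>(1)])
    then show "((\<lambda>t. - \<psi> (occ T - occ t)) has_vector_derivative g (w t p) * \<rho> (occ T - occ t)) (at t within {0..T})"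
      by (simp add: has_real_derivative_iff_has_vector_derivative mult.commute)
  next
    show "continuous_on {0..T} (\<lambda>t. g (w t p) * \<rho> (occ T - occ t))"
      using gw occ_cont by (intro continuous_intros continuous_on_compose2[OF \<rho>(1)]) (auto intro: continuous_on_subset)
  qed
  have "occ 0 = 0" by (simp add: occ_HK)
  then have "has_bochner_integral lborel (\<lambda>t. indicator {0..T} t *\<^sub>R (g (w t p) * \<rho> (occ T - occ t))) (\<psi> (occ T))"
    using bochner \<psi>(2) by simp
  then have "(\<integral>\<^sup>+t. ennreal (indicator {0..T} t *\<^sub>R (g (w t p) * \<rho> (occ T - occ t))) \<partial>lborel) = ennreal (\<psi> (occ T))"
    using g \<rho> by (subst nn_integral_eq_integral) (auto simp: has_bochner_integral_iff)
  also have "(\<integral>\<^sup>+t. ennreal (indicator {0..T} t *\<^sub>R (g (w t p) * \<rho> (occ T - occ t))) \<partial>lborel) =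
    (\<integral>\<^sup>+t. ennreal (g (w t p) * \<rho> (occupation g t T (\<lambda>s. w s p))) * indicator {0..T} t \<partial>lborel)"
    by (intro nn_integral_cong) (auto simp: split split: split_indicator)
  finally show ?thesis by (simp add: occ_def)
qed

lemma nn_integral_threshold:
  assumes T: "0 \<le> T" and g: "continuous_on UNIV g" "\<And>u. 0 \<le> g u" "\<And>u. g u \<le> 1"
    and \<psi>: "\<And>k. (\<psi> has_real_derivative \<rho> k) (at k)" "\<psi> 0 = 0" and \<rho>: "continuous_on UNIV \<rho>" "\<And>k. 0 \<le> \<rho> k"
  shows "(\<integral>\<^sup>+p. ennreal (\<psi> (occupation g 0 T (\<lambda>s. w s p))) \<partial>mu) =
    (\<integral>\<^sup>+t. (\<integral>\<^sup>+p. ennreal (g (w t p) * \<rho> (occupation g t T (\<lambda>s. w s p))) \<partial>mu) * indicator {0..T} t \<partial>lborel)"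
proof -
  interpret mu: sigma_finite_measure mu by (rule sigma_finite_mu)
  interpret P: pair_sigma_finite lborel mu ..
  have gm[measurable]: "g \<in> borel_measurable borel" using g(1) by (rule borel_measurable_continuous_onI)
  have [measurable]: "\<rho> \<in> borel_measurable borel" using \<rho>(1) by (rule borel_measurable_continuous_onI)
  note [measurable] = occupation_start_meas[OF gm]
  have [measurable]: "(\<lambda>x. w (fst x) (snd x)) \<in> borel_measurable (borel \<Otimes>\<^sub>M (borel \<Otimes>\<^sub>M M))"
    using w_pair_meas by (simp add: case_prod_beta')
  have m: "(\<lambda>(t, p). ennreal (g (w t p) * \<rho> (occupation g t T (\<lambda>s. w s p))) * indicator {0..T} t) \<in> borel_measurable (lborel \<Otimes>\<^sub>M mu)"
    by (subst measurable_cong_sets[OF sets_pair_measure_cong[OF sets_lborel sets_mu] refl])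
       (simp add: case_prod_beta', measurable)
  have "(\<integral>\<^sup>+p. ennreal (\<psi> (occupation g 0 T (\<lambda>s. w s p))) \<partial>mu) =
    (\<integral>\<^sup>+p. \<integral>\<^sup>+t. ennreal (g (w t p) * \<rho> (occupation g t T (\<lambda>s. w s p))) * indicator {0..T} t \<partial>lborel \<partial>mu)"
    by (intro nn_integral_cong threshold_occupation[OF _ T g \<psi> \<rho>])
  also have "\<dots> = (\<integral>\<^sup>+t. \<integral>\<^sup>+p. ennreal (g (w t p) * \<rho> (occupation g t T (\<lambda>s. w s p))) * indicator {0..T} t \<partial>mu \<partial>lborel)"
    by (rule P.Fubini'[OF m])
  also have "\<dots> = (\<integral>\<^sup>+t. (\<integral>\<^sup>+p. ennreal (g (w t p) * \<rho> (occupation g t T (\<lambda>s. w s p))) \<partial>mu) * indicator {0..T} t \<partial>lborel)"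
    by (intro nn_integral_cong nn_integral_multc) measurable
  finally show ?thesis .
qed

lemma nn_integral_two_point:
  assumes g: "g \<in> borel_measurable borel" "\<And>u. 0 \<le> g u" "\<And>u. g u \<le> indicator {0<..} u"
  shows "(\<integral>\<^sup>+p. ennreal (g (w t p) * occupation g a b (\<lambda>s. w s p)) \<partial>mu) \<le>
    (\<integral>\<^sup>+s. ennreal (2 * exp (- V s t / 4)) * indicator {a..b} s \<partial>lborel)"
proof -
  interpret mu: sigma_finite_measure mu by (rule sigma_finite_mu)
  interpret P: pair_sigma_finite lborel mu ..
  have g1: "g u \<le> 1" for u using g(3)[of u] by (auto split: split_indicator_asm)
  note [measurable] = g(1)
  have [measurable]: "(\<lambda>x. w (fst x) (snd x)) \<in> borel_measurable (borel \<Otimes>\<^sub>M (borel \<Otimes>\<^sub>M M))"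
    using w_pair_meas by (simp add: case_prod_beta')
  have m: "(\<lambda>(s, p). ennreal (g (w t p) * g (w s p)) * indicator {a..b} s) \<in> borel_measurable (lborel \<Otimes>\<^sub>M mu)"
    by (subst measurable_cong_sets[OF sets_pair_measure_cong[OF sets_lborel sets_mu] refl])
       (simp add: case_prod_beta', measurable)
  have "(\<integral>\<^sup>+p. ennreal (g (w t p) * occupation g a b (\<lambda>s. w s p)) \<partial>mu) =
    (\<integral>\<^sup>+p. \<integral>\<^sup>+s. ennreal (g (w t p) * g (w s p)) * indicator {a..b} s \<partial>lborel \<partial>mu)"
  proof (rule nn_integral_cong)
    fix p assume p: "p \<in> space mu"
    note [measurable] = w_path_meas[OF p]
    have "(\<integral>\<^sup>+s. ennreal (g (w t p) * g (w s p)) * indicator {a..b} s \<partial>lborel) =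
      (\<integral>\<^sup>+s. ennreal (g (w t p)) * ennreal (indicator {a..b} s *\<^sub>R g (w s p)) \<partial>lborel)"
      using g by (intro nn_integral_cong) (auto simp: ennreal_mult split: split_indicator)
    also have "\<dots> = ennreal (g (w t p)) * (\<integral>\<^sup>+s. ennreal (indicator {a..b} s *\<^sub>R g (w s p)) \<partial>lborel)"
      by (rule nn_integral_cmult) measurable
    also have "(\<integral>\<^sup>+s. ennreal (indicator {a..b} s *\<^sub>R g (w s p)) \<partial>lborel) = ennreal (occupation g a b (\<lambda>s. w s p))"
      unfolding occupation_def set_lebesgue_integral_def
      using occupation_set_integrable[OF w_path_meas[OF p] g(1,2) g1, of a b] g
      by (intro nn_integral_eq_integral) (auto simp: set_integrable_def)
    finally show "ennreal (g (w t p) * occupation g a b (\<lambda>s. w s p)) =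
       (\<integral>\<^sup>+s. ennreal (g (w t p) * g (w s p)) * indicator {a..b} s \<partial>lborel)"
      using g by (simp add: ennreal_mult')
  qed
  also have "\<dots> = (\<integral>\<^sup>+s. \<integral>\<^sup>+p. ennreal (g (w t p) * g (w s p)) * indicator {a..b} s \<partial>mu \<partial>lborel)"
    by (rule P.Fubini'[OF m])
  also have "\<dots> \<le> (\<integral>\<^sup>+s. ennreal (2 * exp (- V s t / 4)) * indicator {a..b} s \<partial>lborel)"
  proof (rule nn_integral_mono)
    fix s
    have "(\<integral>\<^sup>+p. ennreal (g (w t p) * g (w s p)) * indicator {a..b} s \<partial>mu) =
       (\<integral>\<^sup>+p. ennreal (g (w t p) * g (w s p)) \<partial>mu) * indicator {a..b} s"
      by (rule nn_integral_multc) measurable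
    also have "\<dots> \<le> (\<integral>\<^sup>+p. indicator {p\<in>space mu. 0 < w t p \<and> 0 < w s p} p \<partial>mu) * indicator {a..b} s"
    proof (intro mult_right_mono nn_integral_mono)
      fix p assume "p \<in> space mu"
      have gz: "g u = 0" if "u \<le> 0" for u using g(2,3)[of u] that by simp
      have "g (w t p) * g (w s p) \<le> 1 * 1" using g(2) g1 by (intro mult_mono) auto
      then show "ennreal (g (w t p) * g (w s p)) \<le> indicator {p\<in>space mu. 0 < w t p \<and> 0 < w s p} p"
        using \<open>p \<in> space mu\<close> gz[of "w t p"] gz[of "w s p"]
        by (cases "0 < w t p"; cases "0 < w s p") (auto simp: ennreal_le_1)
    qed simp
    also have "(\<integral>\<^sup>+p. indicator {p\<in>space mu. 0 < w t p \<and> 0 < w s p} p \<partial>mu) = emeasure mu {p\<in>space mu. 0 < w t p \<and> 0 < w s p}"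
      by (rule nn_integral_indicator) measurable
    also have "\<dots> * indicator {a..b} s \<le> ennreal (2 * exp (- V s t / 4)) * indicator {a..b} s"
      by (intro mult_right_mono two_point_bound) simp
    finally show "(\<integral>\<^sup>+p. ennreal (g (w t p) * g (w s p)) * indicator {a..b} s \<partial>mu) \<le> ennreal (2 * exp (- V s t / 4)) * indicator {a..b} s" .
  qed
  finally show ?thesis .
qed

end

context brown_resnick begin

text \<open>
  The exponential of a power decays faster than the inverse square; \<open>k\<close> is chosen with \<open>\<kappa> * k \<ge> 2\<close>.
\<close>

lemma decorrelation:
  obtains D where "0 < D" "\<And>s t. 0 \<le> s \<Longrightarrow> 0 \<le> t \<Longrightarrow> 1 \<le> \<bar>s - t\<bar> \<Longrightarrow> 2 * exp (- V s t / 4) \<le> D / (s - t)\<^sup>2"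
proof -
  define k where "k = nat \<lceil>2 / \<kappa>\<rceil>"
  have k: "2 \<le> \<kappa> * real k"
  proof -
    have "2 / \<kappa> \<le> real k" unfolding k_def by (rule real_nat_ceiling_ge)
    then show ?thesis using pos by (simp add: field_simps)
  qed
  define D where "D = 2 * fact k / (C1 / 4) ^ k"
  show thesis
  proof (rule that[of D])
    show "0 < D" using pos by (simp add: D_def)
    fix s t :: real assume st: "0 \<le> s" "0 \<le> t" "1 \<le> \<bar>s - t\<bar>"
    define r where "r = \<bar>s - t\<bar>"
    have r: "1 \<le> r" "r\<^sup>2 = (s - t)\<^sup>2" using st by (auto simp: r_def)
    have u: "0 < C1 / 4 * r powr \<kappa>" using pos r by simp
    have "exp (- V s t / 4) \<le> exp (- (C1 / 4 * r powr \<kappa>))"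
      using V_lower[OF st(1,2)] by (simp add: r_def)
    also have "\<dots> \<le> fact k / (C1 / 4 * r powr \<kappa>) ^ k"
      by (rule exp_neg_le_power[OF u])
    also have "(C1 / 4 * r powr \<kappa>) ^ k = (C1 / 4) ^ k * r powr (\<kappa> * real k)"
    proof -
      have "(r powr \<kappa>) ^ k = r powr (\<kappa> * real k)"
        using r(1) by (simp add: powr_realpow[symmetric] powr_powr)
      then show ?thesis by (simp only: power_mult_distrib)
    qed
    also have "fact k / ((C1 / 4) ^ k * r powr (\<kappa> * real k)) \<le> fact k / ((C1 / 4) ^ k * r powr 2)"
      using pos r k by (intro divide_left_mono mult_left_mono powr_mono mult_pos_pos) auto
    also have "r powr 2 = (s - t)\<^sup>2" using r by simp
    finally show "2 * exp (- V s t / 4) \<le> D / (s - t)\<^sup>2" by (simp add: D_def)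
  qed
qed

lemma inverse_square_tail:
  fixes t A D :: real assumes "0 < A" "0 \<le> D"
  shows "(\<integral>\<^sup>+s. ennreal (D / (s - t)\<^sup>2) * indicator {t + A..} s \<partial>lborel) = ennreal (D / A)"
proof -
  have "(\<integral>\<^sup>+s. ennreal (D / (s - t)\<^sup>2) * indicator {t + A..} s \<partial>lborel) = ennreal (0 - (- D / (t + A - t)))"
  proof (rule nn_integral_FTC_atLeast)
    show "((\<lambda>s. - D / (s - t)) has_real_derivative D / (s - t)\<^sup>2) (at s)" if "t + A \<le> s" for s
      using that assms by (auto intro!: derivative_eq_intros simp: power2_eq_square)
    show "((\<lambda>s. - D / (s - t)) \<longlongrightarrow> 0) at_top" by real_asymp
  qed (use assms in auto)
  then show ?thesis by simp
qed

lemma decorrelation_tail: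
  obtains D where "0 < D" "\<And>t A T. 0 \<le> t \<Longrightarrow> 1 \<le> A \<Longrightarrow>
    (\<integral>\<^sup>+s. ennreal (2 * exp (- V s t / 4)) * indicator {t + A..T} s \<partial>lborel) \<le> ennreal (D / A)"
proof -
  obtain D where D: "0 < D" "\<And>s t. 0 \<le> s \<Longrightarrow> 0 \<le> t \<Longrightarrow> 1 \<le> \<bar>s - t\<bar> \<Longrightarrow> 2 * exp (- V s t / 4) \<le> D / (s - t)\<^sup>2"
    using decorrelation by blast
  show thesis
  proof (rule that[OF D(1)])
    fix t A T :: real assume t: "0 \<le> t" and A: "1 \<le> A"
    have "(\<integral>\<^sup>+s. ennreal (2 * exp (- V s t / 4)) * indicator {t + A..T} s \<partial>lborel) \<le>
      (\<integral>\<^sup>+s. ennreal (D / (s - t)\<^sup>2) * indicator {t + A..} s \<partial>lborel)"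
    proof (intro nn_integral_mono)
      fix s :: real
      show "ennreal (2 * exp (- V s t / 4)) * indicator {t + A..T} s \<le> ennreal (D / (s - t)\<^sup>2) * indicator {t + A..} s"
      proof (cases "s \<in> {t + A..T}")
        case True
        then have "2 * exp (- V s t / 4) \<le> D / (s - t)\<^sup>2" using t A by (intro D(2)) auto
        then show ?thesis using True by (simp add: ennreal_leI)
      qed simp
    qed
    also have "\<dots> = ennreal (D / A)" using D(1) A by (intro inverse_square_tail) auto
    finally show "(\<integral>\<^sup>+s. ennreal (2 * exp (- V s t / 4)) * indicator {t + A..T} s \<partial>lborel) \<le> ennreal (D / A)" .
  qed
qed

end

definition ramp :: "real \<Rightarrow> real \<Rightarrow> real" where
  "ramp \<epsilon> u = max 0 (min 1 (u / \<epsilon>))"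

lemma ramp_continuous_bounded: "continuous_on UNIV (ramp \<epsilon>)" "0 \<le> ramp \<epsilon> u" "ramp \<epsilon> u \<le> 1"
  unfolding ramp_def divide_inverse by (auto intro!: continuous_intros)

lemma ramp_le_indicator: "0 < \<epsilon> \<Longrightarrow> ramp \<epsilon> u \<le> indicator {0<..} u"
  by (auto simp: ramp_def divide_simps split: split_indicator)

text \<open>
  Raising a path by \<open>2 * \<epsilon>\<close> makes its ramp count the time above zero and the time in the strip together.
\<close>

lemma indicator_bump_le_ramp: "0 < \<epsilon> \<Longrightarrow> indicator {0<..} u + bump \<epsilon> u \<le> ramp \<epsilon> (u + 2 * \<epsilon>)"
  by (auto simp: ramp_def bump_def divide_simps min_def max_def split: split_indicator)

lemma ramp_meas [measurable]: "ramp \<epsilon> \<in> borel_measurable borel"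
  by (rule borel_measurable_continuous_onI[OF ramp_continuous_bounded(1)])

text \<open>
  Moving a level by \<open>a\<close> costs a factor \<open>exp a\<close>, whatever the functional and the length of the interval.
\<close>

lemma (in gaussian_paths) nn_integral_mu_translate:
  assumes [measurable]: "\<Phi> \<in> borel_measurable (borel \<Otimes>\<^sub>M M)"
  shows "(\<integral>\<^sup>+p. \<Phi> (fst p + a, snd p) \<partial>mu) = ennreal (exp a) * (\<integral>\<^sup>+p. \<Phi> p \<partial>mu)"
proof -
  have "(\<integral>\<^sup>+p. \<Phi> (fst p + a, snd p) \<partial>mu) =
    (\<integral>\<^sup>+\<omega>. \<integral>\<^sup>+z. \<Phi> (z - W 0 \<omega> + a, \<omega>) * ennreal (exp (- z)) \<partial>lborel \<partial>Q 0)"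
    by (subst nn_integral_mu[where t = 0]) auto
  also have "\<dots> = (\<integral>\<^sup>+\<omega>. ennreal (exp a) * (\<integral>\<^sup>+z. \<Phi> (z - W 0 \<omega>, \<omega>) * ennreal (exp (- z)) \<partial>lborel) \<partial>Q 0)"
  proof (rule nn_integral_cong)
    fix \<omega> assume "\<omega> \<in> space (Q 0)"
    then have \<omega>[measurable]: "\<omega> \<in> space M" by simp
    have [measurable]: "(\<lambda>y. \<Phi> (y, \<omega>)) \<in> borel_measurable borel"
      by (rule measurable_compose[OF measurable_Pair2'[OF \<omega>]]) measurable
    have "(\<integral>\<^sup>+z. \<Phi> (z - W 0 \<omega> + a, \<omega>) * ennreal (exp (- z)) \<partial>lborel) =
      (\<integral>\<^sup>+z. \<Phi> ((- a + 1 * z) - W 0 \<omega> + a, \<omega>) * ennreal (exp (- (- a + 1 * z))) \<partial>lborel)"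
      by (subst nn_integral_real_affine[where c = 1 and t = "- a"]) auto
    also have "\<dots> = (\<integral>\<^sup>+z. ennreal (exp a) * (\<Phi> (z - W 0 \<omega>, \<omega>) * ennreal (exp (- z))) \<partial>lborel)"
      by (intro nn_integral_cong) (simp add: exp_diff exp_minus divide_inverse ennreal_mult mult_ac)
    also have "\<dots> = ennreal (exp a) * (\<integral>\<^sup>+z. \<Phi> (z - W 0 \<omega>, \<omega>) * ennreal (exp (- z)) \<partial>lborel)"
      by (rule nn_integral_cmult) measurable
    finally show "(\<integral>\<^sup>+z. \<Phi> (z - W 0 \<omega> + a, \<omega>) * ennreal (exp (- z)) \<partial>lborel) =
      ennreal (exp a) * (\<integral>\<^sup>+z. \<Phi> (z - W 0 \<omega>, \<omega>) * ennreal (exp (- z)) \<partial>lborel)" .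
  qed
  also have "\<dots> = ennreal (exp a) * (\<integral>\<^sup>+p. \<Phi> p \<partial>mu)"
    by (subst nn_integral_mu[where t = 0], measurable, rule nn_integral_cmult) measurable
  finally show ?thesis .
qed

text \<open>
  The two integrands differ by at most \<open>L\<close> times the time that the path spends above zero after
  \<open>t + A\<close>, and by \<open>two_point_bound\<close> a path that is positive at \<open>t\<close> is rarely positive much later.
\<close>

lemma (in brown_resnick) truncate_future:
  assumes g: "g \<in> borel_measurable borel" "\<And>u. 0 \<le> g u" "\<And>u. g u \<le> indicator {0<..} u"
    and \<rho>: "\<rho> \<in> borel_measurable borel" "\<And>k. 0 \<le> \<rho> k" "\<And>k k'. \<bar>\<rho> k - \<rho> k'\<bar> \<le> L * \<bar>k - k'\<bar>"
    and D: "(\<integral>\<^sup>+s. ennreal (2 * exp (- V s t / 4)) * indicator {t + A..T} s \<partial>lborel) \<le> ennreal d" "0 \<le> d"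
    and t: "0 \<le> A" "t + A \<le> T" and L: "0 \<le> L"
  shows "(\<integral>\<^sup>+p. ennreal (g (w t p) * \<rho> (occupation g t T (\<lambda>s. w s p))) \<partial>mu) \<le>
      (\<integral>\<^sup>+p. ennreal (g (w t p) * \<rho> (occupation g t (t + A) (\<lambda>s. w s p))) \<partial>mu) + ennreal (L * d)" (is "?I1 \<le> ?I2 + _")
    and "(\<integral>\<^sup>+p. ennreal (g (w t p) * \<rho> (occupation g t (t + A) (\<lambda>s. w s p))) \<partial>mu) \<le>
      (\<integral>\<^sup>+p. ennreal (g (w t p) * \<rho> (occupation g t T (\<lambda>s. w s p))) \<partial>mu) + ennreal (L * d)"
proof -
  note [measurable] = g(1) \<rho>(1)
  have g1: "g u \<le> 1" for u using g(3)[of u] by (auto split: split_indicator_asm)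
  define R where "R = (\<integral>\<^sup>+p. ennreal (L * (g (w t p) * occupation g (t + A) T (\<lambda>s. w s p))) \<partial>mu)"
  have R: "R \<le> ennreal (L * d)"
  proof -
    have nn: "0 \<le> g (w t p) * occupation g (t + A) T (\<lambda>s. w s p)" for p
      using g occupation_bounds(1)[OF t(2) g(2) g1] by simp
    have "R = (\<integral>\<^sup>+p. ennreal L * ennreal (g (w t p) * occupation g (t + A) T (\<lambda>s. w s p)) \<partial>mu)"
      unfolding R_def using L nn by (intro nn_integral_cong) (simp add: ennreal_mult)
    also have "\<dots> = ennreal L * (\<integral>\<^sup>+p. ennreal (g (w t p) * occupation g (t + A) T (\<lambda>s. w s p)) \<partial>mu)"
      by (rule nn_integral_cmult) measurable
    also have "\<dots> \<le> ennreal L * ennreal d"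
      using nn_integral_two_point[OF g, of t "t + A" T] D(1) by (intro mult_left_mono) (auto intro: order_trans)
    finally show ?thesis using L D(2) by (simp add: ennreal_mult)
  qed
  have near: "g (w t p) * \<rho> (occupation g t T (\<lambda>s. w s p)) \<le> g (w t p) * \<rho> (occupation g t (t + A) (\<lambda>s. w s p)) + L * (g (w t p) * occupation g (t + A) T (\<lambda>s. w s p))"
    "g (w t p) * \<rho> (occupation g t (t + A) (\<lambda>s. w s p)) \<le> g (w t p) * \<rho> (occupation g t T (\<lambda>s. w s p)) + L * (g (w t p) * occupation g (t + A) T (\<lambda>s. w s p))"
    if p: "p \<in> space mu" for p
  proof -
    have split: "occupation g t T (\<lambda>s. w s p) = occupation g t (t + A) (\<lambda>s. w s p) + occupation g (t + A) T (\<lambda>s. w s p)"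
      by (rule occupation_split[OF w_path_meas[OF p] g(1,2) g1]) (use t in auto)
    have nn: "0 \<le> occupation g (t + A) T (\<lambda>s. w s p)" by (rule occupation_bounds(1)[OF t(2) g(2) g1])
    have "\<bar>\<rho> (occupation g t T (\<lambda>s. w s p)) - \<rho> (occupation g t (t + A) (\<lambda>s. w s p))\<bar> \<le> L * occupation g (t + A) T (\<lambda>s. w s p)"
      using \<rho>(3)[of "occupation g t T (\<lambda>s. w s p)" "occupation g t (t + A) (\<lambda>s. w s p)"] nn by (simp add: split)
    then have "\<rho> (occupation g t T (\<lambda>s. w s p)) \<le> \<rho> (occupation g t (t + A) (\<lambda>s. w s p)) + L * occupation g (t + A) T (\<lambda>s. w s p)"
      "\<rho> (occupation g t (t + A) (\<lambda>s. w s p)) \<le> \<rho> (occupation g t T (\<lambda>s. w s p)) + L * occupation g (t + A) T (\<lambda>s. w s p)" by linarith+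
    from this[THEN mult_left_mono[OF _ g(2)[of "w t p"]]]
    show "g (w t p) * \<rho> (occupation g t T (\<lambda>s. w s p)) \<le> g (w t p) * \<rho> (occupation g t (t + A) (\<lambda>s. w s p)) + L * (g (w t p) * occupation g (t + A) T (\<lambda>s. w s p))"
     "g (w t p) * \<rho> (occupation g t (t + A) (\<lambda>s. w s p)) \<le> g (w t p) * \<rho> (occupation g t T (\<lambda>s. w s p)) + L * (g (w t p) * occupation g (t + A) T (\<lambda>s. w s p))"
      by (simp_all add: algebra_simps)
  qed
  have nnL: "0 \<le> L * (g (w t p) * occupation g (t + A) T (\<lambda>s. w s p))" for p
    using L g occupation_bounds(1)[OF t(2) g(2) g1] by simp
  have "?I1 \<le> (\<integral>\<^sup>+p. ennreal (g (w t p) * \<rho> (occupation g t (t + A) (\<lambda>s. w s p))) + ennreal (L * (g (w t p) * occupation g (t + A) T (\<lambda>s. w s p))) \<partial>mu)"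
    using near(1) nnL g \<rho> by (intro nn_integral_mono) (simp flip: ennreal_plus)
  also have "\<dots> = ?I2 + R" unfolding R_def by (rule nn_integral_add) measurable
  finally show "?I1 \<le> ?I2 + ennreal (L * d)" using R by (meson add_left_mono order_trans)
  have "?I2 \<le> (\<integral>\<^sup>+p. ennreal (g (w t p) * \<rho> (occupation g t T (\<lambda>s. w s p))) + ennreal (L * (g (w t p) * occupation g (t + A) T (\<lambda>s. w s p))) \<partial>mu)"
    using near(2) nnL g \<rho> by (intro nn_integral_mono) (simp flip: ennreal_plus)
  also have "\<dots> = ?I1 + R" unfolding R_def by (rule nn_integral_add) measurable
  finally show "?I2 \<le> ?I1 + ennreal (L * d)" using R by (meson add_left_mono order_trans)
qed

context brown_resnick_pair begin

text \<open>
  By \<open>nn_integral_threshold\<close> the mean is the time integral of quantities \<open>H t T\<close>. Up to a small error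
  they depend on the window \<open>[t, t + A]\<close> only, and for late \<open>t\<close> they are close to their value for the
  reference process. The times \<open>t\<close> before \<open>t1\<close> and after \<open>T - A\<close> contribute a bounded amount.
\<close>

theorem threshold_mean_asymptotics:
  assumes g: "continuous_on UNIV g" "\<And>u. 0 \<le> g u" "\<And>u. g u \<le> 1" "\<And>u. g u \<le> indicator {0<..} u"
    and \<psi>: "\<And>k. (\<psi> has_real_derivative \<rho> k) (at k)" "\<psi> 0 = 0"
    and \<rho>: "continuous_on UNIV \<rho>" "\<And>k. 0 \<le> \<rho> k" "\<And>k. \<rho> k \<le> K" "\<And>k k'. \<bar>\<rho> k - \<rho> k'\<bar> \<le> L * \<bar>k - k'\<bar>"
    and L: "0 \<le> L" and e: "0 < e"
  shows "\<forall>\<^sub>F A in at_top. \<forall>\<^sub>F T in at_top.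
    ennreal (T * (R.window g \<rho> g A 0 - e)) \<le> (\<integral>\<^sup>+p. ennreal (\<psi> (occupation g 0 T (\<lambda>s. w s p))) \<partial>mu) \<and>
    (\<integral>\<^sup>+p. ennreal (\<psi> (occupation g 0 T (\<lambda>s. w s p))) \<partial>mu) \<le> ennreal (T * (R.window g \<rho> g A 0 + e))"
proof -
  have gm[measurable]: "g \<in> borel_measurable borel" using g(1) by (rule borel_measurable_continuous_onI)
  have \<rho>m[measurable]: "\<rho> \<in> borel_measurable borel" using \<rho>(1) by (rule borel_measurable_continuous_onI)
  obtain D where D: "0 < D" "\<And>t A T. 0 \<le> t \<Longrightarrow> 1 \<le> A \<Longrightarrow>
    (\<integral>\<^sup>+s. ennreal (2 * exp (- V s t / 4)) * indicator {t + A..T} s \<partial>lborel) \<le> ennreal (D / A)"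
    using decorrelation_tail by blast
  have K: "0 \<le> K" using \<rho>(2,3)[of 0] by (rule order_trans)
  define H where "H t T = (\<integral>\<^sup>+p. ennreal (g (w t p) * \<rho> (occupation g t T (\<lambda>s. w s p))) \<partial>mu)" for t T
  have HK: "H t T \<le> ennreal K" for t T
  proof -
    have "H t T \<le> (\<integral>\<^sup>+p. ennreal K * indicator {p\<in>space mu. 0 < w t p} p \<partial>mu)"
      unfolding H_def
    proof (rule nn_integral_mono)
      fix p assume p: "p \<in> space mu"
      have "g (w t p) * \<rho> (occupation g t T (\<lambda>s. w s p)) \<le> indicator {0<..} (w t p) * K"
        using g \<rho> by (intro mult_mono) auto
      then show "ennreal (g (w t p) * \<rho> (occupation g t T (\<lambda>s. w s p))) \<le> ennreal K * indicator {p\<in>space mu. 0 < w t p} p"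
        using p by (cases "0 < w t p") (auto simp: ennreal_leI ennreal_neg)
    qed
    also have "\<dots> = ennreal K * emeasure mu {p\<in>space mu. 0 < w t p}"
      by (rule nn_integral_cmult_indicator) measurable
    finally show ?thesis by (simp only: emeasure_level_UNIV) simp
  qed
  have H_window: "H t (t + A) = ennreal (window g \<rho> g A t)" for t A
    unfolding H_def by (rule nn_integral_window[OF g(1-3) \<rho>(1-3) gm g(2,4)])
  have ev_A: "\<forall>\<^sub>F A in at_top. L * (D / A) \<le> e / 4"
  proof -
    have "((\<lambda>A. L * (D / A)) \<longlongrightarrow> 0) at_top" by real_asymp
    then have "\<forall>\<^sub>F A in at_top. L * (D / A) < e / 4" using e by (intro order_tendstoD) auto
    then show ?thesis by eventually_elim simp
  qed
  show ?thesis
    using ev_A eventually_ge_at_top[of 1]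
  proof eventually_elim
    case (elim A)
    define h where "h = R.window g \<rho> g A 0"
    have h0: "0 \<le> h"
      unfolding h_def R.window_def using g(2) R.window_at_bounds[OF g(1-3) \<rho>(1-3) gm g(2,4)]
      by (intro Bochner_Integration.integral_nonneg) auto
    have "(window g \<rho> g A \<longlongrightarrow> h) at_top"
      unfolding h_def using elim by (intro window_tendsto[OF g(1-3) \<rho>(1-3) gm g(2,4)]) auto
    then have "\<forall>\<^sub>F t in at_top. dist (window g \<rho> g A t) h < e / 4" using e by (intro tendstoD) auto
    then obtain t0 where t0: "\<And>t. t0 \<le> t \<Longrightarrow> \<bar>window g \<rho> g A t - h\<bar> < e / 4"
      by (auto simp: eventually_at_top_linorder dist_real_def)
    define t1 where "t1 = max 0 t0"
    have LD: "0 \<le> L * (D / A)" "0 \<le> D / A" using L D elim by auto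
    have upper: "H t T \<le> ennreal (h + e / 2)" and lower: "ennreal (h - e / 2) \<le> H t T" if t: "t1 \<le> t" "t + A \<le> T" for t T
    proof -
      have t': "0 \<le> t" "t0 \<le> t" using t by (auto simp: t1_def)
      have A0: "0 \<le> A" using elim by simp
      note tf = truncate_future[OF gm g(2,4) \<rho>m \<rho>(2,4) D(2)[OF t'(1) elim(2)] LD(2) A0 t(2) L, folded H_def]
      have w0: "0 \<le> window g \<rho> g A t"
        unfolding window_def using g(2) window_at_bounds[OF g(1-3) \<rho>(1-3) gm g(2,4)]
        by (intro Bochner_Integration.integral_nonneg) auto
      have "H t T \<le> ennreal (window g \<rho> g A t + L * (D / A))"
        using tf(1) w0 LD by (simp add: H_window)
      also have "\<dots> \<le> ennreal (h + e / 2)" using t0[OF t'(2)] elim(1) by (intro ennreal_leI) linarith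
      finally show "H t T \<le> ennreal (h + e / 2)" .
      have "ennreal (window g \<rho> g A t) \<le> H t T + ennreal (L * (D / A))"
        using tf(2) by (simp add: H_window)
      then have "ennreal (window g \<rho> g A t - L * (D / A)) \<le> H t T"
        using LD by (subst ennreal_minus[symmetric]) (auto intro: ennreal_minus_le_iff[THEN iffD2] simp: add.commute)
      moreover have "ennreal (h - e / 2) \<le> ennreal (window g \<rho> g A t - L * (D / A))"
        using t0[OF t'(2)] elim(1) by (intro ennreal_leI) linarith
      ultimately show "ennreal (h - e / 2) \<le> H t T" by (rule order_trans[rotated])
    qed
    \<comment> \<open>The total length of the two end intervals on which \<open>H t T\<close> is not controlled.\<close>
    define Y where "Y = t1 + A"
    have Y: "0 \<le> Y" "0 \<le> t1" using elim by (auto simp: Y_def t1_def)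
    show "\<forall>\<^sub>F T in at_top.
      ennreal (T * (R.window g \<rho> g A 0 - e)) \<le> (\<integral>\<^sup>+p. ennreal (\<psi> (occupation g 0 T (\<lambda>s. w s p))) \<partial>mu) \<and>
      (\<integral>\<^sup>+p. ennreal (\<psi> (occupation g 0 T (\<lambda>s. w s p))) \<partial>mu) \<le> ennreal (T * (R.window g \<rho> g A 0 + e))"
      using eventually_ge_at_top[of "Y"] eventually_ge_at_top[of "2 * K * Y / e"] eventually_ge_at_top[of "2 * h * Y / e"]
    proof eventually_elim
      case (elim T)
      have T: "0 \<le> T" using elim Y by simp
      have eq: "(\<integral>\<^sup>+p. ennreal (\<psi> (occupation g 0 T (\<lambda>s. w s p))) \<partial>mu) = (\<integral>\<^sup>+t. H t T * indicator {0..T} t \<partial>lborel)"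
        unfolding H_def by (rule nn_integral_threshold[OF T g(1-3) \<psi> \<rho>(1,2)])
      have "(\<integral>\<^sup>+t. H t T * indicator {0..T} t \<partial>lborel) \<le>
        (\<integral>\<^sup>+t. ennreal (h + e / 2) * indicator {0..T} t + (ennreal K * indicator {0..t1} t + ennreal K * indicator {T - A..T} t) \<partial>lborel)"
      proof (rule nn_integral_mono)
        fix t :: real
        consider "t \<notin> {0..T}" | "t \<in> {0..t1}" "t \<in> {0..T}" | "t \<in> {T - A..T}" "t \<in> {0..T}" | "t1 \<le> t" "t + A \<le> T" "t \<in> {0..T}"
          by fastforce
        then show "H t T * indicator {0..T} t \<le> ennreal (h + e / 2) * indicator {0..T} t + (ennreal K * indicator {0..t1} t + ennreal K * indicator {T - A..T} t)"
        proof cases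
          case 2
          then have "H t T * indicator {0..T} t \<le> ennreal K * indicator {0..t1} t" using HK by simp
          then show ?thesis by (simp add: add_increasing add_increasing2)
        next
          case 3
          then have "H t T * indicator {0..T} t \<le> ennreal K * indicator {T - A..T} t" using HK by simp
          then show ?thesis by (simp add: add_increasing)
        next
          case 4
          then have "H t T * indicator {0..T} t \<le> ennreal (h + e / 2) * indicator {0..T} t" using upper by simp
          then show ?thesis by (simp add: add_increasing2)
        qed simp
      qed
      also have "\<dots> = ennreal (h + e / 2) * ennreal T + (ennreal K * ennreal t1 + ennreal K * ennreal A)"
        using T Y \<open>1 \<le> A\<close> by (simp add: nn_integral_add nn_integral_cmult emeasure_lborel_Icc_eq del: ennreal_plus)
      also have "\<dots> = ennreal ((h + e / 2) * T + K * Y)"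
      proof -
        have nn: "0 \<le> h + e / 2" "0 \<le> A" "0 \<le> (h + e / 2) * T" "0 \<le> K * t1" "0 \<le> K * A"
          using h0 e T K Y \<open>1 \<le> A\<close> by auto
        have "ennreal (h + e / 2) * ennreal T + (ennreal K * ennreal t1 + ennreal K * ennreal A) =
          ennreal ((h + e / 2) * T) + (ennreal (K * t1) + ennreal (K * A))"
          using nn T K Y by (simp only: ennreal_mult)
        also have "\<dots> = ennreal ((h + e / 2) * T + (K * t1 + K * A))"
          using nn by (simp only: ennreal_plus add_nonneg_nonneg)
        finally show ?thesis by (simp add: Y_def distrib_left)
      qed
      also have "\<dots> \<le> ennreal (T * (h + e))"
      proof (rule ennreal_leI)
        have "2 * K * Y / e * (e / 2) \<le> T * (e / 2)" using elim(2) e by (intro mult_right_mono) auto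
        moreover have "2 * K * Y / e * (e / 2) = K * Y" using e by simp
        ultimately show "(h + e / 2) * T + K * Y \<le> T * (h + e)" by (simp add: algebra_simps)
      qed
      finally have up: "(\<integral>\<^sup>+t. H t T * indicator {0..T} t \<partial>lborel) \<le> ennreal (T * (h + e))" .
      have lo: "ennreal (T * (h - e)) \<le> (\<integral>\<^sup>+t. H t T * indicator {0..T} t \<partial>lborel)"
      proof (cases "h \<le> e / 2")
        case True
        then have "T * (h - e) \<le> 0" using T e by (intro mult_nonneg_nonpos) auto
        then show ?thesis by (simp add: ennreal_neg)
      next
        case False
        have "ennreal (T * (h - e)) \<le> ennreal ((h - e / 2) * (T - Y))"
        proof (rule ennreal_leI)
          have "2 * h * Y / e * (e / 2) \<le> T * (e / 2)" using elim(3) e by (intro mult_right_mono) auto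
          moreover have "2 * h * Y / e * (e / 2) = h * Y" using e by simp
          ultimately have hY: "h * Y \<le> T * (e / 2)" by simp
          have Ye: "0 \<le> Y * e / 2" using Y e by simp
          have arith: "a - b - b \<le> a - y - b + z" if "y \<le> b" "0 \<le> z" for a b y z :: real using that by linarith
          have "(h - e / 2) * (T - Y) = h * T - h * Y - T * (e / 2) + Y * e / 2" by (simp add: field_simps)
          moreover have "T * (h - e) = h * T - T * (e / 2) - T * (e / 2)" by (simp add: field_simps)
          ultimately show "T * (h - e) \<le> (h - e / 2) * (T - Y)" using arith[OF hY Ye] by (simp only:)
        qed
        also have "\<dots> = ennreal (h - e / 2) * ennreal (T - A - t1)"
        proof -
          have TY: "T - Y = T - A - t1" by (simp add: Y_def)
          have "0 \<le> h - e / 2" "0 \<le> T - A - t1" using False elim(1) by (auto simp: Y_def)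
          then show ?thesis unfolding TY by (rule ennreal_mult)
        qed
        also have "\<dots> = (\<integral>\<^sup>+t. ennreal (h - e / 2) * indicator {t1..T - A} t \<partial>lborel)"
          using elim by (simp add: nn_integral_cmult emeasure_lborel_Icc_eq Y_def)
        also have "\<dots> \<le> (\<integral>\<^sup>+t. H t T * indicator {0..T} t \<partial>lborel)"
        proof (rule nn_integral_mono)
          fix t :: real
          show "ennreal (h - e / 2) * indicator {t1..T - A} t \<le> H t T * indicator {0..T} t"
            using lower[of t T] Y \<open>1 \<le> A\<close> by (auto split: split_indicator)
        qed
        finally show ?thesis .
      qed
      show ?case unfolding eq h_def[symmetric] using up lo by simp
    qed
  qed
qed

end

section \<open>A lower bound by second moments\<close>

context brown_resnick begin

lemma sojourn_time_bounds: "0 \<le> T \<Longrightarrow> 0 \<le> sojourn_time T p" "0 \<le> T \<Longrightarrow> sojourn_time T p \<le> T"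
  unfolding sojourn_time_def using occupation_bounds[of 0 T "indicator {0<..}"] by auto

lemma nn_integral_sojourn_time:
  assumes [measurable]: "\<Phi> \<in> borel_measurable (borel \<Otimes>\<^sub>M M)"
  shows "(\<integral>\<^sup>+p. ennreal (sojourn_time T p) * \<Phi> p \<partial>mu) =
    (\<integral>\<^sup>+t. (\<integral>\<^sup>+p. indicator {0<..} (w t p) * \<Phi> p \<partial>mu) * indicator {0..T} t \<partial>lborel)"
proof -
  interpret mu: sigma_finite_measure mu by (rule sigma_finite_mu)
  interpret P: pair_sigma_finite lborel mu ..
  have [measurable]: "(\<lambda>x. w (fst x) (snd x)) \<in> borel_measurable (borel \<Otimes>\<^sub>M (borel \<Otimes>\<^sub>M M))"
    using w_pair_meas by (simp add: case_prod_beta')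
  have m: "(\<lambda>(t, p). (indicator {0<..} (w t p) * \<Phi> p) * indicator {0..T} t) \<in> borel_measurable (lborel \<Otimes>\<^sub>M mu)"
    by (subst measurable_cong_sets[OF sets_pair_measure_cong[OF sets_lborel sets_mu] refl])
       (simp add: case_prod_beta', measurable)
  have "(\<integral>\<^sup>+p. ennreal (sojourn_time T p) * \<Phi> p \<partial>mu) =
    (\<integral>\<^sup>+p. \<integral>\<^sup>+t. (indicator {0<..} (w t p) * \<Phi> p) * indicator {0..T} t \<partial>lborel \<partial>mu)"
  proof (rule nn_integral_cong)
    fix p assume p: "p \<in> space mu"
    note pm[measurable] = w_path_meas[OF p]
    have "(\<integral>\<^sup>+t. (indicator {0<..} (w t p) * \<Phi> p) * indicator {0..T} t \<partial>lborel) =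
      (\<integral>\<^sup>+t. \<Phi> p * ennreal (indicator {0..T} t *\<^sub>R indicator {0<..} (w t p)) \<partial>lborel)"
      by (intro nn_integral_cong) (auto split: split_indicator)
    also have "\<dots> = \<Phi> p * (\<integral>\<^sup>+t. ennreal (indicator {0..T} t *\<^sub>R indicator {0<..} (w t p)) \<partial>lborel)"
      by (rule nn_integral_cmult) measurable
    also have "(\<integral>\<^sup>+t. ennreal (indicator {0..T} t *\<^sub>R indicator {0<..} (w t p)) \<partial>lborel) = ennreal (sojourn_time T p)"
      unfolding sojourn_time_def occupation_def set_lebesgue_integral_def
      using occupation_set_integrable[OF pm, of "indicator {0<..}" 0 T]
      by (intro nn_integral_eq_integral) (auto simp: set_integrable_def)
    finally show "ennreal (sojourn_time T p) * \<Phi> p = (\<integral>\<^sup>+t. (indicator {0<..} (w t p) * \<Phi> p) * indicator {0..T} t \<partial>lborel)"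
      by (simp add: mult.commute)
  qed
  also have "\<dots> = (\<integral>\<^sup>+t. \<integral>\<^sup>+p. (indicator {0<..} (w t p) * \<Phi> p) * indicator {0..T} t \<partial>mu \<partial>lborel)"
    by (rule P.Fubini'[OF m])
  also have "\<dots> = (\<integral>\<^sup>+t. (\<integral>\<^sup>+p. indicator {0<..} (w t p) * \<Phi> p \<partial>mu) * indicator {0..T} t \<partial>lborel)"
    by (intro nn_integral_cong nn_integral_multc) measurable
  finally show ?thesis .
qed

text \<open>
  The square of the sojourn time is a double time integral, and given one of the two times the pairs
  contribute a bounded amount by \<open>two_point_bound\<close>.
\<close>

lemma sojourn_second_moment:
  obtains K where "0 < K" "\<And>T. 0 \<le> T \<Longrightarrow> (\<integral>\<^sup>+p. ennreal (sojourn_time T p) * ennreal (sojourn_time T p) \<partial>mu) \<le> ennreal (K * T)"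
proof -
  obtain D where D: "0 < D" "\<And>s t. 0 \<le> s \<Longrightarrow> 0 \<le> t \<Longrightarrow> 1 \<le> \<bar>s - t\<bar> \<Longrightarrow> 2 * exp (- V s t / 4) \<le> D / (s - t)\<^sup>2"
    using decorrelation by blast
  define K where "K = 4 + 2 * D"
  have bound: "(\<integral>\<^sup>+p. indicator {0<..} (w t p) * ennreal (sojourn_time T p) \<partial>mu) \<le> ennreal K"
    if t: "0 \<le> t" and T: "0 \<le> T" for t T
  proof -
    have right: "(\<integral>\<^sup>+s. ennreal (D / (s - t)\<^sup>2) * indicator {t + 1..} s \<partial>lborel) = ennreal D"
      using inverse_square_tail[of 1 D t] D(1) by simp
    have "(\<integral>\<^sup>+s. ennreal (D / (s - t)\<^sup>2) * indicator {..t - 1} s \<partial>lborel) =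
      ennreal \<bar>- 1\<bar> * (\<integral>\<^sup>+s. ennreal (D / ((2 * t + (- 1) * s) - t)\<^sup>2) * indicator {..t - 1} (2 * t + (- 1) * s) \<partial>lborel)"
      by (rule nn_integral_real_affine) auto
    also have "\<dots> = (\<integral>\<^sup>+s. ennreal (D / (s - t)\<^sup>2) * indicator {t + 1..} s \<partial>lborel)"
      by (simp, intro nn_integral_cong) (auto simp: power2_commute split: split_indicator)
    finally have left: "(\<integral>\<^sup>+s. ennreal (D / (s - t)\<^sup>2) * indicator {..t - 1} s \<partial>lborel) = ennreal D"
      using right by simp
    have "(\<integral>\<^sup>+p. indicator {0<..} (w t p) * ennreal (sojourn_time T p) \<partial>mu) =
      (\<integral>\<^sup>+p. ennreal (indicator {0<..} (w t p) * occupation (indicator {0<..}) 0 T (\<lambda>s. w s p)) \<partial>mu)"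
      by (intro nn_integral_cong) (auto simp: sojourn_time_def split: split_indicator)
    also have "\<dots> \<le> (\<integral>\<^sup>+s. ennreal (2 * exp (- V s t / 4)) * indicator {0..T} s \<partial>lborel)"
      by (rule nn_integral_two_point) auto
    also have "\<dots> \<le> (\<integral>\<^sup>+s. 2 * indicator {t - 1..t + 1} s + (ennreal (D / (s - t)\<^sup>2) * indicator {t + 1..} s +
        ennreal (D / (s - t)\<^sup>2) * indicator {..t - 1} s) \<partial>lborel)"
    proof (rule nn_integral_mono)
      fix s :: real
      consider "s \<notin> {0..T}" | "s \<in> {t - 1..t + 1}" | "s \<in> {0..T}" "t + 1 \<le> s" | "s \<in> {0..T}" "s \<le> t - 1"
        by fastforce
      then show "ennreal (2 * exp (- V s t / 4)) * indicator {0..T} s \<le> 2 * indicator {t - 1..t + 1} s +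
        (ennreal (D / (s - t)\<^sup>2) * indicator {t + 1..} s + ennreal (D / (s - t)\<^sup>2) * indicator {..t - 1} s)"
      proof cases
        case 2
        have "ennreal (2 * exp (- V s t / 4)) \<le> ennreal 2" by (intro ennreal_leI) simp
        then have "ennreal (2 * exp (- V s t / 4)) * indicator {0..T} s \<le> 2 * indicator {t - 1..t + 1} s"
          using 2 by (auto split: split_indicator)
        then show ?thesis by (simp add: add_increasing2)
      next
        case 3
        then have "2 * exp (- V s t / 4) \<le> D / (s - t)\<^sup>2" using t by (intro D(2)) auto
        then have "ennreal (2 * exp (- V s t / 4)) * indicator {0..T} s \<le> ennreal (D / (s - t)\<^sup>2) * indicator {t + 1..} s"
          using 3 by (simp add: ennreal_leI)
        then show ?thesis by (simp add: add_increasing add_increasing2)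
      next
        case 4
        then have "2 * exp (- V s t / 4) \<le> D / (s - t)\<^sup>2" using t by (intro D(2)) auto
        then have "ennreal (2 * exp (- V s t / 4)) * indicator {0..T} s \<le> ennreal (D / (s - t)\<^sup>2) * indicator {..t - 1} s"
          using 4 by (simp add: ennreal_leI)
        then show ?thesis by (simp add: add_increasing)
      qed simp
    qed
    also have "\<dots> = 2 * emeasure lborel {t - 1..t + 1} + (ennreal D + ennreal D)"
      by (subst nn_integral_add, measurable, subst nn_integral_add, measurable) (simp add: left right nn_integral_cmult)
    also have "\<dots> = ennreal K"
      using D(1) by (simp add: emeasure_lborel_Icc_eq K_def ennreal_plus[symmetric] ennreal_numeral[symmetric] ennreal_mult[symmetric]
          del: ennreal_numeral ennreal_plus)
    finally show ?thesis .
  qed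
  show thesis
  proof (rule that[of K])
    show "0 < K" using D(1) by (simp add: K_def)
    fix T :: real assume T: "0 \<le> T"
    have "(\<integral>\<^sup>+p. ennreal (sojourn_time T p) * ennreal (sojourn_time T p) \<partial>mu) =
      (\<integral>\<^sup>+t. (\<integral>\<^sup>+p. indicator {0<..} (w t p) * ennreal (sojourn_time T p) \<partial>mu) * indicator {0..T} t \<partial>lborel)"
      by (rule nn_integral_sojourn_time) measurable
    also have "\<dots> \<le> (\<integral>\<^sup>+t. ennreal K * indicator {0..T} t \<partial>lborel)"
      using bound[OF _ T] by (intro nn_integral_mono) (auto split: split_indicator)
    also have "\<dots> = ennreal (K * T)"
      using D(1) T by (simp add: nn_integral_cmult emeasure_lborel_Icc_eq K_def ennreal_mult del: ennreal_plus)
    finally show "(\<integral>\<^sup>+p. ennreal (sojourn_time T p) * ennreal (sojourn_time T p) \<partial>mu) \<le> ennreal (K * T)" .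
  qed
qed

text \<open>
  From a high level \<open>z\<close> the path needs a drop of size \<open>z\<close> to become negative. For large \<open>z\<close> the expected time
  in \<open>[t, t + x + 1]\<close> with such a drop is at most 1/2, so with probability at least 1/2 it is less
  than 1 and more than \<open>x\<close> units of time remain above zero.
\<close>

lemma long_sojourn_after_level:
  assumes x: "0 \<le> x"
  obtains p0 where "0 < p0" "\<And>t T. 0 \<le> t \<Longrightarrow> t + (x + 1) \<le> T \<Longrightarrow>
    ennreal p0 \<le> emeasure mu {p\<in>space mu. 0 < w t p \<and> x < sojourn_time T p}"
proof -
  define J where "J = x + 1"
  have J: "1 \<le> J" using x by (simp add: J_def)
  define b where "b = C2 * J powr \<kappa>"
  have b: "0 < b" using pos J by (simp add: b_def)
  have "((\<lambda>z. J * exp (z / 2 - z\<^sup>2 / (4 * b))) \<longlongrightarrow> 0) at_top" using b by real_asymp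
  then have "\<forall>\<^sub>F z in at_top. J * exp (z / 2 - z\<^sup>2 / (4 * b)) < 1/2" by (intro order_tendstoD) auto
  then have "\<forall>\<^sub>F z in at_top. 0 \<le> z \<and> J * exp (z / 2 - z\<^sup>2 / (4 * b)) < 1/2"
    using eventually_ge_at_top[of 0] by eventually_elim auto
  then obtain z where z: "0 \<le> z" "J * exp (z / 2 - z\<^sup>2 / (4 * b)) < 1/2"
    by (auto dest: eventually_happens)
  show thesis
  proof (rule that[of "exp (- z) / 2"])
    fix t T :: real assume t: "0 \<le> t" "t + (x + 1) \<le> T"
    interpret Qt: prob_space "Q t" by (rule prob_space_Q)
    interpret QL: pair_sigma_finite lborel "Q t" ..
    define low where "low = (indicator {..- z} :: real \<Rightarrow> real)"
    have low: "low \<in> borel_measurable borel" "\<And>u. 0 \<le> low u" "\<And>u. low u \<le> 1" by (auto simp: low_def)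
    define N where "N \<omega> = occupation low 0 J (\<lambda>s. W (t + s) \<omega> - W t \<omega>)" for \<omega>
    have [measurable]: "N \<in> borel_measurable M"
      unfolding N_def by (rule occupation_measurable[OF increment_pair_meas low(1)])
    define A where "A = {\<omega>\<in>space M. N \<omega> < 1}"
    have [measurable]: "A \<in> sets M" unfolding A_def by measurable
    have [measurable]: "(\<lambda>x. W (t + fst x) (snd x) - W t (snd x)) \<in> borel_measurable (borel \<Otimes>\<^sub>M M)"
      using increment_pair_meas[of t] by (simp add: case_prod_beta')
    have m: "(\<lambda>(s, \<omega>). ennreal (indicator {0..J} s *\<^sub>R low (W (t + s) \<omega> - W t \<omega>))) \<in> borel_measurable (lborel \<Otimes>\<^sub>M Q t)"
      using low(1) by (subst measurable_cong_sets[OF sets_pair_measure_cong[OF sets_lborel sets_Q] refl])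
         (simp add: case_prod_beta')
    have "emeasure (Q t) (space M - A) \<le> (\<integral>\<^sup>+\<omega>. ennreal (N \<omega>) \<partial>Q t)"
    proof -
      have "emeasure (Q t) (space M - A) = (\<integral>\<^sup>+\<omega>. indicator (space M - A) \<omega> \<partial>Q t)" by simp
      also have "\<dots> \<le> (\<integral>\<^sup>+\<omega>. ennreal (N \<omega>) \<partial>Q t)"
        by (intro nn_integral_mono) (auto simp: A_def split: split_indicator)
      finally show ?thesis .
    qed
    also have "\<dots> = (\<integral>\<^sup>+\<omega>. \<integral>\<^sup>+s. ennreal (indicator {0..J} s *\<^sub>R low (W (t + s) \<omega> - W t \<omega>)) \<partial>lborel \<partial>Q t)"
    proof (rule nn_integral_cong)
      fix \<omega> assume "\<omega> \<in> space (Q t)"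
      then have "continuous_on UNIV (\<lambda>s. W (t + s) \<omega> - W t \<omega>)"
        by (intro continuous_intros continuous_on_compose2[OF W_cont]) auto
      then have pm: "(\<lambda>s. W (t + s) \<omega> - W t \<omega>) \<in> borel_measurable borel" by (rule borel_measurable_continuous_onI)
      show "ennreal (N \<omega>) = (\<integral>\<^sup>+s. ennreal (indicator {0..J} s *\<^sub>R low (W (t + s) \<omega> - W t \<omega>)) \<partial>lborel)"
        unfolding N_def occupation_def set_lebesgue_integral_def
        using occupation_set_integrable[OF pm low, of 0 J] low
        by (intro nn_integral_eq_integral[symmetric]) (auto simp: set_integrable_def)
    qed
    also have "\<dots> = (\<integral>\<^sup>+s. \<integral>\<^sup>+\<omega>. ennreal (indicator {0..J} s *\<^sub>R low (W (t + s) \<omega> - W t \<omega>)) \<partial>Q t \<partial>lborel)"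
      by (rule QL.Fubini'[OF m])
    also have "\<dots> \<le> (\<integral>\<^sup>+s. ennreal (exp (z / 2 - z\<^sup>2 / (4 * b))) * indicator {0..J} s \<partial>lborel)"
    proof (rule nn_integral_mono)
      fix s :: real
      show "(\<integral>\<^sup>+\<omega>. ennreal (indicator {0..J} s *\<^sub>R low (W (t + s) \<omega> - W t \<omega>)) \<partial>Q t) \<le> ennreal (exp (z / 2 - z\<^sup>2 / (4 * b))) * indicator {0..J} s"
      proof (cases "s \<in> {0..J}")
        case True
        have "V (t + s) t \<le> C2 * s powr \<kappa>" using V_upper[of "t + s" t] t True by simp
        also have "\<dots> \<le> b" unfolding b_def using pos True by (intro mult_left_mono powr_mono2) auto
        finally have Vb: "V (t + s) t \<le> b" .
        have "(\<integral>\<^sup>+\<omega>. ennreal (indicator {0..J} s *\<^sub>R low (W (t + s) \<omega> - W t \<omega>)) \<partial>Q t) =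
          (\<integral>\<^sup>+\<omega>. indicator {\<omega>\<in>space M. W (t + s) \<omega> - W t \<omega> \<le> - z} \<omega> \<partial>Q t)"
          using True by (intro nn_integral_cong) (auto simp: low_def split: split_indicator)
        also have "\<dots> = emeasure (Q t) {\<omega>\<in>space M. W (t + s) \<omega> - W t \<omega> \<le> - z}"
          by (rule nn_integral_indicator) measurable
        also have "\<dots> \<le> ennreal (exp (z / 2 - z\<^sup>2 / (4 * b)))" by (rule drop_tail[OF Vb b z(1)])
        finally show ?thesis using True by simp
      qed simp
    qed
    also have "\<dots> = ennreal (J * exp (z / 2 - z\<^sup>2 / (4 * b)))"
      using J by (subst nn_integral_cmult_indicator) (auto simp: emeasure_lborel_Icc_eq ennreal_mult mult.commute)
    also have "\<dots> \<le> ennreal (1/2)" using z(2) by (intro ennreal_leI) simp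
    finally have compl: "Qt.prob (space M - A) \<le> 1/2"
      unfolding Qt.emeasure_eq_measure by (subst (asm) ennreal_le_iff) auto
    have "Qt.prob A = 1 - Qt.prob (space M - A)"
      using Qt.prob_compl[of A] by simp
    then have QA: "1/2 \<le> Qt.prob A" using compl by simp
    have "ennreal (exp (- z) / 2) \<le> ennreal (exp (- z)) * emeasure (Q t) A"
      unfolding Qt.emeasure_eq_measure using QA by (subst ennreal_mult[symmetric]) (auto intro!: ennreal_leI)
    also have "\<dots> = emeasure mu {p\<in>space mu. z < w t p \<and> snd p \<in> A}"
      by (rule emeasure_level[symmetric]) measurable
    also have "\<dots> \<le> emeasure mu {p\<in>space mu. 0 < w t p \<and> x < sojourn_time T p}"
    proof (rule emeasure_mono)
      show "{p\<in>space mu. z < w t p \<and> snd p \<in> A} \<subseteq> {p\<in>space mu. 0 < w t p \<and> x < sojourn_time T p}"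
      proof
        fix p assume "p \<in> {p\<in>space mu. z < w t p \<and> snd p \<in> A}"
        then have p: "p \<in> space mu" "z < w t p" "N (snd p) < 1" "snd p \<in> space M" by (auto simp: A_def)
        define i where "i = (indicator {0<..} :: real \<Rightarrow> real)"
        have i: "i \<in> borel_measurable borel" "\<And>u. 0 \<le> i u" "\<And>u. i u \<le> 1" by (auto simp: i_def)
        have "continuous_on UNIV (\<lambda>s. w (t + s) p)"
          by (intro continuous_on_compose2[OF w_cont[OF p(1)]] continuous_intros) auto
        then have pm: "(\<lambda>s. w (t + s) p) \<in> borel_measurable borel" by (rule borel_measurable_continuous_onI)
        have "continuous_on UNIV (\<lambda>s. W (t + s) (snd p) - W t (snd p))"
          using p(4) by (intro continuous_intros continuous_on_compose2[OF W_cont]) auto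
        then have pm': "(\<lambda>s. W (t + s) (snd p) - W t (snd p)) \<in> borel_measurable borel" by (rule borel_measurable_continuous_onI)
        have "J = (\<integral>s. indicator {0..J} s \<partial>lborel)" using J by simp
        also have "\<dots> \<le> (\<integral>s. indicator {0..J} s *\<^sub>R i (w (t + s) p) + indicator {0..J} s *\<^sub>R low (W (t + s) (snd p) - W t (snd p)) \<partial>lborel)"
        proof (rule integral_mono)
          show "indicat_real {0..J} s \<le> indicator {0..J} s *\<^sub>R i (w (t + s) p) + indicator {0..J} s *\<^sub>R low (W (t + s) (snd p) - W t (snd p))" for s
            using p(2) by (auto simp: w_def i_def low_def split: split_indicator)
        qed (use integrable_indicator_Icc occupation_set_integrable[OF pm i, of 0 J] occupation_set_integrable[OF pm' low, of 0 J] in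
            \<open>auto simp: set_integrable_def\<close>)
        also have "\<dots> = occupation i 0 J (\<lambda>s. w (t + s) p) + N (snd p)"
          unfolding N_def occupation_def set_lebesgue_integral_def
          using occupation_set_integrable[OF pm i, of 0 J] occupation_set_integrable[OF pm' low, of 0 J]
          by (simp add: set_integrable_def)
        finally have "x < occupation i 0 J (\<lambda>s. w (t + s) p)" using p(3) by (simp add: J_def)
        also have "\<dots> = occupation i (t + 0) (t + J) (\<lambda>s. w s p)" by (rule occupation_shift[symmetric])
        also have "\<dots> \<le> sojourn_time T p"
          unfolding sojourn_time_def i_def[symmetric] using i t
          by (intro occupation_mono[OF w_path_meas[OF p(1)]]) (auto simp: J_def)
        finally show "p \<in> {p\<in>space mu. 0 < w t p \<and> x < sojourn_time T p}" using p z(1) by simp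
      qed
    qed measurable
    finally show "ennreal (exp (- z) / 2) \<le> emeasure mu {p\<in>space mu. 0 < w t p \<and> x < sojourn_time T p}" .
  qed simp
qed

text \<open>
  Let \<open>L\<close> be the sojourn time and \<open>E\<close> the event \<open>L > x\<close>. On \<open>E\<close> it satisfies \<open>L \<le> a + L\<^sup>2 / a\<close>. The
  integral of \<open>L\<close> over \<open>E\<close> grows at least linearly by \<open>long_sojourn_after_level\<close>, and that of \<open>L\<^sup>2\<close> at most
  linearly, so for large \<open>a\<close> the measure of \<open>E\<close> has to grow linearly.
\<close>

lemma sojourn_exceedance_lower_bound:
  assumes x: "0 \<le> x"
  obtains q where "0 < q" "\<forall>\<^sub>F T in at_top. ennreal (q * T) \<le> emeasure mu {p\<in>space mu. x < sojourn_time T p}"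
proof -
  obtain p0 where p0: "0 < p0" "\<And>t T. 0 \<le> t \<Longrightarrow> t + (x + 1) \<le> T \<Longrightarrow>
    ennreal p0 \<le> emeasure mu {p\<in>space mu. 0 < w t p \<and> x < sojourn_time T p}"
    using long_sojourn_after_level[OF x] by blast
  obtain K where K: "0 < K" "\<And>T. 0 \<le> T \<Longrightarrow> (\<integral>\<^sup>+p. ennreal (sojourn_time T p) * ennreal (sojourn_time T p) \<partial>mu) \<le> ennreal (K * T)"
    using sojourn_second_moment by blast
  \<comment> \<open>Then the second moment divided by \<open>a\<close> is a quarter of the linear lower bound \<open>p0 * T\<close>.\<close>
  define a where "a = 4 * K / p0"
  have a: "0 < a" using K p0 by (simp add: a_def)
  define q where "q = p0 / (4 * a)"
  show thesis
  proof (rule that[of q])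
    show "0 < q" using a p0 by (simp add: q_def)
    show "\<forall>\<^sub>F T in at_top. ennreal (q * T) \<le> emeasure mu {p\<in>space mu. x < sojourn_time T p}"
      using eventually_ge_at_top[of "2 * (x + 1)"]
    proof eventually_elim
      case (elim T)
      have T: "0 \<le> T" "x + 1 \<le> T" using elim x by auto
      define E where "E = {p\<in>space mu. x < sojourn_time T p}"
      have [measurable]: "E \<in> sets mu" unfolding E_def by measurable
      have Em: "E \<in> sets (borel \<Otimes>\<^sub>M M)" using \<open>E \<in> sets mu\<close> by (simp only: sets_mu)
      note [measurable] = Em
      have "ennreal (p0 * (T - (x + 1))) = (\<integral>\<^sup>+t. ennreal p0 * indicator {0..T - (x + 1)} t \<partial>lborel)"
        using p0(1) T by (simp add: nn_integral_cmult emeasure_lborel_Icc_eq ennreal_mult)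
      also have "\<dots> \<le> (\<integral>\<^sup>+t. (\<integral>\<^sup>+p. indicator {0<..} (w t p) * indicator E p \<partial>mu) * indicator {0..T} t \<partial>lborel)"
      proof (rule nn_integral_mono)
        fix t :: real
        show "ennreal p0 * indicator {0..T - (x + 1)} t \<le> (\<integral>\<^sup>+p. indicator {0<..} (w t p) * indicator E p \<partial>mu) * indicator {0..T} t"
        proof (cases "t \<in> {0..T - (x + 1)}")
          case True
          have "ennreal p0 \<le> emeasure mu {p\<in>space mu. 0 < w t p \<and> x < sojourn_time T p}"
            using True by (intro p0(2)) auto
          also have "\<dots> = (\<integral>\<^sup>+p. indicator {p\<in>space mu. 0 < w t p \<and> x < sojourn_time T p} p \<partial>mu)"
            by (rule nn_integral_indicator[symmetric]) measurable
          also have "\<dots> = (\<integral>\<^sup>+p. indicator {0<..} (w t p) * indicator E p \<partial>mu)"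
            by (intro nn_integral_cong) (auto simp: E_def split: split_indicator)
          finally show ?thesis using True x by simp
        qed simp
      qed
      also have "\<dots> = (\<integral>\<^sup>+p. ennreal (sojourn_time T p) * indicator E p \<partial>mu)"
        by (rule nn_integral_sojourn_time[symmetric]) measurable
      also have "\<dots> \<le> (\<integral>\<^sup>+p. ennreal a * indicator E p + ennreal (1 / a) * (ennreal (sojourn_time T p) * ennreal (sojourn_time T p)) \<partial>mu)"
      proof (rule nn_integral_mono)
        fix p
        have s0: "0 \<le> sojourn_time T p" by (rule sojourn_time_bounds[OF T(1)])
        have "sojourn_time T p \<le> a + 1 / a * (sojourn_time T p * sojourn_time T p)"
        proof (cases "sojourn_time T p \<le> a")
          case True
          have "0 \<le> 1 / a * (sojourn_time T p * sojourn_time T p)" using s0 a by simp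
          with True show ?thesis by linarith
        next
          case False
          then have "a * sojourn_time T p \<le> sojourn_time T p * sojourn_time T p" using s0 by (intro mult_right_mono) auto
          then have "sojourn_time T p \<le> 1 / a * (sojourn_time T p * sojourn_time T p)" using a by (simp add: field_simps)
          then show ?thesis using a by linarith
        qed
        then have "ennreal (sojourn_time T p) \<le> ennreal (a + 1 / a * (sojourn_time T p * sojourn_time T p))"
          by (rule ennreal_leI)
        also have "\<dots> = ennreal a + ennreal (1 / a) * (ennreal (sojourn_time T p) * ennreal (sojourn_time T p))"
        proof -
          have "ennreal (1 / a * (sojourn_time T p * sojourn_time T p)) = ennreal (1 / a) * ennreal (sojourn_time T p * sojourn_time T p)"
            using a s0 by (intro ennreal_mult) auto
          moreover have "ennreal (sojourn_time T p * sojourn_time T p) = ennreal (sojourn_time T p) * ennreal (sojourn_time T p)"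
            using s0 by (intro ennreal_mult) auto
          moreover have "0 \<le> 1 / a * (sojourn_time T p * sojourn_time T p)" using a s0 by simp
          ultimately show ?thesis using a by (subst ennreal_plus) auto
        qed
        finally show "ennreal (sojourn_time T p) * indicator E p \<le> ennreal a * indicator E p + ennreal (1 / a) * (ennreal (sojourn_time T p) * ennreal (sojourn_time T p))"
          by (auto split: split_indicator)
      qed
      also have "\<dots> = ennreal a * emeasure mu E + ennreal (1 / a) * (\<integral>\<^sup>+p. ennreal (sojourn_time T p) * ennreal (sojourn_time T p) \<partial>mu)"
      proof -
        have e1: "(\<integral>\<^sup>+p. ennreal a * indicator E p \<partial>mu) = ennreal a * emeasure mu E"
          by (rule nn_integral_cmult_indicator) measurable
        have e2: "(\<integral>\<^sup>+p. ennreal (1 / a) * (ennreal (sojourn_time T p) * ennreal (sojourn_time T p)) \<partial>mu) =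
          ennreal (1 / a) * (\<integral>\<^sup>+p. ennreal (sojourn_time T p) * ennreal (sojourn_time T p) \<partial>mu)"
          by (rule nn_integral_cmult) measurable
        show ?thesis unfolding e1[symmetric] e2[symmetric] by (rule nn_integral_add) measurable
      qed
      also have "\<dots> \<le> ennreal a * emeasure mu E + ennreal (1 / a) * ennreal (K * T)"
        by (intro add_left_mono mult_left_mono K(2) T) simp
      finally have main: "ennreal (p0 * (T - (x + 1))) \<le> ennreal a * emeasure mu E + ennreal (K * T / a)"
        using a K(1) T by (simp flip: ennreal_mult)
      show "ennreal (q * T) \<le> emeasure mu E"
      proof (cases "emeasure mu E")
        case (real f)
        then have "p0 * (T - (x + 1)) \<le> a * f + K * T / a"
          using main a K(1) T by (simp add: ennreal_le_iff flip: ennreal_mult ennreal_plus)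
        moreover have "K * T / a = p0 * T / 4" using K(1) p0(1) by (simp add: a_def)
        moreover have "p0 * (T / 2) \<le> p0 * (T - (x + 1))" using p0(1) elim by (intro mult_left_mono) auto
        ultimately have "p0 * T / 4 \<le> a * f" by simp
        then have "q * T \<le> f" using a by (simp add: q_def field_simps)
        then show ?thesis using real by (simp add: ennreal_leI)
      qed simp
    qed
  qed
qed

end

text \<open>
  The constants \<open>h\<close> form a Cauchy sequence because they approximate the same function; their convergence
  need not be known beforehand.
\<close>

lemma common_limit:
  fixes f1 f2 :: "real \<Rightarrow> real"
  assumes approx: "\<And>e. 0 < e \<Longrightarrow> \<exists>h. \<forall>\<^sub>F T in at_top. \<bar>f1 T - h\<bar> \<le> e \<and> \<bar>f2 T - h\<bar> \<le> e"
  obtains l where "(f1 \<longlongrightarrow> l) at_top" "(f2 \<longlongrightarrow> l) at_top"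
proof -
  obtain h where h: "\<And>n. \<forall>\<^sub>F T in at_top. \<bar>f1 T - h n\<bar> \<le> inverse (real (Suc n)) \<and> \<bar>f2 T - h n\<bar> \<le> inverse (real (Suc n))"
  proof -
    have "\<forall>n. \<exists>h. \<forall>\<^sub>F T in at_top. \<bar>f1 T - h\<bar> \<le> inverse (real (Suc n)) \<and> \<bar>f2 T - h\<bar> \<le> inverse (real (Suc n))"
      by (intro allI approx) simp
    from choice[OF this] show thesis using that by blast
  qed
  have near: "\<bar>h n - h m\<bar> \<le> inverse (real (Suc n)) + inverse (real (Suc m))" for n m
  proof -
    have "\<forall>\<^sub>F T::real in at_top. \<bar>h n - h m\<bar> \<le> inverse (real (Suc n)) + inverse (real (Suc m))"
      using h[of n] h[of m] by eventually_elim linarith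
    then show ?thesis by simp
  qed
  have inv: "\<exists>N. \<forall>n\<ge>N. inverse (real (Suc n)) < e" if "0 < e" for e :: real
    using order_tendstoD(2)[OF LIMSEQ_inverse_real_of_nat that] by (simp add: eventually_sequentially)
  have "Cauchy h"
    unfolding Cauchy_def dist_real_def
  proof (intro allI impI)
    fix e :: real assume "0 < e"
    then obtain N where N: "\<And>n. N \<le> n \<Longrightarrow> inverse (real (Suc n)) < e / 2" using inv[of "e / 2"] by auto
    have "\<bar>h m - h n\<bar> < e" if "N \<le> m" "N \<le> n" for m n
      using near[of m n] N[OF that(1)] N[OF that(2)] by linarith
    then show "\<exists>N. \<forall>m\<ge>N. \<forall>n\<ge>N. \<bar>h m - h n\<bar> < e" by blast
  qed
  then obtain l where l: "h \<longlonglongrightarrow> l" using Cauchy_convergent_iff convergent_def by blast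
  have hl: "\<bar>h n - l\<bar> \<le> inverse (real (Suc n))" for n
  proof -
    have "(\<lambda>m. \<bar>h n - h m\<bar>) \<longlonglongrightarrow> \<bar>h n - l\<bar>" by (intro tendsto_intros l)
    moreover have "(\<lambda>m. inverse (real (Suc n)) + inverse (real (Suc m))) \<longlonglongrightarrow> inverse (real (Suc n)) + 0"
      by (intro tendsto_intros LIMSEQ_inverse_real_of_nat)
    ultimately show ?thesis
      using near[of n] LIMSEQ_le[of "\<lambda>m. \<bar>h n - h m\<bar>" "\<bar>h n - l\<bar>" "\<lambda>m. inverse (real (Suc n)) + inverse (real (Suc m))"] by auto
  qed
  have lim: "(f \<longlongrightarrow> l) at_top" if f: "\<And>n. \<forall>\<^sub>F T in at_top. \<bar>f T - h n\<bar> \<le> inverse (real (Suc n))" for f :: "real \<Rightarrow> real"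
  proof (rule tendstoI)
    fix e :: real assume "0 < e"
    then obtain n where n: "inverse (real (Suc n)) < e / 2" using inv[of "e / 2"] by auto
    show "\<forall>\<^sub>F T in at_top. dist (f T) l < e"
      using f[of n]
    proof eventually_elim
      case (elim T)
      then show ?case using hl[of n] n unfolding dist_real_def by linarith
    qed
  qed
  have "\<forall>\<^sub>F T in at_top. \<bar>f1 T - h n\<bar> \<le> inverse (real (Suc n))" "\<forall>\<^sub>F T in at_top. \<bar>f2 T - h n\<bar> \<le> inverse (real (Suc n))" for n
    using h[of n] by (auto elim: eventually_mono)
  then show thesis using lim by (intro that) blast+
qed

section \<open>Existence of the limit\<close>

context brown_resnick begin

lemma exceedance_lower:
  assumes x: "0 \<le> x" and \<epsilon>: "0 < \<epsilon>" and \<delta>: "0 < \<delta>"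
  shows "(\<integral>\<^sup>+p. ennreal (threshold x \<delta> (occupation (ramp \<epsilon>) 0 T (\<lambda>s. w s p))) \<partial>mu) \<le> emeasure mu {p\<in>space mu. x < sojourn_time T p}"
proof -
  have "(\<integral>\<^sup>+p. ennreal (threshold x \<delta> (occupation (ramp \<epsilon>) 0 T (\<lambda>s. w s p))) \<partial>mu) \<le>
    (\<integral>\<^sup>+p. indicator {p\<in>space mu. x < sojourn_time T p} p \<partial>mu)"
  proof (rule nn_integral_mono)
    fix p assume p: "p \<in> space mu"
    show "ennreal (threshold x \<delta> (occupation (ramp \<epsilon>) 0 T (\<lambda>s. w s p))) \<le> indicator {p\<in>space mu. x < sojourn_time T p} p"
    proof (cases "x < sojourn_time T p")
      case True
      then show ?thesis using p threshold_bounds(2)[OF x \<delta>] by (simp add: ennreal_le_1)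
    next
      case False
      have "occupation (ramp \<epsilon>) 0 T (\<lambda>s. w s p) \<le> sojourn_time T p"
        unfolding sojourn_time_def using ramp_continuous_bounded ramp_le_indicator[OF \<epsilon>]
        by (intro occupation_mono[OF w_path_meas[OF p]]) auto
      then have "threshold x \<delta> (occupation (ramp \<epsilon>) 0 T (\<lambda>s. w s p)) = 0"
        using False by (intro threshold_eq_0[OF x \<delta>]) auto
      then show ?thesis by simp
    qed
  qed
  also have "\<dots> = emeasure mu {p\<in>space mu. x < sojourn_time T p}"
    by (rule nn_integral_indicator) measurable
  finally show ?thesis .
qed

text \<open>
  Raise the path by \<open>2 * \<epsilon>\<close>. If the sojourn time exceeds \<open>x\<close> and the strip is occupied for at least \<open>\<delta>\<close>, then
  the smoothed occupation time of the raised path is at least \<open>x + \<delta>\<close>, where the threshold equals 1.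
\<close>

lemma exceedance_upper:
  assumes x: "0 \<le> x" and \<epsilon>: "0 < \<epsilon>" and \<delta>: "0 < \<delta>"
  shows "emeasure mu {p\<in>space mu. x < sojourn_time T p} \<le>
    ennreal (exp (2 * \<epsilon>)) * (\<integral>\<^sup>+p. ennreal (threshold x \<delta> (occupation (ramp \<epsilon>) 0 T (\<lambda>s. w s p))) \<partial>mu) +
    emeasure mu {p\<in>space mu. 0 < sojourn_time T p \<and> occupation (bump \<epsilon>) 0 T (\<lambda>s. w s p) < \<delta>}"
proof -
  define \<Phi> where "\<Phi> p = ennreal (threshold x \<delta> (occupation (ramp \<epsilon>) 0 T (\<lambda>s. w s p)))" for p
  define E where "E = {p\<in>space mu. 0 < sojourn_time T p \<and> occupation (bump \<epsilon>) 0 T (\<lambda>s. w s p) < \<delta>}"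
  have Emu: "E \<in> sets mu" unfolding E_def by measurable
  then have Em[measurable]: "E \<in> sets (borel \<Otimes>\<^sub>M M)" by (simp only: sets_mu)
  have "continuous_on UNIV (threshold x \<delta>)"
    using DERIV_isCont[OF DERIV_threshold[OF x \<delta>]] by (intro continuous_at_imp_continuous_on) auto
  then have [measurable]: "threshold x \<delta> \<in> borel_measurable borel" by (rule borel_measurable_continuous_onI)
  have \<Phi>m[measurable]: "\<Phi> \<in> borel_measurable (borel \<Otimes>\<^sub>M M)" unfolding \<Phi>_def by measurable
  have "emeasure mu {p\<in>space mu. x < sojourn_time T p} = (\<integral>\<^sup>+p. indicator {p\<in>space mu. x < sojourn_time T p} p \<partial>mu)"
    by (rule nn_integral_indicator[symmetric]) measurable
  also have "\<dots> \<le> (\<integral>\<^sup>+p. \<Phi> (fst p + 2 * \<epsilon>, snd p) + indicator E p \<partial>mu)"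
  proof (rule nn_integral_mono)
    fix p assume p: "p \<in> space mu"
    show "indicator {p\<in>space mu. x < sojourn_time T p} p \<le> \<Phi> (fst p + 2 * \<epsilon>, snd p) + indicator E p"
    proof (cases "x < sojourn_time T p \<and> p \<notin> E")
      case True
      then have L: "x < sojourn_time T p" and b: "\<delta> \<le> occupation (bump \<epsilon>) 0 T (\<lambda>s. w s p)"
        using x p by (auto simp: E_def)
      have pm: "(\<lambda>s. w s p) \<in> borel_measurable borel" by (rule w_path_meas[OF p])
      have i: "(indicator {0<..} :: real \<Rightarrow> real) \<in> borel_measurable borel" "\<And>u. 0 \<le> indicat_real {0<..} u" "\<And>u. indicat_real {0<..} u \<le> 1" by auto
      have shift: "w s (fst p + 2 * \<epsilon>, snd p) = w s p + 2 * \<epsilon>" for s by (simp add: w_def)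
      have "continuous_on UNIV (\<lambda>s. w s p + 2 * \<epsilon>)" using w_cont[OF p] by (intro continuous_intros)
      then have pm2: "(\<lambda>s. w s p + 2 * \<epsilon>) \<in> borel_measurable borel" by (rule borel_measurable_continuous_onI)
      have "sojourn_time T p + occupation (bump \<epsilon>) 0 T (\<lambda>s. w s p) =
        (\<integral>s. indicator {0..T} s *\<^sub>R indicator {0<..} (w s p) + indicator {0..T} s *\<^sub>R bump \<epsilon> (w s p) \<partial>lborel)"
        unfolding sojourn_time_def occupation_def set_lebesgue_integral_def
        using occupation_set_integrable[OF pm i, of 0 T] occupation_set_integrable[OF pm bump_meas bump_continuous_bounded(2,3), of 0 T]
        by (simp add: set_integrable_def)
      also have "\<dots> \<le> occupation (ramp \<epsilon>) 0 T (\<lambda>s. w s p + 2 * \<epsilon>)"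
        unfolding occupation_def set_lebesgue_integral_def
      proof (rule integral_mono)
        show "indicat_real {0..T} s *\<^sub>R indicat_real {0<..} (w s p) + indicat_real {0..T} s *\<^sub>R bump \<epsilon> (w s p) \<le>
          indicat_real {0..T} s *\<^sub>R ramp \<epsilon> (w s p + 2 * \<epsilon>)" for s
          using indicator_bump_le_ramp[OF \<epsilon>, of "w s p"] by (auto split: split_indicator)
      qed (use occupation_set_integrable[OF pm i, of 0 T] occupation_set_integrable[OF pm bump_meas bump_continuous_bounded(2,3), of 0 T]
           occupation_set_integrable[OF pm2 ramp_meas ramp_continuous_bounded(2,3), of 0 T] in \<open>auto simp: set_integrable_def\<close>)
      finally have "threshold x \<delta> (occupation (ramp \<epsilon>) 0 T (\<lambda>s. w s p + 2 * \<epsilon>)) = 1"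
        using L b by (intro threshold_eq_1[OF x \<delta>]) linarith
      then have "\<Phi> (fst p + 2 * \<epsilon>, snd p) = 1" by (simp add: \<Phi>_def shift)
      then show ?thesis by (auto split: split_indicator)
    qed (auto split: split_indicator)
  qed
  also have "\<dots> = (\<integral>\<^sup>+p. \<Phi> (fst p + 2 * \<epsilon>, snd p) \<partial>mu) + (\<integral>\<^sup>+p. indicator E p \<partial>mu)"
    by (rule nn_integral_add) measurable
  also have "(\<integral>\<^sup>+p. indicator E p \<partial>mu) = emeasure mu E" using Emu by simp
  also have "(\<integral>\<^sup>+p. \<Phi> (fst p + 2 * \<epsilon>, snd p) \<partial>mu) = ennreal (exp (2 * \<epsilon>)) * (\<integral>\<^sup>+p. \<Phi> p \<partial>mu)"
    by (rule nn_integral_mu_translate[OF \<Phi>m])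
  finally show ?thesis unfolding \<Phi>_def E_def .
qed

definition "exceedance x T = emeasure mu {p\<in>space mu. x < sojourn_time T p}"

lemma exceedance_bound:
  assumes "0 \<le> x"
  obtains C0 where "0 < C0" "\<And>T. 1 \<le> T \<Longrightarrow> exceedance x T \<le> ennreal (C0 * T)"
proof -
  obtain C0 where C0: "0 < C0" "\<And>T. 1 \<le> T \<Longrightarrow> emeasure mu {p\<in>space mu. 0 < sojourn_time T p} \<le> ennreal (C0 * T)"
    using sojourn_positive_bound by blast
  have "exceedance x T \<le> emeasure mu {p\<in>space mu. 0 < sojourn_time T p}" for T
    unfolding exceedance_def using assms by (intro emeasure_mono) auto
  then show thesis using C0 by (intro that[of C0]) (auto intro: order_trans)
qed

end

context brown_resnick_pair begin

definition "reference_rate x \<epsilon> \<delta> A = R.window (ramp \<epsilon>) (threshold_slope x \<delta>) (ramp \<epsilon>) A 0"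

text \<open>
  The nested filters record the order of the choices: \<open>\<epsilon>\<close>, \<open>\<delta>\<close>, \<open>A\<close> and finally \<open>T\<close>. The approximating
  constant is built from the reference process alone.
\<close>

lemma exceedance_approx:
  assumes x: "0 \<le> x" and e: "0 < e"
  shows "\<forall>\<^sub>F \<epsilon> in at_right 0. \<forall>\<^sub>F \<delta> in at_right 0. \<forall>\<^sub>F A in at_top. \<forall>\<^sub>F T in at_top.
    \<bar>enn2real (exceedance x T) / T - reference_rate x \<epsilon> \<delta> A\<bar> \<le> e"
proof -
  obtain C0 where C0: "0 < C0" "\<And>T. 1 \<le> T \<Longrightarrow> exceedance x T \<le> ennreal (C0 * T)"
    using exceedance_bound[OF x] by blast
  have "((\<lambda>\<epsilon>. (exp (2 * \<epsilon>) - 1) * C0) \<longlongrightarrow> (exp (2 * 0) - 1) * C0) (at_right 0)"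
    by (intro tendsto_intros)
  then have "\<forall>\<^sub>F \<epsilon> in at_right 0. (exp (2 * \<epsilon>) - 1) * C0 < e / 3"
    using e by (intro order_tendstoD) auto
  then show ?thesis
    using eventually_at_right_less[of 0]
  proof eventually_elim
    case \<epsilon>: (elim \<epsilon>)
    obtain \<delta>0 where \<delta>0: "0 < \<delta>0" "\<And>\<delta>. 0 < \<delta> \<Longrightarrow> \<delta> \<le> \<delta>0 \<Longrightarrow> \<forall>\<^sub>F T in at_top.
      emeasure mu {p\<in>space mu. 0 < sojourn_time T p \<and> occupation (bump \<epsilon>) 0 T (\<lambda>s. w s p) < \<delta>} \<le> ennreal (e / 3 * T)"
      using narrow_excursions_rare[OF \<epsilon>(2), of "e / 3"] e by auto
    have "\<forall>\<^sub>F \<delta> in at_right 0. 0 < \<delta> \<and> \<delta> < \<delta>0"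
      using eventually_at_right_less[of 0] order_tendstoD(2)[OF tendsto_ident_at \<delta>0(1)]
      by eventually_elim auto
    then show ?case
    proof eventually_elim
      case \<delta>: (elim \<delta>)
      have \<delta>p: "0 < \<delta>" using \<delta> by simp
      define I where "I T = (\<integral>\<^sup>+p. ennreal (threshold x \<delta> (occupation (ramp \<epsilon>) 0 T (\<lambda>s. w s p))) \<partial>mu)" for T
      have "\<forall>\<^sub>F A in at_top. \<forall>\<^sub>F T in at_top.
        ennreal (T * (reference_rate x \<epsilon> \<delta> A - e / 3)) \<le> I T \<and> I T \<le> ennreal (T * (reference_rate x \<epsilon> \<delta> A + e / 3))"
        unfolding I_def reference_rate_def
      proof (rule threshold_mean_asymptotics[OF ramp_continuous_bounded ramp_le_indicator[OF \<epsilon>(2)] DERIV_threshold[OF x \<delta>p] _ threshold_slope_continuous_bounded[OF x \<delta>p] threshold_slope_lipschitz[OF x \<delta>p]])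
        show "threshold x \<delta> 0 = 0" using x by (rule threshold_eq_0[OF x \<delta>p])
      qed (use e in auto)
      then show ?case
      proof eventually_elim
        case A: (elim A)
        define h where "h = reference_rate x \<epsilon> \<delta> A"
        have Err: "\<forall>\<^sub>F T in at_top.
          emeasure mu {p\<in>space mu. 0 < sojourn_time T p \<and> occupation (bump \<epsilon>) 0 T (\<lambda>s. w s p) < \<delta>} \<le> ennreal (e / 3 * T)"
          using \<delta> by (intro \<delta>0(2)) auto
        have h0: "0 \<le> h"
          unfolding h_def reference_rate_def R.window_def
          using ramp_continuous_bounded(2) R.window_at_bounds[OF ramp_continuous_bounded threshold_slope_continuous_bounded[OF x \<delta>p] ramp_meas ramp_continuous_bounded(2) ramp_le_indicator[OF \<epsilon>(2)]]
          by (intro Bochner_Integration.integral_nonneg) auto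
        show ?case
          using A Err eventually_ge_at_top[of 1]
        proof eventually_elim
          case T: (elim T)
          define r where "r = emeasure mu {p\<in>space mu. 0 < sojourn_time T p \<and> occupation (bump \<epsilon>) 0 T (\<lambda>s. w s p) < \<delta>}"
          have T0: "0 < T" using T by simp
          have fin: "exceedance x T < \<infinity>" using C0(2)[OF T(3)] by (rule le_less_trans) simp
          then obtain f where f: "exceedance x T = ennreal f" "0 \<le> f" by (cases "exceedance x T") auto
          have lo: "I T \<le> exceedance x T" unfolding I_def exceedance_def by (rule exceedance_lower[OF x \<epsilon>(2) \<delta>p])
          then have "I T < \<infinity>" using fin by (rule le_less_trans)
          then obtain i where i: "I T = ennreal i" "0 \<le> i" by (cases "I T") auto
          have "exceedance x T \<le> ennreal (exp (2 * \<epsilon>)) * I T + r"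
            unfolding I_def exceedance_def r_def by (rule exceedance_upper[OF x \<epsilon>(2) \<delta>p])
          also have "\<dots> \<le> ennreal (exp (2 * \<epsilon>)) * I T + ennreal (e / 3 * T)"
            using T(2) unfolding r_def by (rule add_left_mono)
          also have "\<dots> = ennreal (exp (2 * \<epsilon>) * i + e / 3 * T)"
            using i e T0 by (simp add: ennreal_mult)
          finally have up: "f \<le> exp (2 * \<epsilon>) * i + e / 3 * T"
            unfolding f(1) using i e T0 by (subst (asm) ennreal_le_iff) auto
          have fi: "i \<le> f" using lo f i by (simp add: ennreal_le_iff)
          have fC: "f \<le> C0 * T" using C0(2)[OF T(3)] f C0(1) T0 by (simp add: ennreal_le_iff)
          have i1: "T * (h - e / 3) \<le> i"
          proof (cases "0 \<le> T * (h - e / 3)")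
            case True
            then show ?thesis using T(1) i unfolding h_def[symmetric] by (simp add: ennreal_le_iff)
          qed (use i in linarith)
          have "0 \<le> T * (h + e / 3)" using T0 h0 e by simp
          then have i2: "i \<le> T * (h + e / 3)" using T(1) i unfolding h_def[symmetric] by (simp add: ennreal_le_iff)
          have "(exp (2 * \<epsilon>) - 1) * i \<le> (exp (2 * \<epsilon>) - 1) * (C0 * T)"
            using fi fC \<epsilon>(2) by (intro mult_left_mono) auto
          also have "\<dots> = ((exp (2 * \<epsilon>) - 1) * C0) * T" by simp
          also have "\<dots> \<le> e / 3 * T" using \<epsilon>(1) T0 by (intro mult_right_mono) auto
          finally have i3: "exp (2 * \<epsilon>) * i \<le> i + e / 3 * T" by (simp add: algebra_simps)
          have "f \<le> T * (h + e / 3) + e / 3 * T + e / 3 * T" using up i3 i2 by linarith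
          also have "\<dots> = (h + e) * T" by (simp add: field_simps)
          finally have "f / T \<le> h + e" using T0 by (simp add: divide_le_eq)
          moreover have "(h - e) * T \<le> f"
          proof -
            have "(h - e) * T \<le> (h - e / 3) * T" using T0 e by (intro mult_right_mono) auto
            then show ?thesis using i1 fi by (simp add: mult.commute)
          qed
          then have "h - e \<le> f / T" using T0 by (simp add: le_divide_eq)
          ultimately show ?case unfolding f(1) h_def[symmetric] using f(2) by (simp add: abs_le_iff)
        qed
      qed
    qed
  qed
qed

text \<open>
  The first process and the reference process itself are both approximated by the same constants.
\<close>

theorem exceedance_common_limit:
  assumes x: "0 \<le> x"
  obtains l where "0 < l" "((\<lambda>T. ennreal (1 / T) * exceedance x T) \<longlongrightarrow> ennreal l) at_top"
    "((\<lambda>T. ennreal (1 / T) * R.exceedance x T) \<longlongrightarrow> ennreal l) at_top"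
proof -
  interpret S: brown_resnick_pair N Z' \<kappa> D1 D2 c N Z' D1 D2
    by unfold_locales (rule R_exact)
  define f1 where "f1 T = enn2real (exceedance x T) / T" for T
  define f2 where "f2 T = enn2real (R.exceedance x T) / T" for T
  have "\<exists>h. \<forall>\<^sub>F T in at_top. \<bar>f1 T - h\<bar> \<le> e \<and> \<bar>f2 T - h\<bar> \<le> e" if e: "0 < e" for e
  proof -
    have "\<forall>\<^sub>F \<epsilon> in at_right 0. (\<forall>\<^sub>F \<delta> in at_right 0. \<forall>\<^sub>F A in at_top. \<forall>\<^sub>F T in at_top. \<bar>f1 T - reference_rate x \<epsilon> \<delta> A\<bar> \<le> e) \<and>
       (\<forall>\<^sub>F \<delta> in at_right 0. \<forall>\<^sub>F A in at_top. \<forall>\<^sub>F T in at_top. \<bar>f2 T - reference_rate x \<epsilon> \<delta> A\<bar> \<le> e)"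
      using exceedance_approx[OF x e] S.exceedance_approx[OF x e] unfolding f1_def f2_def reference_rate_def S.reference_rate_def
      by (rule eventually_conj)
    then obtain \<epsilon> where "\<forall>\<^sub>F \<delta> in at_right 0. \<forall>\<^sub>F A in at_top. \<forall>\<^sub>F T in at_top. \<bar>f1 T - reference_rate x \<epsilon> \<delta> A\<bar> \<le> e"
       "\<forall>\<^sub>F \<delta> in at_right 0. \<forall>\<^sub>F A in at_top. \<forall>\<^sub>F T in at_top. \<bar>f2 T - reference_rate x \<epsilon> \<delta> A\<bar> \<le> e"
      by (auto dest: eventually_happens)
    then have "\<forall>\<^sub>F \<delta> in at_right (0::real). (\<forall>\<^sub>F A in at_top. \<forall>\<^sub>F T in at_top. \<bar>f1 T - reference_rate x \<epsilon> \<delta> A\<bar> \<le> e) \<and>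
       (\<forall>\<^sub>F A in at_top. \<forall>\<^sub>F T in at_top. \<bar>f2 T - reference_rate x \<epsilon> \<delta> A\<bar> \<le> e)"
      by (rule eventually_conj)
    then obtain \<delta> where "\<forall>\<^sub>F A in at_top. \<forall>\<^sub>F T in at_top. \<bar>f1 T - reference_rate x \<epsilon> \<delta> A\<bar> \<le> e"
       "\<forall>\<^sub>F A in at_top. \<forall>\<^sub>F T in at_top. \<bar>f2 T - reference_rate x \<epsilon> \<delta> A\<bar> \<le> e"
      by (auto dest: eventually_happens)
    then have "\<forall>\<^sub>F A::real in at_top. (\<forall>\<^sub>F T in at_top. \<bar>f1 T - reference_rate x \<epsilon> \<delta> A\<bar> \<le> e) \<and>
       (\<forall>\<^sub>F T in at_top. \<bar>f2 T - reference_rate x \<epsilon> \<delta> A\<bar> \<le> e)"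
      by (rule eventually_conj)
    then obtain A where "\<forall>\<^sub>F T in at_top. \<bar>f1 T - reference_rate x \<epsilon> \<delta> A\<bar> \<le> e"
       "\<forall>\<^sub>F T in at_top. \<bar>f2 T - reference_rate x \<epsilon> \<delta> A\<bar> \<le> e"
      by (auto dest: eventually_happens)
    then show ?thesis by (intro exI[of _ "reference_rate x \<epsilon> \<delta> A"] eventually_conj)
  qed
  then obtain l where l: "(f1 \<longlongrightarrow> l) at_top" "(f2 \<longlongrightarrow> l) at_top" by (rule common_limit)
  obtain C0 where C0: "0 < C0" "\<And>T. 1 \<le> T \<Longrightarrow> exceedance x T \<le> ennreal (C0 * T)"
    using exceedance_bound[OF x] by blast
  obtain C0' where C0': "0 < C0'" "\<And>T. 1 \<le> T \<Longrightarrow> R.exceedance x T \<le> ennreal (C0' * T)"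
    using R.exceedance_bound[OF x] by blast
  have conv: "((\<lambda>T. ennreal (1 / T) * F T) \<longlongrightarrow> ennreal l) at_top"
    if lim: "((\<lambda>T. enn2real (F T) / T) \<longlongrightarrow> l) at_top" and F: "\<And>T. 1 \<le> T \<Longrightarrow> F T \<le> ennreal (C * T)" for F C
  proof (rule Lim_transform_eventually[OF tendsto_ennrealI[OF lim]])
    show "\<forall>\<^sub>F T in at_top. ennreal (enn2real (F T) / T) = ennreal (1 / T) * F T"
      using eventually_ge_at_top[of 1]
    proof eventually_elim
      case (elim T)
      have "F T < \<infinity>" using F[OF elim] by (rule le_less_trans) simp
      then show ?case using elim by (cases "F T") (auto simp: mult.commute simp flip: ennreal_mult)
    qed
  qed
  obtain q where q: "0 < q" "\<forall>\<^sub>F T in at_top. ennreal (q * T) \<le> exceedance x T"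
    using sojourn_exceedance_lower_bound[OF x] unfolding exceedance_def by blast
  have "\<forall>\<^sub>F T in at_top. q \<le> f1 T"
    using q(2) eventually_ge_at_top[of 1]
  proof eventually_elim
    case (elim T)
    have fin: "exceedance x T < \<infinity>" using C0(2)[OF elim(2)] by (rule le_less_trans) simp
    then obtain f where f: "exceedance x T = ennreal f" "0 \<le> f" by (cases "exceedance x T") auto
    then have "q * T \<le> f" using elim by (simp add: ennreal_le_iff)
    then show ?case using elim f by (simp add: f1_def le_divide_eq)
  qed
  then have "q \<le> l" by (rule tendsto_lowerbound[OF l(1)]) simp
  then show thesis
    using q(1) conv[OF l(1)[unfolded f1_def[abs_def]] C0(2)] conv[OF l(2)[unfolded f2_def[abs_def]] C0'(2)]
    by (intro that[of l]) auto
qed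

end

section \<open>Self-similar processes and fractional Brownian motion\<close>

lemma list_combination_as_sum:
  fixes xs :: "(real \<times> real) list"
  obtains J a where "finite J" "J \<subseteq> {0..}" "\<And>y :: real \<Rightarrow> real. (\<Sum>(b, s)\<leftarrow>xs. b * y (max 0 s)) = (\<Sum>t\<in>J. a t * y t)"
proof -
  have "\<exists>J a. finite J \<and> J \<subseteq> {0..} \<and> (\<forall>y :: real \<Rightarrow> real. (\<Sum>(b, s)\<leftarrow>xs. b * y (max 0 s)) = (\<Sum>t\<in>J. a t * y t))"
  proof (induction xs)
    case (Cons bs xs)
    obtain b s where bs: "bs = (b, s)" by force
    obtain J a where J: "finite J" "J \<subseteq> {0..}" "\<And>y :: real \<Rightarrow> real. (\<Sum>(b, s)\<leftarrow>xs. b * y (max 0 s)) = (\<Sum>t\<in>J. a t * y t)"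
      using Cons.IH by blast
    define u where "u = max 0 s"
    define a' where "a' t = (if t \<in> J then a t else 0) + (if t = u then b else 0)" for t
    have "(\<Sum>(b, s)\<leftarrow>bs # xs. b * y (max 0 s)) = (\<Sum>t\<in>insert u J. a' t * y t)" for y :: "real \<Rightarrow> real"
    proof -
      have "(\<Sum>t\<in>insert u J. a' t * y t) = (\<Sum>t\<in>insert u J. (if t \<in> J then a t else 0) * y t) + (\<Sum>t\<in>insert u J. (if t = u then b else 0) * y t)"
        by (simp only: a'_def distrib_right sum.distrib)
      also have "(\<Sum>t\<in>insert u J. (if t \<in> J then a t else 0) * y t) = (\<Sum>t\<in>J. a t * y t)"
        by (rule sum.mono_neutral_cong_right) (use J in auto)
      also have "(\<Sum>t\<in>insert u J. (if t = u then b else 0) * y t) = (\<Sum>t\<in>{u}. b * y t)"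
        by (rule sum.mono_neutral_cong_right) (use J in auto)
      finally show ?thesis using J(3)[of y] by (simp add: bs u_def)
    qed
    then show ?case using J by (intro exI[of _ "insert u J"] exI[of _ a']) (auto simp: u_def)
  qed auto
  then show thesis using that by blast
qed

lemma centered_normal_cong_AE:
  assumes [measurable]: "X \<in> borel_measurable M" "Y \<in> borel_measurable M" and ae: "AE \<omega> in M. X \<omega> = Y \<omega>"
    and X: "centered_normal M X"
  shows "centered_normal M Y"
  using X unfolding centered_normal_def
proof (elim disjE exE conjE)
  assume "AE \<omega> in M. X \<omega> = 0"
  with ae have "AE \<omega> in M. Y \<omega> = 0" by eventually_elim auto
  then show "(AE \<omega> in M. Y \<omega> = 0) \<or> (\<exists>\<sigma>>0. distributed M lborel Y (normal_density 0 \<sigma>))" ..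
next
  fix \<sigma> :: real assume \<sigma>: "0 < \<sigma>" and D: "distributed M lborel X (normal_density 0 \<sigma>)"
  have "distr M lborel X = distr M lborel Y" by (rule distr_cong_AE) (use ae in auto)
  then have "distributed M lborel Y (normal_density 0 \<sigma>)" using D by (auto simp: distributed_def)
  then show "(AE \<omega> in M. Y \<omega> = 0) \<or> (\<exists>\<sigma>>0. distributed M lborel Y (normal_density 0 \<sigma>))" using \<sigma> by blast
qed

lemma centered_gaussian_square:
  assumes Y: "centered_gaussian_process M Y" and s: "0 \<le> s" and t: "0 \<le> t"
  shows "prob_space.variance M (Y t) = (\<integral>\<omega>. (Y t \<omega>)\<^sup>2 \<partial>M)"
    "incr_variance M Y s t = (\<integral>\<omega>. (Y s \<omega> - Y t \<omega>)\<^sup>2 \<partial>M)"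
    "integrable M (\<lambda>\<omega>. (Y t \<omega>)\<^sup>2)"
proof -
  interpret prob_space M using Y by (simp add: centered_gaussian_process_def)
  have Ym[measurable]: "Y s \<in> borel_measurable M" "Y t \<in> borel_measurable M"
    using Y s t by (auto simp: centered_gaussian_process_def)
  have "centered_normal M (\<lambda>\<omega>. \<Sum>r\<in>{t}. 1 * Y r \<omega>)"
    using Y t unfolding centered_gaussian_process_def by (elim conjE allE[of _ "{t}"] allE[of _ "\<lambda>_. 1"]) auto
  then have Yt: "centered_normal M (Y t)" by simp
  show "variance (Y t) = (\<integral>\<omega>. (Y t \<omega>)\<^sup>2 \<partial>M)" using centered_normal_exp(3)[OF Yt] by simp
  show "integrable M (\<lambda>\<omega>. (Y t \<omega>)\<^sup>2)" by (rule centered_normal_exp(1)[OF Yt]) measurable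
  have "expectation (\<lambda>\<omega>. Y s \<omega> - Y t \<omega>) = 0"
  proof (cases "s = t")
    case False
    have "centered_normal M (\<lambda>\<omega>. \<Sum>r\<in>{s, t}. (if r = s then 1 else - 1) * Y r \<omega>)"
      using Y s t unfolding centered_gaussian_process_def
      by (elim conjE allE[of _ "{s, t}"] allE[of _ "\<lambda>r. if r = s then 1 else - 1"]) auto
    then have "centered_normal M (\<lambda>\<omega>. Y s \<omega> - Y t \<omega>)" using False by simp
    then show ?thesis by (rule centered_normal_exp(3)) measurable
  qed simp
  then show "incr_variance M Y s t = (\<integral>\<omega>. (Y s \<omega> - Y t \<omega>)\<^sup>2 \<partial>M)" by (simp add: incr_variance_def)
qed

text \<open>
  Setting the paths to 0 on a null set that contains all discontinuous ones gives a process with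
  continuous paths only. The sojourn event changes within this null set, so its measure in the
  completion is the measure of a measurable event.
\<close>

theorem berman_mean_as_exceedance:
  fixes Y :: "real \<Rightarrow> 'a \<Rightarrow> real"
  assumes Y: "centered_gaussian_process M Y" and cont: "ae_continuous_paths M Y"
    and var: "\<And>t. 0 \<le> t \<Longrightarrow> prob_space.variance M (Y t) = amp * t powr \<kappa>"
    and pos: "0 < \<kappa>" "0 < C1" "0 < C2" "0 < c"
    and lower: "\<And>s t. 0 \<le> s \<Longrightarrow> 0 \<le> t \<Longrightarrow> C1 * \<bar>s - t\<bar> powr \<kappa> \<le> incr_variance M Y s t"
    and upper: "\<And>s t. 0 \<le> s \<Longrightarrow> 0 \<le> t \<Longrightarrow> incr_variance M Y s t \<le> C2 * \<bar>s - t\<bar> powr \<kappa>"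
    and local: "\<And>s t. 0 \<le> s \<Longrightarrow> 0 \<le> t \<Longrightarrow> ((\<lambda>r. incr_variance M Y (r + s) (r + t)) \<longlongrightarrow> c * \<bar>s - t\<bar> powr \<kappa>) at_top"
  obtains Z where "brown_resnick M Z \<kappa> C1 C2 c"
    "\<And>s t. 0 \<le> s \<Longrightarrow> 0 \<le> t \<Longrightarrow> gaussian_paths.V M Z s t = incr_variance M Y s t"
    "\<And>x T. 0 \<le> T \<Longrightarrow> berman_mean M Y x T = ennreal (1 / T) * brown_resnick.exceedance M Z x T"
proof -
  interpret prob_space M using Y by (simp add: centered_gaussian_process_def)
  have Ym[measurable]: "0 \<le> t \<Longrightarrow> Y t \<in> borel_measurable M" for t
    using Y by (simp add: centered_gaussian_process_def)
  obtain N0 where N0: "{\<omega>\<in>space M. \<not> continuous_on {0..} (\<lambda>t. Y t \<omega>)} \<subseteq> N0" "emeasure M N0 = 0" "N0 \<in> sets M"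
    using cont unfolding ae_continuous_paths_def by (rule AE_E)
  note [measurable] = N0(3)
  define Z where "Z t \<omega> = (if \<omega> \<in> N0 then 0 else Y (max 0 t) \<omega>)" for t \<omega>
  have Zm[measurable]: "Z t \<in> borel_measurable M" for t unfolding Z_def by measurable
  have aeN: "AE \<omega> in M. \<omega> \<notin> N0" by (rule AE_I[of _ _ N0]) (use N0 in auto)
  have ZY: "Z t \<omega> = Y t \<omega>" if "0 \<le> t" "\<omega> \<notin> N0" for t \<omega> using that by (simp add: Z_def)
  have Zcont: "continuous_on UNIV (\<lambda>t. Z t \<omega>)" if \<omega>: "\<omega> \<in> space M" for \<omega>
  proof (cases "\<omega> \<in> N0")
    case False
    then have "continuous_on {0..} (\<lambda>t. Y t \<omega>)" using \<omega> N0(1) by auto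
    then have "continuous_on UNIV (\<lambda>t. Y (max 0 t) \<omega>)"
      by (rule continuous_on_compose2) (auto intro!: continuous_intros)
    then show ?thesis using False by (simp add: Z_def)
  qed (simp add: Z_def)
  have E_eq: "expectation (\<lambda>\<omega>. (Z t \<omega>)\<^sup>2) = amp * (max 0 t) powr \<kappa>" for t
  proof -
    have "expectation (\<lambda>\<omega>. (Z t \<omega>)\<^sup>2) = expectation (\<lambda>\<omega>. (Y (max 0 t) \<omega>)\<^sup>2)"
      by (rule integral_cong_AE) (use aeN in \<open>auto simp: Z_def elim!: eventually_mono\<close>)
    also have "\<dots> = amp * (max 0 t) powr \<kappa>"
      using var[of "max 0 t"] centered_gaussian_square(1)[OF Y, of 0 "max 0 t"] by simp
    finally show ?thesis .
  qed
  have gp: "gaussian_paths M Z"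
  proof (unfold_locales, goal_cases)
    case (1 t) show ?case by (rule Zm)
  next
    case (2 \<omega>) then show ?case by (rule Zcont)
  next
    case (3 xs)
    obtain J a where J: "finite J" "J \<subseteq> {0..}" "\<And>y :: real \<Rightarrow> real. (\<Sum>(b, s)\<leftarrow>xs. b * y (max 0 s)) = (\<Sum>t\<in>J. a t * y t)"
      using list_combination_as_sum by blast
    have Jm[measurable]: "t \<in> J \<Longrightarrow> Y t \<in> borel_measurable M" for t using J(2) by (intro Ym) auto
    show ?case
    proof (rule centered_normal_cong_AE)
      show "centered_normal M (\<lambda>\<omega>. \<Sum>t\<in>J. a t * Y t \<omega>)"
        using Y J by (simp add: centered_gaussian_process_def)
      show "(\<lambda>\<omega>. \<Sum>t\<in>J. a t * Y t \<omega>) \<in> borel_measurable M" by measurable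
      show "(\<lambda>\<omega>. \<Sum>(a, s)\<leftarrow>xs. a * Z s \<omega>) \<in> borel_measurable M"
        by (induction xs) (auto simp: case_prod_beta)
      show "AE \<omega> in M. (\<Sum>t\<in>J. a t * Y t \<omega>) = (\<Sum>(a, s)\<leftarrow>xs. a * Z s \<omega>)"
        using aeN
      proof eventually_elim
        case (elim \<omega>)
        then show ?case using J(3)[of "\<lambda>t. Y t \<omega>"] by (simp add: Z_def)
      qed
    qed
  next
    case 4
    show ?case
      unfolding E_eq using pos by (intro continuous_on_powr' continuous_intros) auto
  qed
  interpret G: gaussian_paths M Z by (rule gp)
  have V_eq: "G.V s t = incr_variance M Y s t" if "0 \<le> s" "0 \<le> t" for s t
  proof -
    have "G.V s t = expectation (\<lambda>\<omega>. (Y s \<omega> - Y t \<omega>)\<^sup>2)"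
      unfolding G.V_def by (rule integral_cong_AE) (use aeN that in \<open>auto simp: Z_def elim!: eventually_mono\<close>)
    then show ?thesis using centered_gaussian_square(2)[OF Y that] by simp
  qed
  interpret B: brown_resnick M Z \<kappa> C1 C2 c
  proof (unfold_locales, goal_cases)
    case (7 s t)
    have "\<forall>\<^sub>F r in at_top. incr_variance M Y (r + s) (r + t) = G.V (r + s) (r + t)"
      using eventually_ge_at_top[of 0] by eventually_elim (use 7 in \<open>simp add: V_eq\<close>)
    then show ?case by (rule Lim_transform_eventually[OF local[OF 7]])
  qed (use pos lower upper V_eq in auto)
  have main: "berman_mean M Y x T = ennreal (1 / T) * B.exceedance x T" if T: "0 \<le> T" for x T
  proof -
    have soj: "sojourn M Y T y \<omega> = B.sojourn_time T (y, \<omega>)" if "\<omega> \<notin> N0" for y \<omega>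
      unfolding sojourn_def B.sojourn_time_def occupation_def set_lebesgue_integral_def
    proof (intro Bochner_Integration.integral_cong refl)
      fix t :: real
      show "indicator {0..T} t *\<^sub>R indicat_real {t. 0 < sqrt 2 * Y t \<omega> - variance (Y t) + y} t =
        indicator {0..T} t *\<^sub>R indicat_real {0<..} (G.w t (y, \<omega>))"
        using that var[of t] E_eq[of t]
        by (cases "0 \<le> t") (auto simp: G.w_def G.W_def G.v_def ZY split: split_indicator)
    qed
    have Sm[measurable]: "{\<omega>\<in>space M. x < B.sojourn_time T (y, \<omega>)} \<in> sets M" for y
    proof -
      have "(\<lambda>\<omega>. B.sojourn_time T (y, \<omega>)) \<in> borel_measurable M"
        by (rule measurable_compose[OF measurable_Pair1' B.sojourn_time_meas]) simp
      then show ?thesis by measurable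
    qed
    have meas_eq: "measure (completion M) {\<omega>\<in>space M. sojourn M Y T y \<omega> > x} = measure M {\<omega>\<in>space M. x < B.sojourn_time T (y, \<omega>)}" for y
    proof -
      let ?A = "{\<omega>\<in>space M. sojourn M Y T y \<omega> > x}" and ?B = "{\<omega>\<in>space M. x < B.sojourn_time T (y, \<omega>)}"
      have "?A \<in> sets (completion M)"
      proof (rule sets_completionI[of _ "?B - N0" "?A \<inter> N0" N0])
        show "?A = (?B - N0) \<union> (?A \<inter> N0)" using soj by auto
        show "N0 \<in> null_sets M" using N0 by auto
      qed auto
      moreover have "?B \<in> sets (completion M)" using Sm by (rule sets_completionI_sets)
      moreover have "AE \<omega> in completion M. \<omega> \<in> ?A \<longleftrightarrow> \<omega> \<in> ?B"
      proof (rule AE_completion)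
        show "AE \<omega> in M. \<omega> \<in> ?A \<longleftrightarrow> \<omega> \<in> ?B"
          using aeN by eventually_elim (simp add: soj)
      qed
      ultimately have "measure (completion M) ?A = measure (completion M) ?B"
        by (intro measure_eq_AE)
      also have "\<dots> = measure M ?B" using Sm by (rule measure_completion)
      finally show ?thesis .
    qed
    have Em: "{p\<in>space G.mu. x < B.sojourn_time T p} \<in> sets (lborel \<Otimes>\<^sub>M M)"
    proof -
      have "{p\<in>space G.mu. x < B.sojourn_time T p} \<in> sets G.mu" by measurable
      then show ?thesis by (simp add: G.mu_def)
    qed
    interpret P: pair_sigma_finite lborel M ..
    have "B.exceedance x T = (\<integral>\<^sup>+p. ennreal (exp (- fst p)) * indicator {p\<in>space G.mu. x < B.sojourn_time T p} p \<partial>(lborel \<Otimes>\<^sub>M M))"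
      unfolding B.exceedance_def using Em by (subst (1) G.mu_def) (rule emeasure_density, auto)
    also have "\<dots> = (\<integral>\<^sup>+y. \<integral>\<^sup>+\<omega>. ennreal (exp (- fst (y, \<omega>))) * indicator {p\<in>space G.mu. x < B.sojourn_time T p} (y, \<omega>) \<partial>M \<partial>lborel)"
      by (rule nn_integral_fst[symmetric]) (use Em in measurable)
    also have "\<dots> = (\<integral>\<^sup>+y. ennreal (measure (completion M) {\<omega>\<in>space M. sojourn M Y T y \<omega> > x} * exp (- y)) \<partial>lborel)"
    proof (rule nn_integral_cong)
      fix y :: real
      have "(\<integral>\<^sup>+\<omega>. ennreal (exp (- fst (y, \<omega>))) * indicator {p\<in>space G.mu. x < B.sojourn_time T p} (y, \<omega>) \<partial>M) =
        (\<integral>\<^sup>+\<omega>. ennreal (exp (- y)) * indicator {\<omega>\<in>space M. x < B.sojourn_time T (y, \<omega>)} \<omega> \<partial>M)"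
        by (intro nn_integral_cong) (auto split: split_indicator)
      also have "\<dots> = ennreal (exp (- y)) * emeasure M {\<omega>\<in>space M. x < B.sojourn_time T (y, \<omega>)}"
        by (rule nn_integral_cmult_indicator) measurable
      finally show "(\<integral>\<^sup>+\<omega>. ennreal (exp (- fst (y, \<omega>))) * indicator {p\<in>space G.mu. x < B.sojourn_time T p} (y, \<omega>) \<partial>M) =
        ennreal (measure (completion M) {\<omega>\<in>space M. sojourn M Y T y \<omega> > x} * exp (- y))"
        by (simp add: meas_eq emeasure_eq_measure ennreal_mult mult.commute)
    qed
    finally show ?thesis by (simp add: berman_mean_def)
  qed
  show thesis by (rule that[OF B.brown_resnick_axioms V_eq main])
qed

lemma self_similar_increments:
  assumes Y: "centered_gaussian_process M Y" and ss: "self_similar M Y (\<kappa> / 2)"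
    and l: "0 < l" and st: "0 \<le> s" "0 \<le> t"
  shows "(\<integral>\<omega>. (Y (l * s) \<omega> - Y (l * t) \<omega>)\<^sup>2 \<partial>M) = l powr \<kappa> * (\<integral>\<omega>. (Y s \<omega> - Y t \<omega>)\<^sup>2 \<partial>M)"
    and "(\<integral>\<omega>. (Y (l * t) \<omega>)\<^sup>2 \<partial>M) = l powr \<kappa> * (\<integral>\<omega>. (Y t \<omega>)\<^sup>2 \<partial>M)"
proof -
  have Ym[measurable]: "0 \<le> t \<Longrightarrow> Y t \<in> borel_measurable M" for t
    using Y by (simp add: centered_gaussian_process_def)
  have law: "process_law M (\<lambda>t. Y (l * t)) = process_law M (\<lambda>t \<omega>. l powr (\<kappa> / 2) * Y t \<omega>)"
    using ss l by (simp add: self_similar_def)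
  have expect: "(\<integral>\<omega>. F (\<lambda>t\<in>{0..}. X t \<omega>) \<partial>M) = integral\<^sup>L (process_law M X) F"
    if X: "\<And>t. 0 \<le> t \<Longrightarrow> X t \<in> borel_measurable M" and F: "F \<in> borel_measurable (\<Pi>\<^sub>M t\<in>{0..}. borel)"
    for X :: "real \<Rightarrow> 'a \<Rightarrow> real" and F :: "(real \<Rightarrow> real) \<Rightarrow> real"
    unfolding process_law_def
  proof (rule integral_distr[symmetric, OF _ F])
    show "(\<lambda>\<omega>. \<lambda>t\<in>{0..}. X t \<omega>) \<in> measurable M (\<Pi>\<^sub>M t\<in>{0..}. borel)"
      by (rule measurable_restrict) (use X in auto)
  qed
  have lm: "\<And>t. 0 \<le> t \<Longrightarrow> Y (l * t) \<in> borel_measurable M" using l by (intro Ym) auto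
  have lm': "\<And>t. 0 \<le> t \<Longrightarrow> (\<lambda>\<omega>. l powr (\<kappa> / 2) * Y t \<omega>) \<in> borel_measurable M" by measurable
  have sq: "(l powr (\<kappa> / 2))\<^sup>2 = l powr \<kappa>" using l by (simp add: power2_eq_square flip: powr_add)
  have tr: "(\<integral>\<omega>. F (\<lambda>t\<in>{0..}. Y (l * t) \<omega>) \<partial>M) = (\<integral>\<omega>. F (\<lambda>t\<in>{0..}. l powr (\<kappa> / 2) * Y t \<omega>) \<partial>M)"
    if F: "F \<in> borel_measurable (\<Pi>\<^sub>M t\<in>{0..}. borel)" for F :: "(real \<Rightarrow> real) \<Rightarrow> real"
    using expect[of "\<lambda>t. Y (l * t)" F, OF lm F] expect[of "\<lambda>t \<omega>. l powr (\<kappa> / 2) * Y t \<omega>" F, OF lm' F] law by simp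
  have c[measurable]: "(\<lambda>f. f s) \<in> borel_measurable (\<Pi>\<^sub>M t\<in>{0..}. borel)" "(\<lambda>f. f t) \<in> borel_measurable (\<Pi>\<^sub>M t\<in>{0..}. borel)"
    using st by (auto intro!: measurable_component_singleton)
  have "(\<integral>\<omega>. (Y (l * s) \<omega> - Y (l * t) \<omega>)\<^sup>2 \<partial>M) = (\<integral>\<omega>. (l powr (\<kappa> / 2) * Y s \<omega> - l powr (\<kappa> / 2) * Y t \<omega>)\<^sup>2 \<partial>M)"
    using tr[of "\<lambda>f. (f s - f t)\<^sup>2"] st by simp
  also have "\<dots> = (\<integral>\<omega>. l powr \<kappa> * (Y s \<omega> - Y t \<omega>)\<^sup>2 \<partial>M)"
    by (simp add: sq power_mult_distrib flip: right_diff_distrib)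
  finally show "(\<integral>\<omega>. (Y (l * s) \<omega> - Y (l * t) \<omega>)\<^sup>2 \<partial>M) = l powr \<kappa> * (\<integral>\<omega>. (Y s \<omega> - Y t \<omega>)\<^sup>2 \<partial>M)" by simp
  have "(\<integral>\<omega>. (Y (l * t) \<omega>)\<^sup>2 \<partial>M) = (\<integral>\<omega>. (l powr (\<kappa> / 2) * Y t \<omega>)\<^sup>2 \<partial>M)"
    using tr[of "\<lambda>f. (f t)\<^sup>2"] st by simp
  then show "(\<integral>\<omega>. (Y (l * t) \<omega>)\<^sup>2 \<partial>M) = l powr \<kappa> * (\<integral>\<omega>. (Y t \<omega>)\<^sup>2 \<partial>M)"
    by (simp add: sq power_mult_distrib)
qed

text \<open>
  By self-similarity it is enough to bound the variogram between \<open>t < 1\<close> and 1. Near 1 this is (S2). Away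
  from 1 the Cauchy-Schwarz inequality bounds the covariance by \<open>t powr (\<kappa> / 2)\<close>, and the variogram
  lies between \<open>(1 - t powr (\<kappa> / 2))\<^sup>2\<close> and \<open>(1 + t powr (\<kappa> / 2))\<^sup>2\<close>. The limit at late times is (S2) again,
  as \<open>r + s = (r + t) * (1 - h)\<close> with \<open>h = (t - s) / (r + t)\<close>.
\<close>

lemma S_class_variogram:
  assumes \<kappa>: "0 < \<kappa>" and c: "0 < c" and S: "S_class M Y \<kappa> \<kappa> c"
  shows "\<And>t. 0 \<le> t \<Longrightarrow> prob_space.variance M (Y t) = t powr \<kappa>"
    and "\<exists>C1>0. \<exists>C2>0. \<forall>s\<ge>0. \<forall>t\<ge>0. C1 * \<bar>s - t\<bar> powr \<kappa> \<le> incr_variance M Y s t \<and> incr_variance M Y s t \<le> C2 * \<bar>s - t\<bar> powr \<kappa>"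
    and "\<And>s t. 0 \<le> s \<Longrightarrow> 0 \<le> t \<Longrightarrow> ((\<lambda>r. incr_variance M Y (r + s) (r + t)) \<longlongrightarrow> c * \<bar>s - t\<bar> powr \<kappa>) at_top"
proof -
  have Y: "centered_gaussian_process M Y" and ss: "self_similar M Y (\<kappa> / 2)" and v1: "prob_space.variance M (Y 1) = 1"
    and loc: "(\<lambda>h. incr_variance M Y (1 - h) 1) \<sim>[at 0] (\<lambda>h. c * \<bar>h\<bar> powr \<kappa>)"
    using S by (auto simp: S_class_def)
  interpret prob_space M using Y by (simp add: centered_gaussian_process_def)
  have Ym[measurable]: "0 \<le> t \<Longrightarrow> Y t \<in> borel_measurable M" for t
    using Y by (simp add: centered_gaussian_process_def)
  have var_E: "variance (Y t) = expectation (\<lambda>\<omega>. (Y t \<omega>)\<^sup>2)" if "0 \<le> t" for t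
    by (rule centered_gaussian_square(1)[OF Y order_refl that])
  have incr_E: "incr_variance M Y s t = expectation (\<lambda>\<omega>. (Y s \<omega> - Y t \<omega>)\<^sup>2)" if "0 \<le> s" "0 \<le> t" for s t
    by (rule centered_gaussian_square(2)[OF Y that])
  have sqi: "integrable M (\<lambda>\<omega>. (Y t \<omega>)\<^sup>2)" if "0 \<le> t" for t
    by (rule centered_gaussian_square(3)[OF Y order_refl that])
  have E_sq: "expectation (\<lambda>\<omega>. (Y t \<omega>)\<^sup>2) = t powr \<kappa>" if t: "0 \<le> t" for t
  proof (cases "t = 0")
    case True
    have "expectation (\<lambda>\<omega>. (Y (2 * 0) \<omega>)\<^sup>2) = 2 powr \<kappa> * expectation (\<lambda>\<omega>. (Y 0 \<omega>)\<^sup>2)"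
      by (rule self_similar_increments(2)[OF Y ss]) auto
    moreover have "2 powr \<kappa> \<noteq> 1" using \<kappa> by simp
    ultimately show ?thesis using True by simp
  next
    case False
    then have "expectation (\<lambda>\<omega>. (Y (t * 1) \<omega>)\<^sup>2) = t powr \<kappa> * expectation (\<lambda>\<omega>. (Y 1 \<omega>)\<^sup>2)"
      using t by (intro self_similar_increments(2)[OF Y ss]) auto
    then show ?thesis using v1 var_E[of 1] by simp
  qed
  show "variance (Y t) = t powr \<kappa>" if "0 \<le> t" for t using var_E[OF that] E_sq[OF that] by simp
  have sym: "incr_variance M Y s t = incr_variance M Y t s" if "0 \<le> s" "0 \<le> t" for s t
    using incr_E[OF that] incr_E[OF that(2,1)] by (simp add: power2_commute)
  have scale: "incr_variance M Y s t = t powr \<kappa> * incr_variance M Y (s / t) 1" if st: "0 \<le> s" "0 < t" for s t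
    using self_similar_increments(1)[OF Y ss st(2), of "s / t" 1] incr_E[of s t] incr_E[of "s / t" 1] st by simp
  have prod_i: "integrable M (\<lambda>\<omega>. Y s \<omega> * Y t \<omega>)" if "0 \<le> s" "0 \<le> t" for s t
  proof (rule Bochner_Integration.integrable_bound[of M "\<lambda>\<omega>. (Y s \<omega>)\<^sup>2 + (Y t \<omega>)\<^sup>2"])
    have "\<bar>a * b\<bar> \<le> \<bar>a\<^sup>2 + b\<^sup>2\<bar>" for a b :: real
    proof -
      have "0 \<le> (\<bar>a\<bar> - \<bar>b\<bar>)\<^sup>2" "0 \<le> \<bar>a * b\<bar>" by auto
      moreover have "(\<bar>a\<bar> - \<bar>b\<bar>)\<^sup>2 = a\<^sup>2 + b\<^sup>2 - 2 * \<bar>a * b\<bar>" by (simp add: power2_diff abs_mult)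
      ultimately show ?thesis by linarith
    qed
    then show "AE \<omega> in M. norm (Y s \<omega> * Y t \<omega>) \<le> norm ((Y s \<omega>)\<^sup>2 + (Y t \<omega>)\<^sup>2)" by simp
  qed (use that sqi in auto)
  have incr_cov: "incr_variance M Y t 1 = t powr \<kappa> + 1 - 2 * expectation (\<lambda>\<omega>. Y t \<omega> * Y 1 \<omega>)" if t: "0 \<le> t" for t
    using t sqi prod_i E_sq[OF t] E_sq[of 1] by (simp add: incr_E power2_diff mult.assoc)
  have cov_le: "\<bar>expectation (\<lambda>\<omega>. Y t \<omega> * Y 1 \<omega>)\<bar> \<le> t powr (\<kappa> / 2)" if t: "0 \<le> t" for t
  proof (cases "t = 0")
    case True
    have "AE \<omega> in M. (Y 0 \<omega>)\<^sup>2 = 0"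
      using E_sq[of 0] sqi[of 0] by (subst integral_nonneg_eq_0_iff_AE[symmetric]) auto
    then have "expectation (\<lambda>\<omega>. Y 0 \<omega> * Y 1 \<omega>) = expectation (\<lambda>\<omega>. 0)"
      by (intro integral_cong_AE) auto
    then show ?thesis using True by simp
  next
    case False
    define a where "a = t powr (\<kappa> / 2)"
    have a: "0 < a" "a * a = t powr \<kappa>" using False t by (auto simp: a_def simp flip: powr_add)
    have "0 \<le> expectation (\<lambda>\<omega>. (a * Y 1 \<omega> + \<sigma> * Y t \<omega>)\<^sup>2)" for \<sigma> by simp
    moreover have "expectation (\<lambda>\<omega>. (a * Y 1 \<omega> + \<sigma> * Y t \<omega>)\<^sup>2) = a\<^sup>2 + \<sigma>\<^sup>2 * t powr \<kappa> + 2 * a * \<sigma> * expectation (\<lambda>\<omega>. Y t \<omega> * Y 1 \<omega>)" for \<sigma>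
    proof -
      have "expectation (\<lambda>\<omega>. (a * Y 1 \<omega> + \<sigma> * Y t \<omega>)\<^sup>2) =
        expectation (\<lambda>\<omega>. a\<^sup>2 * (Y 1 \<omega>)\<^sup>2 + \<sigma>\<^sup>2 * (Y t \<omega>)\<^sup>2 + 2 * a * \<sigma> * (Y t \<omega> * Y 1 \<omega>))"
        by (intro Bochner_Integration.integral_cong refl) (simp add: power2_sum power_mult_distrib)
      also have "\<dots> = a\<^sup>2 + \<sigma>\<^sup>2 * t powr \<kappa> + 2 * a * \<sigma> * expectation (\<lambda>\<omega>. Y t \<omega> * Y 1 \<omega>)"
        using t sqi prod_i[of t 1] E_sq[OF t] E_sq[of 1] by simp
      finally show ?thesis .
    qed
    ultimately have key: "0 \<le> a\<^sup>2 + \<sigma>\<^sup>2 * t powr \<kappa> + 2 * a * \<sigma> * expectation (\<lambda>\<omega>. Y t \<omega> * Y 1 \<omega>)" for \<sigma> by metis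
    have "0 \<le> 2 * a * (a + expectation (\<lambda>\<omega>. Y t \<omega> * Y 1 \<omega>))" "0 \<le> 2 * a * (a - expectation (\<lambda>\<omega>. Y t \<omega> * Y 1 \<omega>))"
      using key[of 1] key[of "-1"] a(2) by (simp_all add: power2_eq_square algebra_simps)
    then show ?thesis using a(1) by (simp add: zero_le_mult_iff a_def[symmetric] abs_le_iff)
  qed
  have ratio: "((\<lambda>h. incr_variance M Y (1 - h) 1 / (c * \<bar>h\<bar> powr \<kappa>)) \<longlongrightarrow> 1) (at 0)"
  proof (rule asymp_equivD_strong[OF loc])
    show "\<forall>\<^sub>F h in at 0. incr_variance M Y (1 - h) 1 \<noteq> 0 \<or> c * \<bar>h\<bar> powr \<kappa> \<noteq> 0"
      using c by (auto simp: eventually_at intro!: exI[of _ 1])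
  qed
  have "\<forall>\<^sub>F h in at 0. \<bar>incr_variance M Y (1 - h) 1 / (c * \<bar>h\<bar> powr \<kappa>) - 1\<bar> < 1/2"
    using tendstoD[OF ratio, of "1/2"] by (simp add: dist_real_def)
  then obtain \<eta>0 where \<eta>0: "0 < \<eta>0" "\<And>h. h \<noteq> 0 \<Longrightarrow> \<bar>h\<bar> < \<eta>0 \<Longrightarrow> \<bar>incr_variance M Y (1 - h) 1 / (c * \<bar>h\<bar> powr \<kappa>) - 1\<bar> < 1/2"
    unfolding eventually_at by (auto simp: dist_real_def)
  define \<eta> where "\<eta> = min (1/2) \<eta>0"
  have \<eta>: "0 < \<eta>" "\<eta> < 1" "\<eta> \<le> \<eta>0" using \<eta>0 by (auto simp: \<eta>_def)
  define m where "m = (1 - (1 - \<eta>) powr (\<kappa> / 2))\<^sup>2"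
  have "(1 - \<eta>) powr (\<kappa> / 2) < 1" using powr_less_mono2[of "\<kappa> / 2" "1 - \<eta>" 1] \<eta> \<kappa> by simp
  then have m: "0 < m" by (simp add: m_def)
  define C1 where "C1 = min (c / 2) m"
  define C2 where "C2 = max (2 * c) (4 / \<eta> powr \<kappa>)"
  have C: "0 < C1" "0 < C2" using c m by (auto simp: C1_def C2_def)
  have unit: "C1 * (1 - t) powr \<kappa> \<le> incr_variance M Y t 1 \<and> incr_variance M Y t 1 \<le> C2 * (1 - t) powr \<kappa>"
    if t: "0 \<le> t" "t < 1" for t
  proof (cases "1 - t < \<eta>")
    case True
    define h where "h = 1 - t"
    have h: "0 < h" "\<bar>h\<bar> < \<eta>0" "h < \<eta>" using True t \<eta> by (auto simp: h_def)
    have "\<bar>incr_variance M Y (1 - h) 1 / (c * \<bar>h\<bar> powr \<kappa>) - 1\<bar> < 1/2" using h by (intro \<eta>0(2)) auto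
    moreover have "1 - h = t" "\<bar>h\<bar> = h" using h by (auto simp: h_def)
    ultimately have "\<bar>incr_variance M Y t 1 / (c * h powr \<kappa>) - 1\<bar> < 1/2" by (simp only:)
    then have r: "1/2 < incr_variance M Y t 1 / (c * h powr \<kappa>)" "incr_variance M Y t 1 / (c * h powr \<kappa>) < 2"
      by linarith+
    have ch: "0 < c * h powr \<kappa>" using c h by simp
    have "1/2 * (c * h powr \<kappa>) < incr_variance M Y t 1" "incr_variance M Y t 1 < 2 * (c * h powr \<kappa>)"
      using r ch by (simp_all only: less_divide_eq divide_less_eq if_True)
    moreover have "C1 * h powr \<kappa> \<le> c / 2 * h powr \<kappa>" "2 * c * h powr \<kappa> \<le> C2 * h powr \<kappa>"
      unfolding C1_def C2_def by (intro mult_right_mono min.cobounded1 max.cobounded1 powr_ge_zero)+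
    ultimately show ?thesis by (simp add: h_def)
  next
    case False
    define a where "a = t powr (\<kappa> / 2)"
    have a: "0 \<le> a" "a\<^sup>2 = t powr \<kappa>" "a \<le> 1"
      using t \<kappa> by (auto simp: a_def power2_eq_square powr_le1 simp flip: powr_add)
    have am: "a \<le> (1 - \<eta>) powr (\<kappa> / 2)" unfolding a_def using t False \<kappa> by (intro powr_mono2) auto
    have "m \<le> (1 - a)\<^sup>2"
      unfolding m_def using am \<open>(1 - \<eta>) powr (\<kappa> / 2) < 1\<close> by (intro power_mono) auto
    also have "(1 - a)\<^sup>2 \<le> incr_variance M Y t 1"
      using incr_cov[OF t(1)] cov_le[OF t(1)] a(2) by (simp add: a_def[symmetric] power2_diff abs_le_iff)
    finally have lo: "m \<le> incr_variance M Y t 1" .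
    have pw: "(1 - t) powr \<kappa> \<le> 1" "\<eta> powr \<kappa> \<le> (1 - t) powr \<kappa>" using t False \<kappa> \<eta> by (auto intro: powr_le1 powr_mono2)
    have "C1 * (1 - t) powr \<kappa> \<le> m * 1" using m pw by (intro mult_mono) (auto simp: C1_def)
    moreover have "incr_variance M Y t 1 \<le> C2 * (1 - t) powr \<kappa>"
    proof -
      have "incr_variance M Y t 1 \<le> (1 + a)\<^sup>2"
        using incr_cov[OF t(1)] cov_le[OF t(1)] a(2) by (simp add: a_def[symmetric] power2_sum abs_le_iff)
      also have "\<dots> \<le> 2\<^sup>2" using a by (intro power_mono) auto
      also have "\<dots> = 4 / \<eta> powr \<kappa> * \<eta> powr \<kappa>" using \<eta> by simp
      also have "\<dots> \<le> C2 * (1 - t) powr \<kappa>" using C pw by (intro mult_mono) (auto simp: C2_def)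
      finally show ?thesis .
    qed
    ultimately show ?thesis using lo by auto
  qed
  have ordered: "C1 * (t - s) powr \<kappa> \<le> incr_variance M Y s t \<and> incr_variance M Y s t \<le> C2 * (t - s) powr \<kappa>"
    if st: "0 \<le> s" "s < t" for s t
  proof -
    have t: "0 < t" using st by simp
    have "(t - s) powr \<kappa> = t powr \<kappa> * (1 - s / t) powr \<kappa>"
    proof -
      have "t - s = t * (1 - s / t)" using t by (simp add: field_simps)
      moreover have "0 \<le> 1 - s / t" using st t by simp
      ultimately show ?thesis using t by (simp add: powr_mult)
    qed
    moreover have "C1 * (1 - s / t) powr \<kappa> \<le> incr_variance M Y (s / t) 1" "incr_variance M Y (s / t) 1 \<le> C2 * (1 - s / t) powr \<kappa>"
      using unit[of "s / t"] st t by auto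
    ultimately show ?thesis
      using scale[OF st(1) t] mult_left_mono[of "C1 * (1 - s / t) powr \<kappa>" "incr_variance M Y (s / t) 1" "t powr \<kappa>"]
        mult_left_mono[of "incr_variance M Y (s / t) 1" "C2 * (1 - s / t) powr \<kappa>" "t powr \<kappa>"]
      by (simp only: powr_ge_zero mult.left_commute simp_thms)
  qed
  have all: "C1 * \<bar>s - t\<bar> powr \<kappa> \<le> incr_variance M Y s t \<and> incr_variance M Y s t \<le> C2 * \<bar>s - t\<bar> powr \<kappa>"
    if st: "0 \<le> s" "0 \<le> t" for s t
  proof (cases s t rule: linorder_cases)
    case less
    then show ?thesis using ordered[OF st(1) less] by (simp add: abs_if)
  next
    case equal
    then show ?thesis using incr_E[OF st] by simp
  next
    case greater
    then show ?thesis using ordered[OF st(2) greater] sym[OF st] by (simp add: abs_if)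
  qed
  then show "\<exists>C1>0. \<exists>C2>0. \<forall>s\<ge>0. \<forall>t\<ge>0. C1 * \<bar>s - t\<bar> powr \<kappa> \<le> incr_variance M Y s t \<and> incr_variance M Y s t \<le> C2 * \<bar>s - t\<bar> powr \<kappa>"
    using C by blast
  have lim: "((\<lambda>r. incr_variance M Y (r + s) (r + t)) \<longlongrightarrow> c * (t - s) powr \<kappa>) at_top" if st: "0 \<le> s" "s < t" for s t
  proof -
    have "((\<lambda>r::real. (t - s) / (r + t)) \<longlongrightarrow> 0) at_top" by real_asymp
    moreover have "\<forall>\<^sub>F r::real in at_top. (t - s) / (r + t) \<noteq> 0"
      using eventually_ge_at_top[of 0] by eventually_elim (use st in simp)
    ultimately have "filterlim (\<lambda>r. (t - s) / (r + t)) (at 0) at_top" by (simp add: filterlim_at)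
    from filterlim_compose[OF ratio this]
    have "((\<lambda>r. incr_variance M Y (1 - (t - s) / (r + t)) 1 / (c * \<bar>(t - s) / (r + t)\<bar> powr \<kappa>)) \<longlongrightarrow> 1) at_top" .
    from tendsto_mult[OF this tendsto_const[of "c * (t - s) powr \<kappa>"]]
    have "((\<lambda>r. incr_variance M Y (1 - (t - s) / (r + t)) 1 / (c * \<bar>(t - s) / (r + t)\<bar> powr \<kappa>) * (c * (t - s) powr \<kappa>)) \<longlongrightarrow> c * (t - s) powr \<kappa>) at_top"
      by simp
    then show ?thesis
    proof (rule Lim_transform_eventually)
      show "\<forall>\<^sub>F r in at_top. incr_variance M Y (1 - (t - s) / (r + t)) 1 / (c * \<bar>(t - s) / (r + t)\<bar> powr \<kappa>) * (c * (t - s) powr \<kappa>) =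
        incr_variance M Y (r + s) (r + t)"
        using eventually_ge_at_top[of 0]
      proof eventually_elim
        case (elim r)
        have rt: "0 < r + t" "0 \<le> r + s" "0 < t - s" using elim st by auto
        have "1 - (t - s) / (r + t) = (r + s) / (r + t)" using rt by (simp add: field_simps)
        moreover have "\<bar>(t - s) / (r + t)\<bar> powr \<kappa> = (t - s) powr \<kappa> / (r + t) powr \<kappa>"
          using rt by (simp add: powr_divide)
        ultimately show ?case using scale[OF rt(2,1)] rt c by simp
      qed
    qed
  qed
  show "((\<lambda>r. incr_variance M Y (r + s) (r + t)) \<longlongrightarrow> c * \<bar>s - t\<bar> powr \<kappa>) at_top" if st: "0 \<le> s" "0 \<le> t" for s t
  proof (cases s t rule: linorder_cases)
    case less
    then show ?thesis using lim[OF st(1) less] by (simp add: abs_if)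
  next
    case equal
    then show ?thesis by (simp add: incr_variance_def)
  next
    case greater
    have "((\<lambda>r. incr_variance M Y (r + t) (r + s)) \<longlongrightarrow> c * \<bar>s - t\<bar> powr \<kappa>) at_top"
      using lim[OF st(2) greater] greater by (simp add: abs_if)
    then show ?thesis
      by (rule Lim_transform_eventually)
         (use eventually_ge_at_top[of 0] in \<open>eventually_elim, use st sym in auto\<close>)
  qed
qed

text \<open>
  Substituting \<open>t = l * u\<close> in the time integral turns the sojourn time of the dilated process into \<open>1 / l\<close>
  times a sojourn time of the original one.
\<close>

lemma fBm_dilation:
  assumes \<kappa>: "0 < \<kappa>" and l: "0 < l" and B: "standard_fBm N B \<kappa>"
  shows "centered_gaussian_process N (\<lambda>t. B (l * t))" "ae_continuous_paths N (\<lambda>t. B (l * t))"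
    "\<And>t. 0 \<le> t \<Longrightarrow> prob_space.variance N (B (l * t)) = l powr \<kappa> * t powr \<kappa>"
    "\<And>s t. 0 \<le> s \<Longrightarrow> 0 \<le> t \<Longrightarrow> incr_variance N (\<lambda>t. B (l * t)) s t = l powr \<kappa> * \<bar>s - t\<bar> powr \<kappa>"
    "\<And>x T. 0 < T \<Longrightarrow> berman_mean N (\<lambda>t. B (l * t)) x T = ennreal l * berman_mean N B (l * x) (l * T)"
proof -
  have G: "centered_gaussian_process N B" and C: "ae_continuous_paths N B" and B0: "AE \<omega> in N. B 0 \<omega> = 0"
    and I: "\<And>t s. 0 \<le> t \<Longrightarrow> 0 \<le> s \<Longrightarrow> incr_variance N B t s = \<bar>t - s\<bar> powr \<kappa>"
    using B by (auto simp: standard_fBm_def)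
  interpret prob_space N using G by (simp add: centered_gaussian_process_def)
  have Bm[measurable]: "0 \<le> t \<Longrightarrow> B t \<in> borel_measurable N" for t
    using G by (simp add: centered_gaussian_process_def)
  show "centered_gaussian_process N (\<lambda>t. B (l * t))"
    unfolding centered_gaussian_process_def
  proof (intro conjI allI impI)
    show "prob_space N" by unfold_locales
    show "B (l * t) \<in> borel_measurable N" if "0 \<le> t" for t using that l by (intro Bm) auto
    fix J :: "real set" and a :: "real \<Rightarrow> real" assume J: "finite J \<and> J \<subseteq> {0..}"
    have inj: "inj_on (\<lambda>t. l * t) J" using l by (auto simp: inj_on_def)
    have "centered_normal N (\<lambda>\<omega>. \<Sum>t\<in>(\<lambda>t. l * t) ` J. a (t / l) * B t \<omega>)"
      using G J l unfolding centered_gaussian_process_def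
      by (elim conjE allE[of _ "(\<lambda>t. l * t) ` J"] allE[of _ "\<lambda>t. a (t / l)"]) auto
    then show "centered_normal N (\<lambda>\<omega>. \<Sum>t\<in>J. a t * B (l * t) \<omega>)"
      using l by (simp add: sum.reindex[OF inj])
  qed
  show "ae_continuous_paths N (\<lambda>t. B (l * t))"
    using C unfolding ae_continuous_paths_def
  proof eventually_elim
    case (elim \<omega>)
    show ?case by (rule continuous_on_compose2[OF elim]) (use l in \<open>auto intro!: continuous_intros\<close>)
  qed
  show "variance (B (l * t)) = l powr \<kappa> * t powr \<kappa>" if t: "0 \<le> t" for t
  proof -
    have lt: "0 \<le> l * t" using l t by simp
    have "variance (B (l * t)) = expectation (\<lambda>\<omega>. (B (l * t) \<omega>)\<^sup>2)"
      by (rule centered_gaussian_square(1)[OF G order_refl lt])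
    also have "\<dots> = expectation (\<lambda>\<omega>. (B (l * t) \<omega> - B 0 \<omega>)\<^sup>2)"
      by (rule integral_cong_AE) (use lt B0 in \<open>auto elim!: eventually_mono\<close>)
    also have "\<dots> = incr_variance N B (l * t) 0" by (rule centered_gaussian_square(2)[OF G lt order_refl, symmetric])
    also have "\<dots> = (l * t) powr \<kappa>" using I[OF lt order_refl] lt by simp
    finally show ?thesis using l t by (simp add: powr_mult)
  qed
  show "incr_variance N (\<lambda>t. B (l * t)) s t = l powr \<kappa> * \<bar>s - t\<bar> powr \<kappa>" if "0 \<le> s" "0 \<le> t" for s t
  proof -
    have "incr_variance N (\<lambda>t. B (l * t)) s t = incr_variance N B (l * s) (l * t)" by (simp add: incr_variance_def)
    also have "\<dots> = \<bar>l * s - l * t\<bar> powr \<kappa>" using that l by (intro I) auto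
    also have "\<bar>l * s - l * t\<bar> = l * \<bar>s - t\<bar>" using l by (simp add: abs_mult flip: right_diff_distrib)
    finally show ?thesis using l by (simp add: powr_mult)
  qed
  show "berman_mean N (\<lambda>t. B (l * t)) x T = ennreal l * berman_mean N B (l * x) (l * T)" if T: "0 < T" for x T
  proof -
    have soj: "sojourn N B (l * T) y \<omega> = l * sojourn N (\<lambda>t. B (l * t)) T y \<omega>" for y \<omega>
    proof -
      define D where "D = {t. sqrt 2 * B t \<omega> - variance (B t) + y > 0}"
      have "sojourn N B (l * T) y \<omega> = (\<integral>t. indicator {0..l * T} t *\<^sub>R indicat_real D t \<partial>lborel)"
        by (simp add: sojourn_def set_lebesgue_integral_def D_def)
      also have "\<dots> = \<bar>l\<bar> *\<^sub>R (\<integral>t. indicator {0..l * T} (0 + l * t) *\<^sub>R indicat_real D (0 + l * t) \<partial>lborel)"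
        by (rule lborel_integral_real_affine) (use l in simp)
      also have "(\<integral>t. indicator {0..l * T} (0 + l * t) *\<^sub>R indicat_real D (0 + l * t) \<partial>lborel) = sojourn N (\<lambda>t. B (l * t)) T y \<omega>"
        unfolding sojourn_def set_lebesgue_integral_def
        by (intro Bochner_Integration.integral_cong) (use l in \<open>auto simp: D_def indicator_def zero_le_mult_iff\<close>)
      finally show ?thesis using l by simp
    qed
    have set_eq: "{\<omega>\<in>space N. sojourn N B (l * T) y \<omega> > l * x} = {\<omega>\<in>space N. sojourn N (\<lambda>t. B (l * t)) T y \<omega> > x}" for y
      unfolding soj using l by simp
    have "ennreal (1 / T) = ennreal l * ennreal (1 / (l * T))"
      using l T by (subst ennreal_mult[symmetric]) auto
    then show ?thesis
      unfolding berman_mean_def set_eq by (simp add: mult.assoc)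
  qed
qed

theorem theorem2p1:
  fixes M :: "'a measure" and Y :: "real \<Rightarrow> 'a \<Rightarrow> real"
    and N :: "'b measure" and B :: "real \<Rightarrow> 'b \<Rightarrow> real"
    and \<kappa> c x :: real
  assumes "0 < \<kappa>" and "\<kappa> \<le> 2" and "0 < c" and "0 \<le> x"
    and "S_class M Y \<kappa> \<kappa> c"
    and "standard_fBm N B \<kappa>"
  shows "berman_exists M Y x \<and>
    berman_exists N B (c powr (1 / \<kappa>) * x) \<and>
    berman M Y x = ennreal (c powr (1 / \<kappa>)) * berman N B (c powr (1 / \<kappa>) * x) \<and>
    0 < berman M Y x \<and> berman M Y x < \<infinity>"
proof -
  define l where "l = c powr (1 / \<kappa>)"
  have l: "0 < l" "l powr \<kappa> = c" using assms(1,3) by (auto simp: l_def powr_powr)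
  note fB = fBm_dilation[OF assms(1) l(1) assms(6), unfolded l(2)]
  have Y: "centered_gaussian_process M Y" "ae_continuous_paths M Y" using assms(5) by (auto simp: S_class_def)
  note Sv = S_class_variogram[OF assms(1,3,5)]
  obtain C1 C2 where C0: "0 < C1" "0 < C2"
    "\<forall>s\<ge>0. \<forall>t\<ge>0. C1 * \<bar>s - t\<bar> powr \<kappa> \<le> incr_variance M Y s t \<and> incr_variance M Y s t \<le> C2 * \<bar>s - t\<bar> powr \<kappa>"
    using Sv(2) by (elim exE conjE)
  then have C: "\<And>s t. 0 \<le> s \<Longrightarrow> 0 \<le> t \<Longrightarrow> C1 * \<bar>s - t\<bar> powr \<kappa> \<le> incr_variance M Y s t"
    "\<And>s t. 0 \<le> s \<Longrightarrow> 0 \<le> t \<Longrightarrow> incr_variance M Y s t \<le> C2 * \<bar>s - t\<bar> powr \<kappa>"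
    by simp_all
  have var1: "prob_space.variance M (Y t) = 1 * t powr \<kappa>" if "0 \<le> t" for t using Sv(1)[OF that] by simp
  obtain Z where Z: "brown_resnick M Z \<kappa> C1 C2 c"
    "\<And>s t. 0 \<le> s \<Longrightarrow> 0 \<le> t \<Longrightarrow> gaussian_paths.V M Z s t = incr_variance M Y s t"
    "\<And>x T. 0 \<le> T \<Longrightarrow> berman_mean M Y x T = ennreal (1 / T) * brown_resnick.exceedance M Z x T"
  proof (rule berman_mean_as_exceedance[OF Y var1 assms(1) C0(1,2) assms(3) C Sv(3)])
    fix Z assume "brown_resnick M Z \<kappa> C1 C2 c"
      "\<And>s t. 0 \<le> s \<Longrightarrow> 0 \<le> t \<Longrightarrow> gaussian_paths.V M Z s t = incr_variance M Y s t"
      "\<And>x T. 0 \<le> T \<Longrightarrow> berman_mean M Y x T = ennreal (1 / T) * brown_resnick.exceedance M Z x T"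
    then show thesis by (rule that)
  qed assumption+
  obtain Z' where Z': "brown_resnick N Z' \<kappa> c c c"
    "\<And>s t. 0 \<le> s \<Longrightarrow> 0 \<le> t \<Longrightarrow> gaussian_paths.V N Z' s t = incr_variance N (\<lambda>t. B (l * t)) s t"
    "\<And>x T. 0 \<le> T \<Longrightarrow> berman_mean N (\<lambda>t. B (l * t)) x T = ennreal (1 / T) * brown_resnick.exceedance N Z' x T"
  proof (rule berman_mean_as_exceedance[OF fB(1,2,3) assms(1,3,3,3)])
    fix s t :: real assume st: "0 \<le> s" "0 \<le> t"
    show "c * \<bar>s - t\<bar> powr \<kappa> \<le> incr_variance N (\<lambda>t. B (l * t)) s t" "incr_variance N (\<lambda>t. B (l * t)) s t \<le> c * \<bar>s - t\<bar> powr \<kappa>"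
      by (simp_all add: fB(4)[OF st])
    have "\<forall>\<^sub>F r in at_top. c * \<bar>s - t\<bar> powr \<kappa> = incr_variance N (\<lambda>t. B (l * t)) (r + s) (r + t)"
      using eventually_ge_at_top[of 0] by eventually_elim (use st fB(4) in simp)
    then show "((\<lambda>r. incr_variance N (\<lambda>t. B (l * t)) (r + s) (r + t)) \<longlongrightarrow> c * \<bar>s - t\<bar> powr \<kappa>) at_top"
      by (rule Lim_transform_eventually[OF tendsto_const])
  next
    fix Z assume "brown_resnick N Z \<kappa> c c c"
      "\<And>s t. 0 \<le> s \<Longrightarrow> 0 \<le> t \<Longrightarrow> gaussian_paths.V N Z s t = incr_variance N (\<lambda>t. B (l * t)) s t"
      "\<And>x T. 0 \<le> T \<Longrightarrow> berman_mean N (\<lambda>t. B (l * t)) x T = ennreal (1 / T) * brown_resnick.exceedance N Z x T"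
    then show thesis by (rule that)
  qed assumption+
  interpret X: brown_resnick M Z \<kappa> C1 C2 c by (rule Z(1))
  interpret R: brown_resnick N Z' \<kappa> c c c by (rule Z'(1))
  interpret P: brown_resnick_pair M Z \<kappa> C1 C2 c N Z' c c
    by unfold_locales (simp add: Z'(2) fB(4))
  obtain L where L: "0 < L" "((\<lambda>T. ennreal (1 / T) * X.exceedance x T) \<longlongrightarrow> ennreal L) at_top"
    "((\<lambda>T. ennreal (1 / T) * R.exceedance x T) \<longlongrightarrow> ennreal L) at_top"
    using P.exceedance_common_limit[OF assms(4)] by blast
  have limY: "(berman_mean M Y x \<longlongrightarrow> ennreal L) at_top"
    by (rule Lim_transform_eventually[OF L(2)])
       (use eventually_ge_at_top[of 0] in \<open>eventually_elim, simp add: Z(3)\<close>)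
  have limB': "((\<lambda>T. ennreal l * berman_mean N B (l * x) (l * T)) \<longlongrightarrow> ennreal L) at_top"
    by (rule Lim_transform_eventually[OF L(3)])
       (use eventually_gt_at_top[of 0] in \<open>eventually_elim, simp add: Z'(3)[symmetric] fB(5)\<close>)
  have limB: "(berman_mean N B (l * x) \<longlongrightarrow> ennreal (1 / l) * ennreal L) at_top"
  proof -
    have "filterlim (\<lambda>T. T / l) at_top at_top" using l(1) by real_asymp
    from filterlim_compose[OF limB' this]
    have "((\<lambda>T. ennreal l * berman_mean N B (l * x) T) \<longlongrightarrow> ennreal L) at_top" using l(1) by simp
    then have "((\<lambda>T. ennreal (1 / l) * (ennreal l * berman_mean N B (l * x) T)) \<longlongrightarrow> ennreal (1 / l) * ennreal L) at_top"
      by (intro ennreal_tendsto_cmult) auto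
    then show ?thesis using l(1) by (simp add: mult.assoc[symmetric] ennreal_mult[symmetric])
  qed
  have "berman M Y x = ennreal L" unfolding berman_def by (rule tendsto_Lim[OF _ limY]) simp
  moreover have "berman N B (l * x) = ennreal (1 / l) * ennreal L" unfolding berman_def by (rule tendsto_Lim[OF _ limB]) simp
  moreover have "ennreal l * (ennreal (1 / l) * ennreal L) = ennreal L"
    using l(1) L(1) by (simp flip: ennreal_mult)
  ultimately show ?thesis
    using limY limB L(1) unfolding berman_exists_def l_def[symmetric] by auto
qed

end
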